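(* For each prime power $q$, there are uncountably many local isomorphism classes of topologically simple totally disconnected locally compact groups of the form $\mathrm{AU}_{\Lambda}(\mathbb{F}_q)/\mathrm{Z}_{\Lambda}(\mathbb{F}_q)$ with $(\Lambda,\lesssim)$ a $\mathbb{Z}$-like preordered set.
   Context: Let $(\Lambda,\lesssim)$ be a preordered set ($\lesssim$ reflexive and transitive). Write $i\sim j$ if $i\lesssim j$ and $j\lesssim i$; $i\lnsim j$ if $i\lesssim j$ and $i\not\sim j$; $[i,j]=\{k\in\Lambda : i\lesssim k\lesssim j\}$. A subset $\Lambda'\subseteq\Lambda$ is convex if $[i,j]\subseteq\Lambda'$ whenever $i,j\in\Lambda'$; it is strongly convex if for every $i\in\Lambda\setminus\Lambda'$ either $i\lnsim j$ for all $j\in\Lambda'$, or $j\lnsim i$ for all $j\in\Lambda'$. $(\Lambda,\lesssim)$ is $\mathbb{Z}$-like if every finite subset of $\Lambda$ is contained in a finite strongly convex subset. A $(\Lambda\times\Lambda)$-matrix over a commutative unital ring $R$ is a tuple $(a_{ij})_{i,j\in\Lambda}$ of elements of $R$; $\mathrm{M}_\Lambda(R)$ is the set of these. The product of $(a_{ij})$ and $(b_{ij})$ is $(\sum_{k}a_{ik}b_{kj})_{i,j}$, defined only when each of these sums has finitely many nonzero terms. The matrix $(a_{ij})$ is nonsingular if there is a finite convex $\Lambda'\subseteq\Lambda$ such that $(a_{ij})_{i,j\in\Lambda''}$ is invertible over $R$ for every finite convex $\Lambda''\supseteq\Lambda'$; upper triangular if $a_{ij}=0$ whenever $i\not\lesssim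 j$; almost upper triangular if $a_{ij}=0$ for all but finitely many pairs $(i,j)$ with $i\not\lesssim j$; scalar if $a_{ij}=0$ for $i\neq j$ and $a_{ii}$ is constant. $\mathrm{U}_\Lambda(R)$, $\mathrm{AU}_\Lambda(R)$ and $\mathrm{Z}_\Lambda(R)$ are the groups (under matrix multiplication) of nonsingular upper triangular, nonsingular almost upper triangular, and nonsingular scalar matrices, respectively. Topology ($R$ discrete; finite fields are discrete): for any $\mathbb{Z}$-like preorder, $\mathrm{U}_\Lambda(R)$ carries the subspace topology from the product topology on $\mathrm{M}_\Lambda(R)=R^{\Lambda\times\Lambda}$. For a finite convex $\Lambda'\subseteq\Lambda$, $\Lambda+\Lambda'$ denotes the set $\Lambda$ with the smallest preorder containing $\lesssim$ and making all elements of $\Lambda'$ equivalent (it is again $\mathbb{Z}$-like). $\mathrm{AU}_\Lambda(R)$ is the union of its subgroups $\mathrm{U}_{\Lambda+\Lambda'}(R)$ and carries the unique group topology for which the inclusion of $\mathrm{U}_{\Lambda+\Lambda'}(R)$ into $\mathrm{AU}_\Lambda(R)$ is continuous and open for every finite convex $\Lambda'\subseteq\Lambda$. A local isomorphism of topological groups $G$ and $H$ is an open embedding $\phi:U\to H$, where $U$ is an open neighbourhood of the identity in $G$ and $\phi$ is compatible with the group operations as far as they are defined on $U$; $G$ and $H$ are locally isomorphic if there is a local isomorphism between them. A topological group is topologically simple if it is nontrivial and its only closed normal subgroups are the trivial subgroup and the whole group. *)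

theory Defs
  imports
    "HOL-Analysis.Analysis"
    "HOL-Algebra.Coset"
    "HOL-Number_Theory.Prime_Powers"
begin

section \<open>Preordered sets\<close>

text \<open>A preordered set is a pair \<open>(L, r)\<close> with \<^prop>\<open>preorder_on L r\<close>.\<close>

definition sim :: "'i rel \<Rightarrow> 'i \<Rightarrow> 'i \<Rightarrow> bool" where
  "sim r i j \<longleftrightarrow> (i, j) \<in> r \<and> (j, i) \<in> r"

definition strictly_below :: "'i rel \<Rightarrow> 'i \<Rightarrow> 'i \<Rightarrow> bool" where
  "strictly_below r i j \<longleftrightarrow> (i, j) \<in> r \<and> \<not> sim r i j"

definition interval :: "'i set \<Rightarrow> 'i rel \<Rightarrow> 'i \<Rightarrow> 'i \<Rightarrow> 'i set" where
  "interval L r i j = {k \<in> L. (i, k) \<in> r \<and> (k, j) \<in> r}"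

definition order_convex :: "'i set \<Rightarrow> 'i rel \<Rightarrow> 'i set \<Rightarrow> bool" where
  "order_convex L r S \<longleftrightarrow> S \<subseteq> L \<and> (\<forall>i\<in>S. \<forall>j\<in>S. interval L r i j \<subseteq> S)"

definition strongly_convex :: "'i set \<Rightarrow> 'i rel \<Rightarrow> 'i set \<Rightarrow> bool" where
  "strongly_convex L r S \<longleftrightarrow> S \<subseteq> L \<and>
     (\<forall>i\<in>L - S. (\<forall>j\<in>S. strictly_below r i j) \<or> (\<forall>j\<in>S. strictly_below r j i))"

definition Z_like :: "'i set \<Rightarrow> 'i rel \<Rightarrow> bool" where
  "Z_like L r \<longleftrightarrow> preorder_on L r \<and>
     (\<forall>F. finite F \<and> F \<subseteq> L \<longrightarrow> (\<exists>S. finite S \<and> F \<subseteq> S \<and> strongly_convex L r S))"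

text \<open>The preordered set denoted \<open>\<Lambda> + \<Lambda>'\<close>: the smallest preorder on \<open>L\<close> that contains \<open>r\<close> and
  makes all elements of \<open>S\<close> equivalent.\<close>

definition merge_preorder :: "'i set \<Rightarrow> 'i rel \<Rightarrow> 'i set \<Rightarrow> 'i rel" where
  "merge_preorder L r S = \<Inter>{r'. preorder_on L r' \<and> r \<subseteq> r' \<and> (\<forall>i\<in>S. \<forall>j\<in>S. sim r' i j)}"

lemma Z_like_converse:
  assumes "Z_like L r"
  shows "Z_like L (r\<inverse>)"
proof -
  have "preorder_on L (r\<inverse>)"
    using assms unfolding Z_like_def preorder_on_def refl_on_def by auto
  moreover have "strictly_below (r\<inverse>) i j \<longleftrightarrow> strictly_below r j i" for i j
    by (auto simp: strictly_below_def sim_def)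
  then have "strongly_convex L (r\<inverse>) S \<longleftrightarrow> strongly_convex L r S" for S
    unfolding strongly_convex_def by blast
  ultimately show ?thesis
    using assms unfolding Z_like_def by auto
qed

lemma Z_like_obtain:
  assumes "Z_like L r" "finite F" "F \<subseteq> L"
  obtains S where "finite S" "F \<subseteq> S" "strongly_convex L r S"
proof -
  have "\<exists>S. finite S \<and> F \<subseteq> S \<and> strongly_convex L r S"
    using assms by (simp add: Z_like_def)
  then show ?thesis
    using that by (elim exE conjE)
qed

lemma strongly_convexD:
  assumes "strongly_convex L r S" "i \<in> L" "i \<notin> S"
  shows "(\<forall>j\<in>S. (i, j) \<in> r \<and> (j, i) \<notin> r) \<or> (\<forall>j\<in>S. (j, i) \<in> r \<and> (i, j) \<notin> r)"
proof -
  have "strictly_below r a b \<longleftrightarrow> (a, b) \<in> r \<and> (b, a) \<notin> r" for a b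
    by (auto simp: strictly_below_def sim_def)
  then show ?thesis
    using assms by (simp add: strongly_convex_def)
qed

lemma strongly_convex_imp_order_convex:
  assumes S: "strongly_convex L r S"
  shows "order_convex L r S"
  unfolding order_convex_def
proof (intro conjI ballI subsetI)
  show "y \<in> L" if "y \<in> S" for y
    using S that by (auto simp: strongly_convex_def)
  show "y \<in> S" if ij: "i \<in> S" "j \<in> S" and "y \<in> interval L r i j" for i j y
  proof (rule ccontr)
    assume "y \<notin> S"
    moreover have y: "y \<in> L" "(i, y) \<in> r" "(y, j) \<in> r"
      using that(3) by (simp_all add: interval_def)
    ultimately show False
      using strongly_convexD[OF S, of y] ij by metis
  qed
qed

lemma Z_like_countable_above:
  assumes Z: "Z_like L r" and x: "x \<in> L"
  shows "countable {k. (x, k) \<in> r}"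
proof (cases "finite {k. (x, k) \<in> r}")
  case False
  let ?A = "{k. (x, k) \<in> r}"
  have rL: "r \<subseteq> L \<times> L"
    using Z by (simp add: Z_like_def preorder_on_def)
  have "finite {k \<in> ?A. card (interval L r x k) < n}" for n
  proof -
    obtain B where B: "B \<subseteq> ?A" "finite B" "card B = n"
      using infinite_arbitrarily_large[OF False] by metis
    then have "finite (insert x B)" "insert x B \<subseteq> L"
      using x rL by auto
    then obtain S where S: "finite S" "insert x B \<subseteq> S" "strongly_convex L r S"
      by (rule Z_like_obtain[OF Z])
    have "k \<in> S" if k: "(x, k) \<in> r" "card (interval L r x k) < n" for k
    proof (rule ccontr)
      assume nk: "k \<notin> S"
      have "k \<in> L"
        using k rL by auto
      then have above: "\<forall>j\<in>S. (j, k) \<in> r"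
        using strongly_convexD[OF S(3) _ nk] S(2) k(1) by auto
      obtain S' where S': "finite S'" "{x, k} \<subseteq> S'" "strongly_convex L r S'"
        using Z_like_obtain[OF Z, of "{x, k}"] x \<open>k \<in> L\<close> by auto
      have "interval L r x k \<subseteq> S'"
        using strongly_convex_imp_order_convex[OF S'(3)] S'(2) by (simp add: order_convex_def)
      then have "finite (interval L r x k)"
        using S'(1) finite_subset by blast
      moreover have "B \<subseteq> interval L r x k"
        using B(1) above S(2) rL unfolding interval_def by auto
      ultimately have "card B \<le> card (interval L r x k)"
        by (rule card_mono)
      then show False
        using k(2) B(3) by simp
    qed
    then have "{k \<in> ?A. card (interval L r x k) < n} \<subseteq> S"
      by blast
    then show ?thesis
      using S(1) by (rule finite_subset)
  qed
  then have "countable (\<Union>n. {k \<in> ?A. card (interval L r x k) < n})"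
    by (simp add: countable_finite)
  moreover have "?A = (\<Union>n. {k \<in> ?A. card (interval L r x k) < n})"
    by (auto intro: lessI)
  ultimately show ?thesis
    by simp
qed (rule countable_finite)

text \<open>Every \<open>\<int>\<close>-like preordered set is countable, so up to isomorphism the preordered sets on subsets
  of \<^typ>\<open>nat\<close> are all there are.\<close>

lemma Z_like_countable:
  assumes Z: "Z_like L r"
  shows "countable L"
proof (cases "L = {}")
  case False
  then obtain x where x: "x \<in> L" by blast
  obtain S where S: "finite S" "{x} \<subseteq> S" "strongly_convex L r S"
    using Z_like_obtain[OF Z, of "{x}"] x by auto
  have "L \<subseteq> S \<union> {k. (x, k) \<in> r} \<union> {k. (x, k) \<in> r\<inverse>}"
    using strongly_convexD[OF S(3)] S(2) by blast
  moreover have "countable (S \<union> {k. (x, k) \<in> r} \<union> {k. (x, k) \<in> r\<inverse>})"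
    using Z_like_countable_above[OF Z x] Z_like_countable_above[OF Z_like_converse[OF Z] x]
      countable_finite[OF S(1)] by blast
  ultimately show ?thesis
    by (rule countable_subset)
qed simp

section \<open>Matrices\<close>

text \<open>Matrices indexed by \<open>L \<times> L\<close> are extensional functions on \<open>L \<times> L\<close>, matching the
  underlying set of \<^const>\<open>product_topology\<close>.\<close>

definition matrices :: "'i set \<Rightarrow> ('i \<times> 'i \<Rightarrow> 'a) set" where
  "matrices L = (L \<times> L) \<rightarrow>\<^sub>E UNIV"

text \<open>The product is meaningful only if all the index sets below are finite, which is the case
  for all matrices in the groups considered here. An entry with infinitely many nonzero summands gets
  the junk value \<open>0\<close>.\<close>

definition mat_mult ::
    "'i set \<Rightarrow> ('i \<times> 'i \<Rightarrow> 'a::comm_ring_1) \<Rightarrow> ('i \<times> 'i \<Rightarrow> 'a) \<Rightarrow> ('i \<times> 'i \<Rightarrow> 'a)" where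
  "mat_mult L A B =
     (\<lambda>(i, j) \<in> L \<times> L. \<Sum>k \<in> {k \<in> L. A (i, k) * B (k, j) \<noteq> 0}. A (i, k) * B (k, j))"

definition mat_one :: "'i set \<Rightarrow> ('i \<times> 'i \<Rightarrow> 'a::comm_ring_1)" where
  "mat_one L = (\<lambda>(i, j) \<in> L \<times> L. if i = j then 1 else 0)"

definition mat_invertible :: "'i set \<Rightarrow> ('i \<times> 'i \<Rightarrow> 'a::comm_ring_1) \<Rightarrow> bool" where
  "mat_invertible S A \<longleftrightarrow>
     (\<exists>B \<in> matrices S. mat_mult S A B = mat_one S \<and> mat_mult S B A = mat_one S)"

definition nonsingular :: "'i set \<Rightarrow> 'i rel \<Rightarrow> ('i \<times> 'i \<Rightarrow> 'a::comm_ring_1) \<Rightarrow> bool" where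
  "nonsingular L r A \<longleftrightarrow>
     (\<exists>S. finite S \<and> order_convex L r S \<and>
        (\<forall>S'. finite S' \<and> order_convex L r S' \<and> S \<subseteq> S' \<longrightarrow>
           mat_invertible S' (restrict A (S' \<times> S'))))"

definition upper_triangular :: "'i set \<Rightarrow> 'i rel \<Rightarrow> ('i \<times> 'i \<Rightarrow> 'a::comm_ring_1) \<Rightarrow> bool" where
  "upper_triangular L r A \<longleftrightarrow> (\<forall>i\<in>L. \<forall>j\<in>L. (i, j) \<notin> r \<longrightarrow> A (i, j) = 0)"

definition almost_upper_triangular ::
    "'i set \<Rightarrow> 'i rel \<Rightarrow> ('i \<times> 'i \<Rightarrow> 'a::comm_ring_1) \<Rightarrow> bool" where
  "almost_upper_triangular L r A \<longleftrightarrow>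
     finite {(i, j) \<in> L \<times> L. (i, j) \<notin> r \<and> A (i, j) \<noteq> 0}"

definition scalar_matrix :: "'i set \<Rightarrow> ('i \<times> 'i \<Rightarrow> 'a::comm_ring_1) \<Rightarrow> bool" where
  "scalar_matrix L A \<longleftrightarrow>
     (\<forall>i\<in>L. \<forall>j\<in>L. i \<noteq> j \<longrightarrow> A (i, j) = 0) \<and> (\<forall>i\<in>L. \<forall>j\<in>L. A (i, i) = A (j, j))"

definition U_group :: "'i set \<Rightarrow> 'i rel \<Rightarrow> ('i \<times> 'i \<Rightarrow> 'a::comm_ring_1) monoid" where
  "U_group L r =
     \<lparr>carrier = {A \<in> matrices L. nonsingular L r A \<and> upper_triangular L r A},
      mult = mat_mult L, one = mat_one L\<rparr>"

definition AU_group :: "'i set \<Rightarrow> 'i rel \<Rightarrow> ('i \<times> 'i \<Rightarrow> 'a::comm_ring_1) monoid" where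
  "AU_group L r =
     \<lparr>carrier = {A \<in> matrices L. nonsingular L r A \<and> almost_upper_triangular L r A},
      mult = mat_mult L, one = mat_one L\<rparr>"

definition Z_subgroup :: "'i set \<Rightarrow> 'i rel \<Rightarrow> ('i \<times> 'i \<Rightarrow> 'a::comm_ring_1) set" where
  "Z_subgroup L r = {A \<in> matrices L. nonsingular L r A \<and> scalar_matrix L A}"

section \<open>Topological groups\<close>

definition topological_group :: "'g monoid \<Rightarrow> 'g topology \<Rightarrow> bool" where
  "topological_group G T \<longleftrightarrow> group G \<and> topspace T = carrier G \<and>
     continuous_map (prod_topology T T) T (\<lambda>(x, y). x \<otimes>\<^bsub>G\<^esub> y) \<and>
     continuous_map T T (\<lambda>x. inv\<^bsub>G\<^esub> x)"

definition totally_disconnected_space :: "'a topology \<Rightarrow> bool" where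
  "totally_disconnected_space T \<longleftrightarrow> (\<forall>S. connectedin T S \<longrightarrow> (\<forall>x\<in>S. \<forall>y\<in>S. x = y))"

text \<open>No Hausdorff condition is needed: in a totally disconnected space points are closed, and a
  topological group whose points are closed is Hausdorff.\<close>

definition tdlc_group :: "'g monoid \<Rightarrow> 'g topology \<Rightarrow> bool" where
  "tdlc_group G T \<longleftrightarrow>
     topological_group G T \<and> totally_disconnected_space T \<and> locally_compact_space T"

definition topologically_simple :: "'g monoid \<Rightarrow> 'g topology \<Rightarrow> bool" where
  "topologically_simple G T \<longleftrightarrow> topological_group G T \<and> carrier G \<noteq> {\<one>\<^bsub>G\<^esub>} \<and>
     (\<forall>N. N \<lhd> G \<and> closedin T N \<longrightarrow> N = {\<one>\<^bsub>G\<^esub>} \<or> N = carrier G)"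

definition local_isomorphism ::
    "'g monoid \<Rightarrow> 'g topology \<Rightarrow> 'h monoid \<Rightarrow> 'h topology \<Rightarrow> 'g set \<Rightarrow> ('g \<Rightarrow> 'h) \<Rightarrow> bool" where
  "local_isomorphism G T H T' U \<phi> \<longleftrightarrow>
     openin T U \<and> \<one>\<^bsub>G\<^esub> \<in> U \<and>
     embedding_map (subtopology T U) T' \<phi> \<and> open_map (subtopology T U) T' \<phi> \<and>
     \<phi> \<one>\<^bsub>G\<^esub> = \<one>\<^bsub>H\<^esub> \<and>
     (\<forall>x\<in>U. \<forall>y\<in>U. x \<otimes>\<^bsub>G\<^esub> y \<in> U \<longrightarrow> \<phi> (x \<otimes>\<^bsub>G\<^esub> y) = \<phi> x \<otimes>\<^bsub>H\<^esub> \<phi> y) \<and>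
     (\<forall>x\<in>U. inv\<^bsub>G\<^esub> x \<in> U \<longrightarrow> \<phi> (inv\<^bsub>G\<^esub> x) = inv\<^bsub>H\<^esub> (\<phi> x))"

definition locally_isomorphic ::
    "'g monoid \<times> 'g topology \<Rightarrow> 'h monoid \<times> 'h topology \<Rightarrow> bool" where
  "locally_isomorphic X Y \<longleftrightarrow>
     (\<exists>U \<phi>. local_isomorphism (fst X) (snd X) (fst Y) (snd Y) U \<phi>)"

definition local_isomorphism_classes ::
    "('g monoid \<times> 'g topology) set \<Rightarrow> ('g monoid \<times> 'g topology) set set" where
  "local_isomorphism_classes \<G> =
     \<G> // {(X, Y). X \<in> \<G> \<and> Y \<in> \<G> \<and> locally_isomorphic X Y}"

definition quotient_group_topology :: "'g monoid \<Rightarrow> 'g topology \<Rightarrow> 'g set \<Rightarrow> 'g set topology" where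
  "quotient_group_topology G T N =
     topology (\<lambda>V. V \<subseteq> carrier (G Mod N) \<and> openin T {x \<in> topspace T. N #>\<^bsub>G\<^esub> x \<in> V})"

lemma openin_quotient_group_topology:
  "openin (quotient_group_topology G T N) V \<longleftrightarrow>
     V \<subseteq> carrier (G Mod N) \<and> openin T {x \<in> topspace T. N #>\<^bsub>G\<^esub> x \<in> V}"
proof -
  have "istopology (\<lambda>V. V \<subseteq> carrier (G Mod N) \<and> openin T {x \<in> topspace T. N #>\<^bsub>G\<^esub> x \<in> V})"
    unfolding istopology_def
  proof (intro conjI allI impI)
    fix V W
    assume "V \<subseteq> carrier (G Mod N) \<and> openin T {x \<in> topspace T. N #>\<^bsub>G\<^esub> x \<in> V}"
      and "W \<subseteq> carrier (G Mod N) \<and> openin T {x \<in> topspace T. N #>\<^bsub>G\<^esub> x \<in> W}"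
    moreover have "{x \<in> topspace T. N #>\<^bsub>G\<^esub> x \<in> V \<inter> W} =
        {x \<in> topspace T. N #>\<^bsub>G\<^esub> x \<in> V} \<inter> {x \<in> topspace T. N #>\<^bsub>G\<^esub> x \<in> W}"
      by auto
    ultimately show "V \<inter> W \<subseteq> carrier (G Mod N)"
      and "openin T {x \<in> topspace T. N #>\<^bsub>G\<^esub> x \<in> V \<inter> W}"
      by (auto intro: openin_Int)
  next
    fix \<K>
    assume *: "\<forall>V\<in>\<K>. V \<subseteq> carrier (G Mod N) \<and> openin T {x \<in> topspace T. N #>\<^bsub>G\<^esub> x \<in> V}"
    then show "\<Union>\<K> \<subseteq> carrier (G Mod N)"
      by auto
    have "{x \<in> topspace T. N #>\<^bsub>G\<^esub> x \<in> \<Union>\<K>} = (\<Union>V\<in>\<K>. {x \<in> topspace T. N #>\<^bsub>G\<^esub> x \<in> V})"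
      by auto
    then show "openin T {x \<in> topspace T. N #>\<^bsub>G\<^esub> x \<in> \<Union>\<K>}"
      using * by auto
  qed
  then show ?thesis
    unfolding quotient_group_topology_def by simp
qed

section \<open>The topological groups \<open>AU / Z\<close>\<close>

definition U_topology :: "'i set \<Rightarrow> 'i rel \<Rightarrow> ('i \<times> 'i \<Rightarrow> 'a::comm_ring_1) topology" where
  "U_topology L r =
     subtopology (product_topology (\<lambda>_. discrete_topology UNIV) (L \<times> L)) (carrier (U_group L r))"

text \<open>For \<open>\<int>\<close>-like \<open>(L, r)\<close> there is exactly one topology of this kind, so that the definite
  description is proper.\<close>

definition AU_topology :: "'i set \<Rightarrow> 'i rel \<Rightarrow> ('i \<times> 'i \<Rightarrow> 'a::comm_ring_1) topology" where
  "AU_topology L r = (THE T. topological_group (AU_group L r) T \<and>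
     (\<forall>S. finite S \<and> order_convex L r S \<longrightarrow>
        continuous_map (U_topology L (merge_preorder L r S)) T (\<lambda>A. A) \<and>
        open_map (U_topology L (merge_preorder L r S)) T (\<lambda>A. A)))"

definition PAU_group :: "'i set \<Rightarrow> 'i rel \<Rightarrow> ('i \<times> 'i \<Rightarrow> 'a::comm_ring_1) set monoid" where
  "PAU_group L r = AU_group L r Mod Z_subgroup L r"

definition PAU_topology :: "'i set \<Rightarrow> 'i rel \<Rightarrow> ('i \<times> 'i \<Rightarrow> 'a::comm_ring_1) set topology" where
  "PAU_topology L r = quotient_group_topology (AU_group L r) (AU_topology L r) (Z_subgroup L r)"

end

theory Submission
  imports Defs "HOL-Library.Function_Algebras"
begin

text \<open>Take \<open>\<Lambda>\<close> to be a chain of type \<open>\<omega>\<close> of finite blocks of equivalent elements. For an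
  infinite set \<open>A\<close> of natural numbers, let block \<open>n\<close> have three elements if \<open>n \<in> A\<close> and two
  otherwise. The congruence subgroups \<open>V m\<close>, consisting of the upper triangular matrices whose
  first \<open>m\<close> blocks of columns agree with the identity, form a basis of identity neighbourhoods, and
  \<open>V m\<close> is normal in the subgroup of matrices that are upper triangular outside the first \<open>m\<close> blocks.

  A subgroup normalised by some \<open>V j\<close> that contains a nontrivial element of \<open>V j\<close> contains all
  matrices \<open>1 + x v\<close> for a fixed nonzero column \<open>x\<close> and all rows \<open>v\<close> that vanish on sufficiently many
  blocks. For a non-central normal subgroup this produces all elementary matrices, which generate a
  dense subgroup. For a local isomorphism it transports the additive group of rows on one side to
  that on the other. The nonzero subgroups of rows invariant under \<open>V k\<close> are exactly the groups
  \<open>Row t\<close> of rows that vanish on the first \<open>t\<close> blocks (\<open>t \<ge> k\<close>), and the index of \<open>Row (t + 1)\<close> in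
  \<open>Row t\<close> determines the size of block \<open>t\<close>. So a local isomorphism identifies the two sequences of
  block sizes up to deleting initial segments, and each local isomorphism class contains only
  countably many of these groups.\<close>

section \<open>Group topologies given by a filtration\<close>

text \<open>A local isomorphism preserves only products near the identity, so the invariant has to
  be expressible inside arbitrarily small congruence subgroups, where neither the field nor the
  matrix entries are visible. What survives is the condition of being normalised by some
  \<open>V j\<close>, and it is strong enough to force transvections \<open>1 + x v\<close> into a
  nontrivial subgroup. The correspondence of rows obtained this way is only known to be additive, so
  block sizes are recovered by counting; this works because both sides have the same finite field.
  Every block has at least two elements so that shears inside a block are available; with them no
  diagonal matrices enter. The sizes two and three are the least ones that let a block encode one
  bit. Scalars meet \<open>V 1\<close> trivially, so the quotient by them does not affect local
  questions.\<close>

definition filtration_topology :: "'g monoid \<Rightarrow> (nat \<Rightarrow> 'g set) \<Rightarrow> 'g topology" where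
  "filtration_topology G V =
     topology (\<lambda>W. W \<subseteq> carrier G \<and> (\<forall>x\<in>W. \<exists>n. \<forall>v\<in>V n. x \<otimes>\<^bsub>G\<^esub> v \<in> W))"

text \<open>\<open>V_conj\<close> asks only that conjugates of some smaller \<open>V m\<close> lie
  in \<open>V n\<close>. Normality would be too strong: in the application a given element is in
  general only known to normalise \<open>V m\<close> for large \<open>m\<close>.\<close>

locale filtered_group = group G for G :: "'a monoid" (structure) +
  fixes V :: "nat \<Rightarrow> 'a set"
  assumes V_subgroup: "subgroup (V n) G"
    and V_antimono: "m \<le> n \<Longrightarrow> V n \<subseteq> V m"
    and V_conj: "x \<in> carrier G \<Longrightarrow> \<exists>m. \<forall>v\<in>V m. x \<otimes> v \<otimes> inv x \<in> V n"
begin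

lemma cancel [simp]:
  assumes "x \<in> carrier G" "y \<in> carrier G"
  shows "x \<otimes> (inv x \<otimes> y) = y" "inv x \<otimes> (x \<otimes> y) = y"
  using assms by (simp_all flip: m_assoc)

abbreviation T where "T \<equiv> filtration_topology G V"

lemma V_carrier: "v \<in> V n \<Longrightarrow> v \<in> carrier G"
  using V_subgroup subgroup.mem_carrier by metis

lemma V_one: "\<one> \<in> V n"
  using V_subgroup subgroup.one_closed by metis

lemma V_mult: "u \<in> V n \<Longrightarrow> v \<in> V n \<Longrightarrow> u \<otimes> v \<in> V n"
  using V_subgroup subgroup.m_closed by metis

lemma V_inv: "u \<in> V n \<Longrightarrow> inv u \<in> V n"
  using V_subgroup subgroup.m_inv_closed by metis

lemma openin_T: "openin T W \<longleftrightarrow> W \<subseteq> carrier G \<and> (\<forall>x\<in>W. \<exists>n. \<forall>v\<in>V n. x \<otimes> v \<in> W)"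
proof -
  have "istopology (\<lambda>W. W \<subseteq> carrier G \<and> (\<forall>x\<in>W. \<exists>n. \<forall>v\<in>V n. x \<otimes> v \<in> W))"
    unfolding istopology_def
  proof (intro conjI allI impI)
    fix A B
    assume A: "A \<subseteq> carrier G \<and> (\<forall>x\<in>A. \<exists>n. \<forall>v\<in>V n. x \<otimes> v \<in> A)"
      and B: "B \<subseteq> carrier G \<and> (\<forall>x\<in>B. \<exists>n. \<forall>v\<in>V n. x \<otimes> v \<in> B)"
    show "A \<inter> B \<subseteq> carrier G"
      using A by blast
    show "\<forall>x\<in>A \<inter> B. \<exists>n. \<forall>v\<in>V n. x \<otimes> v \<in> A \<inter> B"
    proof
      fix x assume "x \<in> A \<inter> B"
      then obtain m n where m: "\<forall>v\<in>V m. x \<otimes> v \<in> A" and n: "\<forall>v\<in>V n. x \<otimes> v \<in> B"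
        using A B by blast
      then have "\<forall>v\<in>V (max m n). x \<otimes> v \<in> A \<inter> B"
        using V_antimono[of m "max m n"] V_antimono[of n "max m n"] by auto
      then show "\<exists>n. \<forall>v\<in>V n. x \<otimes> v \<in> A \<inter> B" ..
    qed
  next
    fix \<K>
    assume K: "\<forall>W\<in>\<K>. W \<subseteq> carrier G \<and> (\<forall>x\<in>W. \<exists>n. \<forall>v\<in>V n. x \<otimes> v \<in> W)"
    then show "\<Union> \<K> \<subseteq> carrier G"
      by blast
    show "\<forall>x\<in>\<Union> \<K>. \<exists>n. \<forall>v\<in>V n. x \<otimes> v \<in> \<Union> \<K>"
    proof
      fix x assume "x \<in> \<Union> \<K>"
      then obtain W where W: "W \<in> \<K>" "x \<in> W" by blast
      then obtain n where "\<forall>v\<in>V n. x \<otimes> v \<in> W"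
        using K by meson
      then show "\<exists>n. \<forall>v\<in>V n. x \<otimes> v \<in> \<Union> \<K>"
        using W by blast
    qed
  qed
  then show ?thesis
    unfolding filtration_topology_def by simp
qed

lemma topspace_T: "topspace T = carrier G"
proof -
  have "openin T (carrier G)"
    unfolding openin_T using V_carrier by blast
  then show ?thesis
    using openin_subset[of T "carrier G"] openin_topspace[of T] unfolding openin_T by blast
qed

lemma openin_coset:
  assumes "x \<in> carrier G"
  shows "openin T ((\<lambda>v. x \<otimes> v) ` V n)"
  unfolding openin_T
proof (intro conjI ballI exI)
  show "(\<lambda>v. x \<otimes> v) ` V n \<subseteq> carrier G"
    using assms V_carrier by auto
  fix y v assume y: "y \<in> (\<lambda>v. x \<otimes> v) ` V n" and v: "v \<in> V n"
  then obtain u where u: "u \<in> V n" "y = x \<otimes> u" by blast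
  then have "y \<otimes> v = x \<otimes> (u \<otimes> v)"
    using v assms V_carrier by (simp add: m_assoc)
  then show "y \<otimes> v \<in> (\<lambda>v. x \<otimes> v) ` V n"
    using u v V_mult by blast
qed

lemma openin_V: "openin T (V n)"
proof -
  have "(\<lambda>v. \<one> \<otimes> v) ` V n = V n"
    using V_carrier by (auto simp: image_iff)
  then show ?thesis
    using openin_coset[of \<one> n] by simp
qed

lemma coset_self: "x \<in> carrier G \<Longrightarrow> x \<in> (\<lambda>v. x \<otimes> v) ` V n"
  using V_one by (metis image_eqI r_one)

lemma continuous_translation:
  assumes a: "a \<in> carrier G"
  shows "continuous_map T T (\<lambda>x. a \<otimes> x)"
  unfolding continuous_map_def topspace_T
proof (intro conjI allI impI)
  show "(\<lambda>x. a \<otimes> x) \<in> carrier G \<rightarrow> carrier G"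
    using a by auto
  fix W assume W: "openin T W"
  show "openin T {x \<in> carrier G. a \<otimes> x \<in> W}"
    unfolding openin_T
  proof (intro conjI ballI)
    fix x assume x: "x \<in> {x \<in> carrier G. a \<otimes> x \<in> W}"
    then obtain n where "\<forall>v\<in>V n. a \<otimes> x \<otimes> v \<in> W"
      using W unfolding openin_T by blast
    then have "\<forall>v\<in>V n. x \<otimes> v \<in> {x \<in> carrier G. a \<otimes> x \<in> W}"
      using x a V_carrier by (auto simp: m_assoc)
    then show "\<exists>n. \<forall>v\<in>V n. x \<otimes> v \<in> {x \<in> carrier G. a \<otimes> x \<in> W}" ..
  qed auto
qed

theorem topological_group_T: "topological_group G T"
  unfolding topological_group_def
proof (intro conjI)
  show "group G" by (rule is_group)
  show "topspace T = carrier G" by (rule topspace_T)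
  show "continuous_map (prod_topology T T) T (\<lambda>(x, y). x \<otimes> y)"
    unfolding continuous_map_def topspace_prod_topology topspace_T
  proof (intro conjI allI impI)
    show "(\<lambda>(x, y). x \<otimes> y) \<in> carrier G \<times> carrier G \<rightarrow> carrier G"
      by auto
    fix W assume W: "openin T W"
    show "openin (prod_topology T T)
        {p \<in> carrier G \<times> carrier G. (case p of (x, y) \<Rightarrow> x \<otimes> y) \<in> W}"
      unfolding openin_prod_topology_alt
    proof (intro allI impI)
      fix x y assume "(x, y) \<in> {p \<in> carrier G \<times> carrier G. (case p of (x, y) \<Rightarrow> x \<otimes> y) \<in> W}"
      then have x: "x \<in> carrier G" and y: "y \<in> carrier G" and xy: "x \<otimes> y \<in> W"
        by auto
      obtain n where n: "\<forall>v\<in>V n. x \<otimes> y \<otimes> v \<in> W"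
        using W xy unfolding openin_T by blast
      \<comment> \<open>Moving \<open>v\<close> past \<open>y\<close> turns it into
        \<open>inv y \<otimes> v \<otimes> y\<close>, so the neighbourhood of \<open>x\<close> is
        chosen by conjugation with \<open>inv y\<close>.\<close>
      obtain m where m: "\<forall>v\<in>V m. inv y \<otimes> v \<otimes> inv (inv y) \<in> V n"
        using V_conj[of "inv y" n] y by auto
      have "x \<otimes> v \<otimes> (y \<otimes> u) \<in> W" if "v \<in> V m" "u \<in> V n" for u v
      proof -
        have c: "u \<in> carrier G" "v \<in> carrier G"
          using that V_carrier by auto
        have "inv y \<otimes> v \<otimes> y \<otimes> u \<in> V n"
          using m that y V_mult by auto
        then have "x \<otimes> y \<otimes> (inv y \<otimes> v \<otimes> y \<otimes> u) \<in> W"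
          using n by blast
        moreover have "x \<otimes> y \<otimes> (inv y \<otimes> v \<otimes> y \<otimes> u) = x \<otimes> v \<otimes> (y \<otimes> u)"
          using c x y by (simp add: m_assoc)
        ultimately show ?thesis by simp
      qed
      then have "(\<lambda>v. x \<otimes> v) ` V m \<times> (\<lambda>v. y \<otimes> v) ` V n \<subseteq>
          {p \<in> carrier G \<times> carrier G. (case p of (x, y) \<Rightarrow> x \<otimes> y) \<in> W}"
        using x y V_carrier by auto
      then show "\<exists>P Q. openin T P \<and> openin T Q \<and> x \<in> P \<and> y \<in> Q \<and> P \<times> Q \<subseteq>
          {p \<in> carrier G \<times> carrier G. (case p of (x, y) \<Rightarrow> x \<otimes> y) \<in> W}"
        using openin_coset[OF x, of m] openin_coset[OF y, of n] coset_self[OF x, of m]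
          coset_self[OF y, of n] by (intro exI conjI)
    qed
  qed
  show "continuous_map T T (\<lambda>x. inv x)"
    unfolding continuous_map_def topspace_T
  proof (intro conjI allI impI)
    show "(\<lambda>x. inv x) \<in> carrier G \<rightarrow> carrier G"
      by auto
    fix W assume W: "openin T W"
    show "openin T {x \<in> carrier G. inv x \<in> W}"
      unfolding openin_T
    proof (intro conjI ballI)
      fix x assume x: "x \<in> {x \<in> carrier G. inv x \<in> W}"
      then obtain n where n: "\<forall>v\<in>V n. inv x \<otimes> v \<in> W"
        using W unfolding openin_T by blast
      obtain m where m: "\<forall>v\<in>V m. x \<otimes> v \<otimes> inv x \<in> V n"
        using V_conj[of x n] x by blast
      have "inv (x \<otimes> v) \<in> W" if "v \<in> V m" for v
      proof -
        have c: "v \<in> carrier G" "x \<in> carrier G"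
          using that V_carrier x by auto
        have "x \<otimes> inv v \<otimes> inv x \<in> V n"
          using m that V_inv by blast
        then have "inv x \<otimes> (x \<otimes> inv v \<otimes> inv x) \<in> W"
          using n by blast
        then show ?thesis
          using c by (simp add: inv_mult_group m_assoc)
      qed
      then have "\<forall>v\<in>V m. x \<otimes> v \<in> {x \<in> carrier G. inv x \<in> W}"
        using x V_carrier by auto
      then show "\<exists>n. \<forall>v\<in>V n. x \<otimes> v \<in> {x \<in> carrier G. inv x \<in> W}" ..
    qed auto
  qed
qed

text \<open>If \<open>inv x \<otimes> y\<close> is outside \<open>V n\<close>, the coset of
  \<open>x\<close> modulo \<open>V n\<close> is clopen and separates \<open>x\<close> from
  \<open>y\<close>.\<close>

lemma totally_disconnected_T:
  assumes triv: "(\<Inter>n. V n) = {\<one>}"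
  shows "totally_disconnected_space T"
  unfolding totally_disconnected_space_def
proof (intro allI impI ballI)
  fix S x y assume S: "connectedin T S" and x: "x \<in> S" and y: "y \<in> S"
  have Sc: "S \<subseteq> carrier G"
    using S topspace_T connectedin_subset_topspace by metis
  then have c: "x \<in> carrier G" "y \<in> carrier G"
    using x y by auto
  show "x = y"
  proof (rule ccontr)
    assume "x \<noteq> y"
    then have "inv x \<otimes> y \<noteq> \<one>"
      using c by (metis cancel(1) inv_closed r_one)
    then obtain n where n: "inv x \<otimes> y \<notin> V n"
      using triv by blast
    let ?A = "(\<lambda>v. x \<otimes> v) ` V n"
    let ?B = "carrier G - ?A"
    have "openin T ?B"
      unfolding openin_T
    proof (intro conjI ballI exI)
      fix z v assume z: "z \<in> ?B" and v: "v \<in> V n"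
      have "z \<otimes> v \<notin> ?A"
      proof
        assume "z \<otimes> v \<in> ?A"
        then obtain u where u: "u \<in> V n" "z \<otimes> v = x \<otimes> u" by blast
        have cc: "u \<in> carrier G" "v \<in> carrier G" "z \<in> carrier G"
          using z v u(1) V_carrier by auto
        have "z = z \<otimes> v \<otimes> inv v"
          using cc by (simp add: m_assoc)
        also have "\<dots> = x \<otimes> (u \<otimes> inv v)"
          using cc c u(2) by (simp add: m_assoc)
        finally have "z = x \<otimes> (u \<otimes> inv v)" .
        then show False
          using z u v V_inv V_mult by blast
      qed
      then show "z \<otimes> v \<in> ?B"
        using z v V_carrier by auto
    qed blast
    moreover have "openin T ?A"
      using openin_coset c by blast
    moreover have "y \<in> ?B"
      using n c V_carrier by auto
    moreover have "S \<subseteq> ?A \<union> ?B" "?A \<inter> ?B \<inter> S = {}"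
      using Sc by auto
    ultimately show False
      using S x y coset_self[OF c(1), of n] unfolding connectedin by blast
  qed
qed

lemma locally_compact_T:
  assumes "compactin T K" "V n \<subseteq> K"
  shows "locally_compact_space T"
  unfolding locally_compact_space_def topspace_T
proof
  fix x assume x: "x \<in> carrier G"
  have "compactin T ((\<lambda>v. x \<otimes> v) ` K)"
    using image_compactin[OF assms(1) continuous_translation[OF x]] .
  moreover have "(\<lambda>v. x \<otimes> v) ` V n \<subseteq> (\<lambda>v. x \<otimes> v) ` K"
    using assms(2) by blast
  ultimately show "\<exists>U K. openin T U \<and> compactin T K \<and> x \<in> U \<and> U \<subseteq> K"
    using openin_coset[OF x, of n] coset_self[OF x, of n] by blast
qed

lemma closedin_mem:
  assumes "closedin T N" and "x \<in> carrier G" and "\<And>n. \<exists>v\<in>V n. x \<otimes> v \<in> N"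
  shows "x \<in> N"
proof (rule ccontr)
  assume "x \<notin> N"
  then have "x \<in> carrier G - N" "openin T (carrier G - N)"
    using assms topspace_T by (auto simp: closedin_def)
  then show False
    using assms(3) openin_T[of "carrier G - N"] by (meson Diff_iff)
qed

text \<open>Openness of a preimage can be tested on cosets, so the quotient topology again comes
  from a filtration, namely from the images of the \<open>V n\<close>. The results of this locale
  thereby apply to \<open>PAU_group\<close> as well.\<close>

lemma quotient_filtered_group:
  assumes N: "N \<lhd> G"
  shows "filtered_group (G Mod N) (\<lambda>n. (\<lambda>v. N #> v) ` V n)"
    and "quotient_group_topology G T N = filtration_topology (G Mod N) (\<lambda>n. (\<lambda>v. N #> v) ` V n)"
proof -
  interpret N: normal N G by (rule N)
  interpret Q: group "G Mod N" by (rule N.factorgroup_is_group)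
  have hom: "(\<lambda>v. N #> v) \<in> hom G (G Mod N)"
    using N.r_coset_hom_Mod by simp
  interpret h: group_hom G "G Mod N" "\<lambda>v. N #> v"
    by (intro group_hom.intro group_hom_axioms.intro hom is_group Q.is_group)
  have Qcar: "carrier (G Mod N) = (\<lambda>v. N #> v) ` carrier G"
    by (auto simp: FactGroup_def RCOSETS_def)
  show F: "filtered_group (G Mod N) (\<lambda>n. (\<lambda>v. N #> v) ` V n)"
  proof (intro filtered_group.intro filtered_group_axioms.intro Q.is_group)
    show "subgroup ((\<lambda>v. N #> v) ` V n) (G Mod N)" for n
      by (rule h.subgroup_img_is_subgroup[OF V_subgroup])
    show "(\<lambda>v. N #> v) ` V n \<subseteq> (\<lambda>v. N #> v) ` V m" if "m \<le> n" for m n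
      using V_antimono[OF that] by blast
    fix X n assume "X \<in> carrier (G Mod N)"
    then obtain x where x: "x \<in> carrier G" "X = N #> x"
      using Qcar by blast
    obtain m where m: "\<forall>v\<in>V m. x \<otimes> v \<otimes> inv x \<in> V n"
      using V_conj[OF x(1)] by blast
    have "X \<otimes>\<^bsub>G Mod N\<^esub> (N #> v) \<otimes>\<^bsub>G Mod N\<^esub> inv\<^bsub>G Mod N\<^esub> X = N #> (x \<otimes> v \<otimes> inv x)"
      if "v \<in> V m" for v
      using x V_carrier[OF that] by simp
    then show "\<exists>m. \<forall>v\<in>(\<lambda>v. N #> v) ` V m.
        X \<otimes>\<^bsub>G Mod N\<^esub> v \<otimes>\<^bsub>G Mod N\<^esub> inv\<^bsub>G Mod N\<^esub> X \<in> (\<lambda>v. N #> v) ` V n"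
      using m by (intro exI[of _ m]) auto
  qed
  interpret F: filtered_group "G Mod N" "\<lambda>n. (\<lambda>v. N #> v) ` V n" by (rule F)
  have *: "openin T {x \<in> carrier G. N #> x \<in> W} \<longleftrightarrow>
      (\<forall>X\<in>W. \<exists>n. \<forall>v\<in>(\<lambda>v. N #> v) ` V n. X \<otimes>\<^bsub>G Mod N\<^esub> v \<in> W)"
    if W: "W \<subseteq> carrier (G Mod N)" for W
  proof -
    have "openin T {x \<in> carrier G. N #> x \<in> W} \<longleftrightarrow>
        (\<forall>x\<in>carrier G. N #> x \<in> W \<longrightarrow> (\<exists>n. \<forall>v\<in>V n. N #> (x \<otimes> v) \<in> W))"
      unfolding openin_T using V_carrier by auto
    also have "\<dots> \<longleftrightarrow>
        (\<forall>x\<in>carrier G. N #> x \<in> W \<longrightarrow> (\<exists>n. \<forall>v\<in>V n. (N #> x) \<otimes>\<^bsub>G Mod N\<^esub> (N #> v) \<in> W))"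
      using V_carrier by (intro ball_cong imp_cong ex_cong1 refl) (metis h.hom_mult)
    also have "\<dots> \<longleftrightarrow> (\<forall>X\<in>W. \<exists>n. \<forall>v\<in>(\<lambda>v. N #> v) ` V n. X \<otimes>\<^bsub>G Mod N\<^esub> v \<in> W)"
      using W unfolding Qcar by blast
    finally show ?thesis .
  qed
  show "quotient_group_topology G T N = F.T"
    unfolding topology_eq openin_quotient_group_topology F.openin_T topspace_T
    using * by blast
qed

lemma continuous_map_quotient:
  "continuous_map T (quotient_group_topology G T N) (\<lambda>x. N #> x)"
proof -
  have "{x \<in> carrier G. N #> x \<in> carrier (G Mod N)} = carrier G"
    by (auto simp: FactGroup_def RCOSETS_def)
  then have "openin (quotient_group_topology G T N) (carrier (G Mod N))"
    using openin_topspace[of T] by (simp add: openin_quotient_group_topology topspace_T)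
  then have "topspace (quotient_group_topology G T N) = carrier (G Mod N)"
    using openin_subset openin_topspace by (metis openin_quotient_group_topology subset_antisym)
  then show ?thesis
    unfolding continuous_map_def topspace_T
    by (auto simp: FactGroup_def RCOSETS_def openin_quotient_group_topology topspace_T)
qed

text \<open>A closed normal subgroup of the quotient is the image of its preimage, which is a closed
  normal subgroup of \<open>G\<close> above \<open>N\<close>.\<close>

lemma topologically_simple_quotient:
  assumes N: "N \<lhd> G" and proper: "N \<noteq> carrier G"
    and simple: "\<And>M. \<lbrakk>M \<lhd> G; closedin T M; N \<subseteq> M; M \<noteq> N\<rbrakk> \<Longrightarrow> M = carrier G"
  shows "topologically_simple (G Mod N) (quotient_group_topology G T N)"
proof -
  interpret N: normal N G by (rule N)
  interpret Q: group "G Mod N" by (rule N.factorgroup_is_group)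
  interpret h: group_hom G "G Mod N" "\<lambda>v. N #> v"
    by (intro group_hom.intro group_hom_axioms.intro N.r_coset_hom_Mod is_group Q.is_group)
  interpret F: filtered_group "G Mod N" "\<lambda>n. (\<lambda>v. N #> v) ` V n"
    by (rule quotient_filtered_group[OF N])
  have Qcar: "carrier (G Mod N) = (\<lambda>v. N #> v) ` carrier G"
    by (auto simp: FactGroup_def RCOSETS_def)
  have N1: "N #> x = N \<longleftrightarrow> x \<in> N" if "x \<in> carrier G" for x
    using that N.rcos_const[of x] rcos_self[OF _ N.subgroup_axioms, of x] by blast
  have one: "\<one>\<^bsub>G Mod N\<^esub> = N"
    by (simp add: FactGroup_def)
  have eq: "quotient_group_topology G T N = F.T"
    by (rule quotient_filtered_group[OF N])
  show ?thesis
    unfolding topologically_simple_def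
  proof (intro conjI allI impI)
    show "topological_group (G Mod N) (quotient_group_topology G T N)"
      unfolding eq by (rule F.topological_group_T)
    obtain x where "x \<in> carrier G" "x \<notin> N"
      using proper N.subset by blast
    then show "carrier (G Mod N) \<noteq> {\<one>\<^bsub>G Mod N\<^esub>}"
      unfolding one Qcar using N1 by blast
    fix \<M> assume M: "\<M> \<lhd> G Mod N \<and> closedin (quotient_group_topology G T N) \<M>"
    interpret M: normal \<M> "G Mod N" using M by blast
    let ?M = "{x \<in> carrier G. N #> x \<in> \<M>}"
    have "subgroup ?M G"
    proof
      show "inv x \<in> ?M" if "x \<in> ?M" for x
        using that h.hom_inv[of x] M.m_inv_closed by auto
      show "\<one> \<in> ?M"
        using h.hom_one M.one_closed by auto
    qed (use h.hom_mult M.m_closed in auto)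
    moreover have "x \<otimes> h \<otimes> inv x \<in> ?M" if "x \<in> carrier G" "h \<in> ?M" for x h
      using that M.inv_op_closed2[of "N #> x" "N #> h"] by (auto simp: Qcar)
    ultimately have normal: "?M \<lhd> G"
      unfolding normal_inv_iff by blast
    have "openin (quotient_group_topology G T N) (carrier (G Mod N) - \<M>)"
      using M F.topspace_T unfolding closedin_def eq by auto
    then have "openin T {x \<in> carrier G. N #> x \<in> carrier (G Mod N) - \<M>}"
      unfolding openin_quotient_group_topology topspace_T by blast
    moreover have "{x \<in> carrier G. N #> x \<in> carrier (G Mod N) - \<M>} = carrier G - ?M"
      using Qcar by blast
    ultimately have closed: "closedin T ?M"
      unfolding closedin_def topspace_T by auto
    have NM: "N \<subseteq> ?M"
      using N1 N.subset M.one_closed unfolding one by force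
    have img: "\<M> = (\<lambda>v. N #> v) ` ?M"
    proof (intro equalityI subsetI)
      fix X assume X: "X \<in> \<M>"
      then have "X \<in> (\<lambda>v. N #> v) ` carrier G"
        using M.subset Qcar by auto
      then show "X \<in> (\<lambda>v. N #> v) ` ?M"
        using X by auto
    qed auto
    show "\<M> = {\<one>\<^bsub>G Mod N\<^esub>} \<or> \<M> = carrier (G Mod N)"
    proof (cases "?M = N")
      case True
      have "(\<lambda>v. N #> v) ` N = {N}"
        using N1 N.subset N.one_closed by blast
      then show ?thesis
        using img True unfolding one by simp
    next
      case False
      then have "?M = carrier G"
        using simple normal closed NM by blast
      then show ?thesis
        using img unfolding Qcar by simp
    qed
  qed
qed

end

text \<open>Turns the topological data into a comparison of filtrations: the last two conclusions
  express openness and continuity of \<open>\<phi>\<close> at the identity, and only subgroups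
  remain.\<close>

lemma filtered_local_isomorphism:
  assumes "filtered_group G V" "filtered_group H W"
    and iso: "local_isomorphism G (filtration_topology G V) H (filtration_topology H W) U \<phi>"
  obtains k where "inj_on \<phi> (V k)"
    and "\<And>x y. \<lbrakk>x \<in> V k; y \<in> V k\<rbrakk> \<Longrightarrow> \<phi> (x \<otimes>\<^bsub>G\<^esub> y) = \<phi> x \<otimes>\<^bsub>H\<^esub> \<phi> y"
    and "\<And>n. n \<ge> k \<Longrightarrow> \<exists>j. W j \<subseteq> \<phi> ` V n"
    and "\<And>j. \<exists>n\<ge>k. \<phi> ` V n \<subseteq> W j"
proof -
  interpret G: filtered_group G V by fact
  interpret H: filtered_group H W by fact
  let ?X = "subtopology G.T U"
  have U: "openin G.T U" "\<one>\<^bsub>G\<^esub> \<in> U" and emb: "embedding_map ?X H.T \<phi>"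
    and opn: "open_map ?X H.T \<phi>" and one: "\<phi> \<one>\<^bsub>G\<^esub> = \<one>\<^bsub>H\<^esub>"
    and mult: "\<And>x y. \<lbrakk>x \<in> U; y \<in> U; x \<otimes>\<^bsub>G\<^esub> y \<in> U\<rbrakk> \<Longrightarrow> \<phi> (x \<otimes>\<^bsub>G\<^esub> y) = \<phi> x \<otimes>\<^bsub>H\<^esub> \<phi> y"
    using iso unfolding local_isomorphism_def by auto
  have Uc: "U \<subseteq> carrier G"
    using U(1) unfolding G.openin_T by blast
  have tX: "topspace ?X = U"
    using Uc by (auto simp: G.topspace_T)
  obtain k where k: "V k \<subseteq> U"
    using U G.V_carrier unfolding G.openin_T by (metis G.l_one subsetI)
  have cont: "continuous_map ?X H.T \<phi>"
    using emb homeomorphic_imp_continuous_map continuous_map_in_subtopology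
    unfolding embedding_map_def by blast
  have inj: "inj_on \<phi> U"
    using emb homeomorphic_imp_injective_map tX unfolding embedding_map_def by metis
  show ?thesis
  proof
    show "inj_on \<phi> (V k)"
      using inj k inj_on_subset by blast
    show "\<phi> (x \<otimes>\<^bsub>G\<^esub> y) = \<phi> x \<otimes>\<^bsub>H\<^esub> \<phi> y" if "x \<in> V k" "y \<in> V k" for x y
      using mult k that G.V_mult by blast
    show "\<exists>j. W j \<subseteq> \<phi> ` V n" if "n \<ge> k" for n
    proof -
      have "V n \<subseteq> U"
        using that k G.V_antimono by blast
      then have "openin ?X (V n)"
        using G.openin_V U(1) openin_open_subtopology by blast
      then have "openin H.T (\<phi> ` V n)"
        using opn unfolding open_map_def by blast
      moreover have "\<one>\<^bsub>H\<^esub> \<in> \<phi> ` V n"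
        using one G.V_one by (metis image_eqI)
      ultimately obtain j where j: "\<forall>v\<in>W j. \<one>\<^bsub>H\<^esub> \<otimes>\<^bsub>H\<^esub> v \<in> \<phi> ` V n"
        unfolding H.openin_T by blast
      then have "W j \<subseteq> \<phi> ` V n"
        using H.V_carrier H.l_one by (metis subsetI)
      then show ?thesis ..
    qed
    show "\<exists>n\<ge>k. \<phi> ` V n \<subseteq> W j" for j
    proof -
      have "openin ?X {x \<in> U. \<phi> x \<in> W j}"
        using cont H.openin_V tX unfolding continuous_map_def by metis
      then have "openin G.T {x \<in> U. \<phi> x \<in> W j}"
        using U(1) openin_open_subtopology by blast
      moreover have "\<one>\<^bsub>G\<^esub> \<in> {x \<in> U. \<phi> x \<in> W j}"
        using U one H.V_one by auto
      ultimately obtain n where "\<forall>v\<in>V n. \<one>\<^bsub>G\<^esub> \<otimes>\<^bsub>G\<^esub> v \<in> {x \<in> U. \<phi> x \<in> W j}"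
        unfolding G.openin_T by blast
      then have "\<phi> ` V n \<subseteq> W j"
        using G.V_carrier G.l_one by (metis (no_types, lifting) image_subsetI mem_Collect_eq)
      then have "\<phi> ` V (max n k) \<subseteq> W j"
        using G.V_antimono[of n "max n k"] by auto
      then show ?thesis
        by (intro exI[of _ "max n k"]) auto
    qed
  qed
qed

section \<open>Column-finite matrices\<close>

abbreviation mm :: "('i \<times> 'i \<Rightarrow> 'a::comm_ring_1) \<Rightarrow> ('i \<times> 'i \<Rightarrow> 'a) \<Rightarrow> ('i \<times> 'i \<Rightarrow> 'a)"  (infixl "\<odot>" 70)
  where "A \<odot> B \<equiv> mat_mult UNIV A B"

abbreviation Idm :: "'i \<times> 'i \<Rightarrow> 'a::comm_ring_1" where "Idm \<equiv> mat_one UNIV"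

text \<open>Upper triangular matrices over a chain of type \<omega> with finite blocks have finite
  columns but possibly infinite rows. Finite columns keep the sums in \<open>mat_mult\<close>
  finite, so the junk value never occurs.\<close>

definition col_finite :: "('i \<times> 'i \<Rightarrow> 'a::comm_ring_1) \<Rightarrow> bool" where
  "col_finite A \<longleftrightarrow> (\<forall>j. finite {i. A (i, j) \<noteq> 0})"

lemma Idm_apply [simp]: "Idm (i, j) = (if i = j then 1 else 0)"
  by (simp add: mat_one_def)

text \<open>The support of a column of the right factor bounds the sum, whatever the left factor
  is.\<close>

lemma mm_sum:
  assumes "finite F" "{k. B (k, j) \<noteq> 0} \<subseteq> F"
  shows "(A \<odot> B) (i, j) = (\<Sum>k\<in>F. A (i, k) * B (k, j))"
proof -
  have "(A \<odot> B) (i, j) = (\<Sum>k\<in>{k. A (i, k) * B (k, j) \<noteq> 0}. A (i, k) * B (k, j))"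
    by (simp add: mat_mult_def)
  also have "\<dots> = (\<Sum>k\<in>F. A (i, k) * B (k, j))"
  proof (rule sum.mono_neutral_left)
    show "{k. A (i, k) * B (k, j) \<noteq> 0} \<subseteq> F"
      using assms(2) by (metis (mono_tags, lifting) Collect_mono_iff mult_not_zero subset_trans)
  qed (use assms in auto)
  finally show ?thesis .
qed

lemma mm_eq_0: "(\<And>k. A (i, k) = 0 \<or> B (k, j) = 0) \<Longrightarrow> (A \<odot> B) (i, j) = 0"
proof -
  assume "\<And>k. A (i, k) = 0 \<or> B (k, j) = 0"
  then have "A (i, k) * B (k, j) = 0" for k
    by (metis mult_zero_left mult_zero_right)
  then show ?thesis
    by (simp add: mat_mult_def)
qed

lemma mm_nonzero: "(A \<odot> B) (i, j) \<noteq> 0 \<Longrightarrow> \<exists>k. A (i, k) \<noteq> 0 \<and> B (k, j) \<noteq> 0"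
  using mm_eq_0 by metis

lemma col_finite_Idm [simp]: "col_finite Idm"
  by (simp add: col_finite_def)

lemma col_finite_mm [simp]:
  assumes "col_finite A" "col_finite B"
  shows "col_finite (A \<odot> B)"
  unfolding col_finite_def
proof
  fix j
  have "{i. (A \<odot> B) (i, j) \<noteq> 0} \<subseteq> (\<Union>k\<in>{k. B (k, j) \<noteq> 0}. {i. A (i, k) \<noteq> 0})"
    using mm_nonzero by fast
  moreover have "finite \<dots>"
    using assms by (simp add: col_finite_def)
  ultimately show "finite {i. (A \<odot> B) (i, j) \<noteq> 0}"
    by (rule finite_subset)
qed

lemma col_finite_add [simp]:
  assumes "col_finite A" "col_finite B"
  shows "col_finite (A + B)" "col_finite (A - B)"
proof -
  have fin: "finite ({i. A (i, j) \<noteq> 0} \<union> {i. B (i, j) \<noteq> 0})" for j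
    using assms by (simp add: col_finite_def)
  have "{i. (A + B) (i, j) \<noteq> 0} \<subseteq> {i. A (i, j) \<noteq> 0} \<union> {i. B (i, j) \<noteq> 0}"
    "{i. (A - B) (i, j) \<noteq> 0} \<subseteq> {i. A (i, j) \<noteq> 0} \<union> {i. B (i, j) \<noteq> 0}" for j
    by auto
  then show "col_finite (A + B)" "col_finite (A - B)"
    using finite_subset[OF _ fin] unfolding col_finite_def by blast+
qed

text \<open>The two sums can be interchanged because column \<open>j\<close> of \<open>C\<close> is
  finite and meets only finitely many columns of \<open>B\<close>, each of them finite.\<close>

lemma mm_assoc:
  assumes B: "col_finite B" and C: "col_finite C"
  shows "(A \<odot> B) \<odot> C = A \<odot> (B \<odot> C)"
proof (rule ext, clarify)
  fix i j
  let ?C = "{l. C (l, j) \<noteq> 0}"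
  let ?B = "\<Union>l\<in>?C. {k. B (k, l) \<noteq> 0}"
  have fin: "finite ?C" "finite ?B"
    using B C by (simp_all add: col_finite_def)
  have BC: "{k. (B \<odot> C) (k, j) \<noteq> 0} \<subseteq> ?B"
    using mm_nonzero by fast
  have "((A \<odot> B) \<odot> C) (i, j) = (\<Sum>l\<in>?C. (A \<odot> B) (i, l) * C (l, j))"
    using fin by (simp add: mm_sum)
  also have "\<dots> = (\<Sum>l\<in>?C. (\<Sum>k\<in>?B. A (i, k) * B (k, l)) * C (l, j))"
    using fin by (intro sum.cong refl arg_cong2[where f = "(*)"] mm_sum) auto
  also have "\<dots> = (\<Sum>k\<in>?B. \<Sum>l\<in>?C. A (i, k) * B (k, l) * C (l, j))"
    unfolding sum_distrib_right by (rule sum.swap)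
  also have "\<dots> = (\<Sum>k\<in>?B. A (i, k) * (B \<odot> C) (k, j))"
    using fin by (simp add: mm_sum sum_distrib_left mult.assoc)
  also have "\<dots> = (A \<odot> (B \<odot> C)) (i, j)"
    using mm_sum[OF fin(2) BC] by metis
  finally show "((A \<odot> B) \<odot> C) (i, j) = (A \<odot> (B \<odot> C)) (i, j)" .
qed

lemma mm_Idm [simp]: "A \<odot> Idm = A"
proof (rule ext, clarify)
  show "(A \<odot> Idm) (i, j) = A (i, j)" for i j
    by (subst mm_sum[of "{j}"]) auto
qed

lemma Idm_mm [simp]: "col_finite A \<Longrightarrow> Idm \<odot> A = A"
proof (rule ext, clarify)
  show "(Idm \<odot> A) (i, j) = A (i, j)" if "col_finite A" for i j
    using that by (subst mm_sum[of "insert i {k. A (k, j) \<noteq> 0}"])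
      (auto simp: col_finite_def if_distrib if_distribR cong: if_cong)
qed

lemma mm_add_left: "col_finite C \<Longrightarrow> (A + B) \<odot> C = A \<odot> C + B \<odot> C"
  by (rule ext) (auto simp: mm_sum[OF _ subset_refl] col_finite_def distrib_right sum.distrib)

lemma mm_diff_left: "col_finite C \<Longrightarrow> (A - B) \<odot> C = A \<odot> C - B \<odot> C"
  by (rule ext) (auto simp: mm_sum[OF _ subset_refl] col_finite_def left_diff_distrib sum_subtractf)

lemma mm_add_right:
  assumes "col_finite A" "col_finite B"
  shows "C \<odot> (A + B) = C \<odot> A + C \<odot> B" "C \<odot> (A - B) = C \<odot> A - C \<odot> B"
proof -
  have *: "(C \<odot> A') (i, j) = (\<Sum>k\<in>{k. A (k, j) \<noteq> 0} \<union> {k. B (k, j) \<noteq> 0}. C (i, k) * A' (k, j))"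
    if "A' \<in> {A, B, A + B, A - B}" for A' i j
    using that assms by (intro mm_sum) (auto simp: col_finite_def)
  show "C \<odot> (A + B) = C \<odot> A + C \<odot> B" "C \<odot> (A - B) = C \<odot> A - C \<odot> B"
    by (rule ext, clarify, simp add: * distrib_left sum.distrib right_diff_distrib sum_subtractf)+
qed

lemma matrices_UNIV [simp]: "matrices UNIV = UNIV"
  by (simp add: matrices_def)

text \<open>Invertibility of the square block on \<open>S\<close>, phrased for total functions in
  place of the extensional ones in \<open>mat_invertible\<close>.\<close>

definition inv_on :: "'i set \<Rightarrow> ('i \<times> 'i \<Rightarrow> 'a::comm_ring_1) \<Rightarrow> bool" where
  "inv_on S A \<longleftrightarrow> (\<exists>B. \<forall>i\<in>S. \<forall>j\<in>S. (\<Sum>k\<in>S. A (i, k) * B (k, j)) = Idm (i, j)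
     \<and> (\<Sum>k\<in>S. B (i, k) * A (k, j)) = Idm (i, j))"

lemma mat_invertible_restrict:
  assumes S: "finite S"
  shows "mat_invertible S (restrict A (S \<times> S)) \<longleftrightarrow> inv_on S A"
proof -
  have mult: "mat_mult S (restrict A (S \<times> S)) (restrict B (S \<times> S)) =
      (\<lambda>(i, j)\<in>S \<times> S. \<Sum>k\<in>S. A (i, k) * B (k, j))" for A B :: "'a \<times> 'a \<Rightarrow> 'b"
    unfolding mat_mult_def
    using S by (intro restrict_ext) (auto intro!: sum.mono_neutral_cong_left)
  have one: "(\<lambda>(i, j)\<in>S \<times> S. f i j) = mat_one S \<longleftrightarrow> (\<forall>i\<in>S. \<forall>j\<in>S. f i j = (Idm (i, j) :: 'b))" for f
    unfolding mat_one_def by (auto simp: fun_eq_iff restrict_def split: if_splits)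
  have mat: "B \<in> matrices S \<longleftrightarrow> B = restrict B (S \<times> S)" for B :: "'a \<times> 'a \<Rightarrow> 'b"
    unfolding matrices_def by (metis PiE_restrict restrict_PiE_iff UNIV_I)
  show ?thesis
  proof
    assume "mat_invertible S (restrict A (S \<times> S))"
    then obtain B where B: "B \<in> matrices S"
      "mat_mult S (restrict A (S \<times> S)) B = mat_one S" "mat_mult S B (restrict A (S \<times> S)) = mat_one S"
      unfolding mat_invertible_def by blast
    have "restrict B (S \<times> S) = B"
      using mat B(1) by simp
    then show "inv_on S A"
      using B(2,3) mult[of A B] mult[of B A] one[of "\<lambda>i j. \<Sum>k\<in>S. A (i, k) * B (k, j)"]
        one[of "\<lambda>i j. \<Sum>k\<in>S. B (i, k) * A (k, j)"]
      unfolding inv_on_def by (intro exI[of _ B]) auto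
  next
    assume "inv_on S A"
    then obtain B where
      "\<forall>i\<in>S. \<forall>j\<in>S. (\<Sum>k\<in>S. A (i, k) * B (k, j)) = Idm (i, j)"
      "\<forall>i\<in>S. \<forall>j\<in>S. (\<Sum>k\<in>S. B (i, k) * A (k, j)) = Idm (i, j)"
      unfolding inv_on_def by blast
    then have "mat_mult S (restrict A (S \<times> S)) (restrict B (S \<times> S)) = mat_one S"
      "mat_mult S (restrict B (S \<times> S)) (restrict A (S \<times> S)) = mat_one S"
      unfolding mult one by blast+
    moreover have "restrict B (S \<times> S) \<in> matrices S"
      unfolding mat by simp
    ultimately show "mat_invertible S (restrict A (S \<times> S))"
      unfolding mat_invertible_def by blast
  qed
qed

section \<open>Almost upper triangular matrices over a chain of finite blocks\<close>

text \<open>\<open>b\<close> sends an element to the number of its block, so \<open>i\<close> is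
  below \<open>j\<close> iff \<open>b i \<le> b j\<close>. \<open>two_in_fibre\<close> also makes
  every block nonempty, so no number is skipped.\<close>

locale block_order =
  fixes b :: "'i \<Rightarrow> nat"
  assumes finite_fibre: "finite {i. b i = n}"
    and two_in_fibre: "\<exists>i j. i \<noteq> j \<and> b i = n \<and> b j = n"
begin

lemma finite_below: "finite {i. b i < n}"
proof -
  have "{i. b i < n} = (\<Union>k<n. {i. b i = k})"
    by auto
  then show ?thesis
    using finite_fibre by simp
qed

lemma fibre_obtain: obtains i where "b i = n"
  using two_in_fibre by blast

text \<open>Upper triangularity for the preorder in which the first \<open>m\<close> blocks are
  merged into one.\<close>

definition tri :: "nat \<Rightarrow> ('i \<times> 'i \<Rightarrow> 'k::{field,finite}) set" where
  "tri m = {A. \<forall>i j. b j < b i \<and> m \<le> b i \<longrightarrow> A (i, j) = 0}"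

definition proj :: "nat \<Rightarrow> ('i \<times> 'i \<Rightarrow> 'k::{field,finite})" where
  "proj m = (\<lambda>(i, j). if i = j \<and> b i < m then 1 else 0)"

lemma tri_mono: "m \<le> n \<Longrightarrow> tri m \<subseteq> tri n"
  by (auto simp: tri_def)

lemma triD: "A \<in> tri m \<Longrightarrow> b j < b i \<Longrightarrow> m \<le> b i \<Longrightarrow> A (i, j) = 0"
  by (simp add: tri_def)

text \<open>In terms of columns: the span of the first \<open>e\<close> blocks is mapped into itself
  for every \<open>e \<ge> m\<close>. The truncation arguments rest on this.\<close>

lemma tri_below: "A \<in> tri m \<Longrightarrow> m \<le> e \<Longrightarrow> b j < e \<Longrightarrow> A (i, j) \<noteq> 0 \<Longrightarrow> b i < e"
  using triD[of A m j i] by linarith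

lemma col_finite_tri: "A \<in> tri m \<Longrightarrow> col_finite A"
  unfolding col_finite_def
proof
  fix j assume A: "A \<in> tri m"
  have "{i. A (i, j) \<noteq> 0} \<subseteq> {i. b i < max m (Suc (b j))}"
    using tri_below[OF A, of "max m (Suc (b j))" j] by auto
  then show "finite {i. A (i, j) \<noteq> 0}"
    using finite_below finite_subset by blast
qed

lemma tri_Idm: "Idm \<in> tri m"
  by (auto simp: tri_def)

lemma proj_apply: "proj m (i, j) = (if i = j \<and> b i < m then 1 else 0)"
  by (simp add: proj_def)

lemma tri_proj: "proj n \<in> tri m"
  by (auto simp: tri_def proj_apply)

lemma col_finite_proj [simp]: "col_finite (proj n)"
  using tri_proj col_finite_tri by blast

lemma tri_mm:
  assumes "A \<in> tri m" "B \<in> tri m"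
  shows "A \<odot> B \<in> tri m"
  unfolding tri_def
proof (clarify, rule mm_eq_0)
  fix i j k assume "b j < b i" "m \<le> b i"
  then show "A (i, k) = 0 \<or> B (k, j) = 0"
    using triD[OF assms(1), of k i] triD[OF assms(2), of j k] by linarith
qed

lemma mm_proj: "(A \<odot> proj e) (i, j) = (if b j < e then A (i, j) else 0)"
  by (subst mm_sum[of "{j}"]) (auto simp: proj_apply)

lemma proj_mm: "col_finite A \<Longrightarrow> (proj e \<odot> A) (i, j) = (if b i < e then A (i, j) else 0)"
  by (subst mm_sum[of "insert i {k. A (k, j) \<noteq> 0}"])
    (auto simp: col_finite_def proj_apply if_distrib if_distribR cong: if_cong)

lemma proj_mm_proj: "m \<le> e \<Longrightarrow> A \<in> tri m \<Longrightarrow> proj e \<odot> (A \<odot> proj e) = A \<odot> proj e"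
proof (rule ext, clarify)
  show "(proj e \<odot> (A \<odot> proj e)) (i, j) = (A \<odot> proj e) (i, j)" if "m \<le> e" "A \<in> tri m" for i j
    using that tri_below[of A m e j i] by (auto simp: proj_mm mm_proj col_finite_tri)
qed

lemma eq_by_proj:
  assumes "\<And>e. d \<le> e \<Longrightarrow> A \<odot> proj e = B \<odot> proj e"
  shows "A = B"
proof (rule ext, clarify)
  fix i j
  show "A (i, j) = B (i, j)"
    using fun_cong[OF assms[of "max d (Suc (b j))"], of "(i, j)"]
    by (simp add: mm_proj less_max_iff_disj)
qed

text \<open>Left multiplication by \<open>A\<close> is injective on a finite set of matrices containing the idempotent
  \<open>proj e\<close>, so it hits \<open>proj e\<close>; this avoids determinants.\<close>

lemma inverse_tri:
  fixes A B :: "'i \<times> 'i \<Rightarrow> 'k::{field,finite}"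
  assumes A: "A \<in> tri m" and B: "B \<in> tri e" and AB: "B \<odot> A = Idm"
  shows "B \<in> tri m"
proof (cases "e \<le> m")
  case True
  then show ?thesis
    using B tri_mono by blast
next
  case False
  define X :: "('i \<times> 'i \<Rightarrow> 'k) set" where "X = {C \<in> tri m. \<forall>i j. \<not> (b i < e \<and> b j < e) \<longrightarrow> C (i, j) = 0}"
  let ?F = "{i. b i < e} \<times> {i. b i < e}"
  have "finite {C. \<forall>p. (p \<in> ?F \<longrightarrow> C p \<in> (UNIV :: 'k set)) \<and> (p \<notin> ?F \<longrightarrow> C p = 0)}"
    using finite_below by (intro finite_set_of_finite_funs) auto
  moreover have "X \<subseteq> {C. \<forall>p. (p \<in> ?F \<longrightarrow> C p \<in> (UNIV :: 'k set)) \<and> (p \<notin> ?F \<longrightarrow> C p = 0)}"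
    by (auto simp: X_def)
  ultimately have fin: "finite X"
    using finite_subset by blast
  have cA: "col_finite A"
    using A col_finite_tri by blast
  have "A \<odot> C \<in> X" if C: "C \<in> X" for C
  proof -
    have "(A \<odot> C) (i, j) = 0" if "\<not> (b i < e \<and> b j < e)" for i j
    proof (rule mm_eq_0)
      fix k
      show "A (i, k) = 0 \<or> C (k, j) = 0"
        using that C triD[OF A, of k i] False unfolding X_def by (cases "b k < e") auto
    qed
    then show ?thesis
      using C A tri_mm by (auto simp: X_def)
  qed
  moreover have inverts: "B \<odot> (A \<odot> C) = C" if "C \<in> X" for C
  proof -
    have "col_finite C"
      using that col_finite_tri by (auto simp: X_def)
    then show ?thesis
      using AB cA by (simp flip: mm_assoc)
  qed
  then have "inj_on (\<lambda>C. A \<odot> C) X"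
    by (metis inj_onI)
  ultimately have "(\<lambda>C. A \<odot> C) ` X = X"
    by (intro endo_inj_surj fin) auto
  moreover have "proj e \<in> X"
    using tri_proj by (auto simp: X_def proj_apply)
  ultimately obtain C where C: "C \<in> X" "proj e = A \<odot> C"
    by blast
  then have BC: "B \<odot> proj e = C"
    using inverts by simp
  show ?thesis
    unfolding tri_def
  proof clarify
    fix i j assume ij: "b j < b i" "m \<le> b i"
    show "B (i, j) = 0"
    proof (cases "b j < e")
      case True
      then have "B (i, j) = C (i, j)"
        using BC by (metis mm_proj)
      then show ?thesis
        using C ij by (auto simp: X_def tri_def)
    next
      case False
      then show ?thesis
        using triD[OF B ij(1)] ij by simp
    qed
  qed
qed

text \<open>A two-sided inverse of the same shape replaces the condition on finite convex subsets;
  \<open>AU_iff\<close> shows that this describes the same matrices.\<close>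

definition AU :: "('i \<times> 'i \<Rightarrow> 'k::{field,finite}) set" where
  "AU = {A. \<exists>m. A \<in> tri m \<and> (\<exists>B\<in>tri m. A \<odot> B = Idm \<and> B \<odot> A = Idm)}"

text \<open>The first \<open>e\<close> blocks are invariant under \<open>A\<close> and
  \<open>B\<close>, so the truncations multiply like the matrices themselves.\<close>

lemma inv_on_below:
  assumes A: "A \<in> tri m" and B: "B \<in> tri m" and AB: "A \<odot> B = Idm" "B \<odot> A = Idm" and e: "m \<le> e"
  shows "inv_on {i. b i < e} A"
proof -
  have "(\<Sum>k | b k < e. A (i, k) * B (k, j)) = (A \<odot> B) (i, j)"
    "(\<Sum>k | b k < e. B (i, k) * A (k, j)) = (B \<odot> A) (i, j)" if "b j < e" for i j
    using tri_below[OF A e that] tri_below[OF B e that] finite_below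
    by (subst mm_sum[of "{k. b k < e}"]; auto)+
  then show ?thesis
    unfolding inv_on_def using AB by (intro exI[of _ B]) auto
qed

text \<open>The inverses of the truncations to the first \<open>e\<close> blocks, extended by zero,
  are compatible with each other, so column \<open>j\<close> of the inverse can be read off from any
  truncation beyond \<open>d\<close> and \<open>b j\<close>.\<close>

lemma inverse_limit:
  assumes A: "A \<in> tri d" and inv: "\<And>e. d \<le> e \<Longrightarrow> inv_on {i. b i < e} A"
  shows "\<exists>B\<in>tri d. A \<odot> B = Idm \<and> B \<odot> A = Idm"
proof -
  have cA [simp]: "col_finite A"
    using A col_finite_tri by blast
  have ex: "\<exists>C. A \<odot> C = proj e \<and> C \<odot> A \<odot> proj e = proj e \<and>
      (\<forall>i j. \<not> (b i < e \<and> b j < e) \<longrightarrow> C (i, j) = 0)" if e: "d \<le> e" for e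
  proof -
    obtain B where B: "\<And>i j. \<lbrakk>b i < e; b j < e\<rbrakk> \<Longrightarrow> (\<Sum>k | b k < e. A (i, k) * B (k, j)) = Idm (i, j)"
      "\<And>i j. \<lbrakk>b i < e; b j < e\<rbrakk> \<Longrightarrow> (\<Sum>k | b k < e. B (i, k) * A (k, j)) = Idm (i, j)"
      using inv[OF e] unfolding inv_on_def by auto
    define C where "C = (\<lambda>(i, j). if b i < e \<and> b j < e then B (i, j) else 0)"
    have C: "C (i, j) = (if b i < e \<and> b j < e then B (i, j) else 0)" for i j
      by (simp add: C_def)
    have "(A \<odot> C) (i, j) = proj e (i, j)" for i j
    proof (cases "b i < e \<and> b j < e")
      case True
      have "(A \<odot> C) (i, j) = (\<Sum>k | b k < e. A (i, k) * C (k, j))"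
        using finite_below by (intro mm_sum) (auto simp: C)
      also have "\<dots> = (\<Sum>k | b k < e. A (i, k) * B (k, j))"
        using True by (auto simp: C)
      finally show ?thesis
        using B True by (simp add: proj_apply)
    next
      case False
      have "A (i, k) = 0 \<or> C (k, j) = 0" for k
        using False triD[OF A, of k i] e unfolding C by (cases "b k < e") auto
      then show ?thesis
        using False by (auto simp: mm_eq_0 proj_apply)
    qed
    moreover have "(C \<odot> A \<odot> proj e) (i, j) = proj e (i, j)" for i j
    proof (cases "b j < e")
      case True
      have "(C \<odot> A) (i, j) = (\<Sum>k | b k < e. C (i, k) * A (k, j))"
        using finite_below tri_below[OF A e True] by (intro mm_sum) auto
      also have "\<dots> = (if b i < e then \<Sum>k | b k < e. B (i, k) * A (k, j) else 0)"
        using True by (auto simp: C)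
      finally show ?thesis
        using B True by (auto simp: mm_proj proj_apply)
    qed (auto simp: mm_proj proj_apply)
    moreover have "\<forall>i j. \<not> (b i < e \<and> b j < e) \<longrightarrow> C (i, j) = 0"
      by (simp add: C)
    ultimately show ?thesis
      by (intro exI[of _ C]) auto
  qed
  then obtain C where C: "\<And>e. d \<le> e \<Longrightarrow> A \<odot> C e = proj e"
    "\<And>e. d \<le> e \<Longrightarrow> C e \<odot> A \<odot> proj e = proj e"
    "\<And>e i j. \<lbrakk>d \<le> e; \<not> (b i < e \<and> b j < e)\<rbrakk> \<Longrightarrow> C e (i, j) = 0"
    by metis
  have cC [simp]: "col_finite (C e)" if "d \<le> e" for e
    unfolding col_finite_def
  proof
    fix j
    have "{i. C e (i, j) \<noteq> 0} \<subseteq> {i. b i < e}"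
      using C(3)[OF that] by blast
    then show "finite {i. C e (i, j) \<noteq> 0}"
      using finite_below finite_subset by blast
  qed
  \<comment> \<open>Both sides arise from \<open>C e' \<odot> A \<odot> C e\<close>, because
    \<open>A \<odot> C e = proj e\<close> and \<open>C e'\<close> is a left inverse of
    \<open>A\<close> on the first \<open>e'\<close> blocks.\<close>
  have coherent: "C e' \<odot> proj e = C e" if e: "d \<le> e" "e \<le> e'" for e e'
  proof -
    have pC: "proj e' \<odot> C e = C e"
    proof (rule ext, clarify)
      show "(proj e' \<odot> C e) (i, j) = C e (i, j)" for i j
        using C(3)[OF e(1), of i j] e by (auto simp: proj_mm)
    qed
    have "C e' \<odot> proj e = C e' \<odot> (A \<odot> (proj e' \<odot> C e))"
      using C(1) e pC by simp
    also have "\<dots> = C e' \<odot> A \<odot> proj e' \<odot> C e"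
      using e by (simp add: mm_assoc)
    also have "\<dots> = C e"
      using C(2)[of e'] e pC by simp
    finally show ?thesis .
  qed
  \<comment> \<open>\<open>max d (Suc (b j))\<close> is the first admissible truncation that
    contains column \<open>j\<close>.\<close>
  define B where "B = (\<lambda>(i, j). C (max d (Suc (b j))) (i, j))"
  have Bp: "B \<odot> proj e = C e" if e: "d \<le> e" for e
  proof (rule ext, clarify)
    fix i j
    show "(B \<odot> proj e) (i, j) = C e (i, j)"
    proof (cases "b j < e")
      case True
      then have "C e \<odot> proj (max d (Suc (b j))) = C (max d (Suc (b j)))"
        using e by (intro coherent) auto
      then show ?thesis
        using True by (simp add: mm_proj B_def) (metis less_max_iff_disj lessI mm_proj)
    qed (use C(3)[OF e] in \<open>auto simp: mm_proj\<close>)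
  qed
  have Bt: "B \<in> tri d"
    unfolding tri_def B_def using C(3)[of "max d (Suc _)"] by (auto simp: less_max_iff_disj)
  then have cB [simp]: "col_finite B"
    using col_finite_tri by blast
  have "A \<odot> B = Idm"
  proof (rule eq_by_proj)
    show "A \<odot> B \<odot> proj e = Idm \<odot> proj e" if "d \<le> e" for e
      using that C(1) Bp by (simp add: mm_assoc)
  qed
  moreover have "B \<odot> A = Idm"
  proof (rule eq_by_proj)
    fix e assume e: "d \<le> e"
    have "B \<odot> A \<odot> proj e = B \<odot> (proj e \<odot> (A \<odot> proj e))"
      using proj_mm_proj[OF e A] by (simp add: mm_assoc)
    also have "\<dots> = (B \<odot> proj e) \<odot> A \<odot> proj e"
      by (simp add: mm_assoc)
    also have "\<dots> = Idm \<odot> proj e"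
      using C(2) Bp e by simp
    finally show "B \<odot> A \<odot> proj e = Idm \<odot> proj e" .
  qed
  ultimately show ?thesis
    using Bt by blast
qed

subsection \<open>The underlying preorders\<close>

text \<open>No transitive closure is taken: for convex \<open>S\<close> the union is already a
  preorder. \<open>rel {}\<close> is the order by block numbers.\<close>

definition rel :: "'i set \<Rightarrow> 'i rel" where
  "rel S = {(i, j). b i \<le> b j} \<union> S \<times> S"

text \<open>Convexity is what makes the relation transitive: in a failing chain one endpoint would
  lie between two elements of \<open>S\<close>, hence in \<open>S\<close>, and then both endpoints
  would be in \<open>S\<close>.\<close>

lemma preorder_rel:
  assumes "order_convex UNIV (rel {}) S"
  shows "preorder_on UNIV (rel S)"
proof -
  have S: "k \<in> S" if "i \<in> S" "j \<in> S" "b i \<le> b k" "b k \<le> b j" for i j k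
    using assms that unfolding order_convex_def interval_def rel_def by blast
  have "trans (rel S)"
  proof (rule transI)
    fix x y z assume xy: "(x, y) \<in> rel S" and yz: "(y, z) \<in> rel S"
    show "(x, z) \<in> rel S"
    proof (rule ccontr)
      assume "(x, z) \<notin> rel S"
      then have xz: "b z < b x" "\<not> (x \<in> S \<and> z \<in> S)"
        by (auto simp: rel_def)
      consider "b x \<le> b y" "y \<in> S" "z \<in> S" | "x \<in> S" "y \<in> S" "b y \<le> b z"
        using xy yz xz by (auto simp: rel_def)
      then show False
        using S[of z y x] S[of y x z] xz by cases auto
    qed
  qed
  then show ?thesis
    by (auto simp: preorder_on_def refl_on_def rel_def)
qed

lemma order_convex_empty: "order_convex UNIV (rel {}) {}"
  by (simp add: order_convex_def)

lemma merge_rel: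
  assumes "order_convex UNIV (rel {}) S"
  shows "merge_preorder UNIV (rel {}) S = rel S"
proof
  have "preorder_on UNIV (rel S) \<and> rel {} \<subseteq> rel S \<and> (\<forall>i\<in>S. \<forall>j\<in>S. sim (rel S) i j)"
    using preorder_rel[OF assms] by (auto simp: rel_def sim_def)
  then show "merge_preorder UNIV (rel {}) S \<subseteq> rel S"
    unfolding merge_preorder_def by blast
  show "rel S \<subseteq> merge_preorder UNIV (rel {}) S"
    unfolding merge_preorder_def by (auto simp: rel_def sim_def)
qed

lemma Z_like_rel: "Z_like UNIV (rel {})"
  unfolding Z_like_def
proof (intro conjI allI impI)
  show "preorder_on UNIV (rel {})"
    using preorder_rel order_convex_empty by blast
  fix F :: "'i set" assume F: "finite F \<and> F \<subseteq> UNIV"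
  let ?S = "{i. b i < Suc (Max (b ` F))}"
  have "strongly_convex UNIV (rel {}) ?S"
    by (auto simp: strongly_convex_def strictly_below_def sim_def rel_def)
  moreover have "F \<subseteq> ?S"
    using F by (auto simp: less_Suc_eq_le)
  ultimately show "\<exists>S. finite S \<and> F \<subseteq> S \<and> strongly_convex UNIV (rel {}) S"
    using finite_below by blast
qed

lemma convex_below: "S \<subseteq> {i. b i < e} \<Longrightarrow> order_convex UNIV (rel S) {i. b i < e}"
  by (auto simp: order_convex_def interval_def rel_def)

text \<open>Because \<open>e > 0\<close>, the set contains an element of block \<open>0\<close>, and
  convexity fills the interval from there to an element of its highest block. Invertibility on large
  finite convex sets thus becomes a condition on initial segments.\<close>

lemma convex_initial:
  assumes fin: "finite S'" and conv: "order_convex UNIV (rel S) S'"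
    and sub: "{i. b i < e} \<subseteq> S'" and e: "0 < e"
  obtains e' where "e \<le> e'" "S' = {i. b i < e'}"
proof
  let ?e = "Suc (Max (b ` S'))"
  obtain i0 where i0: "b i0 = 0" by (rule fibre_obtain)
  obtain i1 where i1: "b i1 = e - 1" by (rule fibre_obtain)
  have S: "i0 \<in> S'" "i1 \<in> S'"
    using sub i0 i1 e by auto
  then obtain j where j: "j \<in> S'" "b j = Max (b ` S')"
    using Max_in[of "b ` S'"] fin by fastforce
  show "e \<le> ?e"
    using S i1 fin Max_ge[of "b ` S'" "b i1"] by fastforce
  show "S' = {i. b i < ?e}"
  proof
    show "S' \<subseteq> {i. b i < ?e}"
      using fin by (auto simp: less_Suc_eq_le)
    show "{i. b i < ?e} \<subseteq> S'"
    proof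
      fix k assume "k \<in> {i. b i < ?e}"
      then have "k \<in> interval UNIV (rel S) i0 j"
        using i0 j by (simp add: interval_def rel_def)
      then show "k \<in> S'"
        using conv S(1) j(1) unfolding order_convex_def by blast
    qed
  qed
qed

lemma finite_bound:
  assumes "finite (S :: 'i set)"
  obtains e where "S \<subseteq> {i. b i < e}" "d \<le> e" "0 < e"
proof
  show "S \<subseteq> {i. b i < max d (Suc (Max (b ` S)))}"
    using assms by (auto simp: less_max_iff_disj less_Suc_eq_le)
qed auto

lemma nonsingular_rel:
  assumes S: "finite S"
  shows "nonsingular UNIV (rel S) A \<longleftrightarrow> (\<exists>d. \<forall>e\<ge>d. inv_on {i. b i < e} A)"
proof
  assume "nonsingular UNIV (rel S) A"
  then obtain S0 where S0: "finite S0" "\<And>S'. \<lbrakk>finite S'; order_convex UNIV (rel S) S'; S0 \<subseteq> S'\<rbrakk> \<Longrightarrow>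
      mat_invertible S' (restrict A (S' \<times> S'))"
    unfolding nonsingular_def by blast
  obtain d where d: "S \<union> S0 \<subseteq> {i. b i < d}"
    using finite_bound[of "S \<union> S0"] S S0(1) by (metis finite_Un)
  have "inv_on {i. b i < e} A" if "d \<le> e" for e
  proof -
    have "S \<union> S0 \<subseteq> {i. b i < e}"
      using d that by auto
    then have "mat_invertible {i. b i < e} (restrict A ({i. b i < e} \<times> {i. b i < e}))"
      by (intro S0 finite_below convex_below) auto
    then show ?thesis
      using mat_invertible_restrict finite_below by metis
  qed
  then show "\<exists>d. \<forall>e\<ge>d. inv_on {i. b i < e} A"
    by blast
next
  assume "\<exists>d. \<forall>e\<ge>d. inv_on {i. b i < e} A"
  then obtain d where d: "\<And>e. d \<le> e \<Longrightarrow> inv_on {i. b i < e} A"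
    by blast
  obtain e where e: "S \<subseteq> {i. b i < e}" "d \<le> e" "0 < e"
    using finite_bound[OF S] by blast
  have "mat_invertible S' (restrict A (S' \<times> S'))"
    if "finite S'" "order_convex UNIV (rel S) S'" "{i. b i < e} \<subseteq> S'" for S'
    using convex_initial[OF that e(3)] d e(2) mat_invertible_restrict[OF that(1)] by (metis le_trans)
  then show "nonsingular UNIV (rel S) A"
    unfolding nonsingular_def using finite_below convex_below[OF e(1)] by blast
qed

lemma AU_iff: "A \<in> AU \<longleftrightarrow> (\<exists>m. A \<in> tri m) \<and> (\<exists>d. \<forall>e\<ge>d. inv_on {i. b i < e} A)"
proof
  assume "A \<in> AU"
  then show "(\<exists>m. A \<in> tri m) \<and> (\<exists>d. \<forall>e\<ge>d. inv_on {i. b i < e} A)"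
    unfolding AU_def using inv_on_below by blast
next
  assume "(\<exists>m. A \<in> tri m) \<and> (\<exists>d. \<forall>e\<ge>d. inv_on {i. b i < e} A)"
  then obtain m d where A: "A \<in> tri m" "\<And>e. d \<le> e \<Longrightarrow> inv_on {i. b i < e} A"
    by blast
  have "A \<in> tri (max m d)"
    using A(1) tri_mono[of m "max m d"] by auto
  then show "A \<in> AU"
    unfolding AU_def using inverse_limit[of A "max m d"] A(2) by auto
qed

lemma carrier_U:
  assumes S: "finite S"
  shows "carrier (U_group UNIV (rel S) :: ('i \<times> 'i \<Rightarrow> 'k::{field,finite}) monoid) =
    {A \<in> AU. \<forall>i j. b j < b i \<longrightarrow> (i, j) \<notin> S \<times> S \<longrightarrow> A (i, j) = 0}" (is "_ = ?R")
proof -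
  obtain e where e: "S \<subseteq> {i. b i < e}"
    using finite_bound[OF S] by blast
  have up: "upper_triangular UNIV (rel S) A \<longleftrightarrow> (\<forall>i j. b j < b i \<longrightarrow> (i, j) \<notin> S \<times> S \<longrightarrow> A (i, j) = 0)"
    for A :: "'i \<times> 'i \<Rightarrow> 'k"
    by (auto simp: upper_triangular_def rel_def not_le)
  have "A \<in> tri e" if "\<forall>i j. b j < b i \<longrightarrow> (i, j) \<notin> S \<times> S \<longrightarrow> A (i, j) = 0" for A :: "'i \<times> 'i \<Rightarrow> 'k"
    using that e unfolding tri_def by fastforce
  then show ?thesis
    unfolding U_group_def using up by (auto simp: AU_iff nonsingular_rel[OF S])
qed

text \<open>Finitely many nonzero entries below the diagonal blocks occupy rows of the first
  \<open>m\<close> blocks for some \<open>m\<close>; conversely, for a matrix in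
  \<open>tri m\<close> all such entries lie in a finite square.\<close>

lemma carrier_AU: "carrier (AU_group UNIV (rel {}) :: ('i \<times> 'i \<Rightarrow> 'k::{field,finite}) monoid) = AU"
proof -
  have "almost_upper_triangular UNIV (rel {}) A \<longleftrightarrow> (\<exists>m. A \<in> tri m)" for A :: "'i \<times> 'i \<Rightarrow> 'k"
  proof
    assume "almost_upper_triangular UNIV (rel {}) A"
    then have fin: "finite {(i, j). b j < b i \<and> A (i, j) \<noteq> 0}"
      by (simp add: almost_upper_triangular_def rel_def not_le)
    then obtain m where "fst ` {(i, j). b j < b i \<and> A (i, j) \<noteq> 0} \<subseteq> {i. b i < m}"
      using finite_bound[OF finite_imageI[OF fin, of fst]] by blast
    then have "A \<in> tri m"
      unfolding tri_def by (force simp: image_iff)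
    then show "\<exists>m. A \<in> tri m" ..
  next
    assume "\<exists>m. A \<in> tri m"
    then obtain m where "A \<in> tri m" ..
    then have "{(i, j). b j < b i \<and> A (i, j) \<noteq> 0} \<subseteq> {i. b i < m} \<times> {i. b i < m}"
      unfolding tri_def by fastforce
    then show "almost_upper_triangular UNIV (rel {}) A"
      unfolding almost_upper_triangular_def
      using finite_below finite_subset[OF _ finite_cartesian_product[OF finite_below finite_below]]
      by (simp add: rel_def not_le)
  qed
  then show ?thesis
    unfolding set_eq_iff AU_group_def by (simp add: AU_iff nonsingular_rel conj_commute)
qed

section \<open>The group of nonsingular almost upper triangular matrices\<close>

abbreviation G :: "('i \<times> 'i \<Rightarrow> 'k::{field,finite}) monoid" where
  "G \<equiv> AU_group UNIV (rel {})"

lemma mult_G [simp]: "A \<otimes>\<^bsub>G\<^esub> B = A \<odot> B"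
  by (simp add: AU_group_def)

lemma one_G [simp]: "\<one>\<^bsub>G\<^esub> = Idm"
  by (simp add: AU_group_def)

lemma AU_I: "A \<in> tri m \<Longrightarrow> B \<in> tri m \<Longrightarrow> A \<odot> B = Idm \<Longrightarrow> B \<odot> A = Idm \<Longrightarrow> A \<in> AU"
  unfolding AU_def by blast

lemma AU_Idm: "Idm \<in> AU"
  by (rule AU_I[OF tri_Idm tri_Idm]) auto

lemma AU_E:
  assumes "A \<in> AU"
  obtains m B where "A \<in> tri m" "B \<in> tri m" "A \<odot> B = Idm" "B \<odot> A = Idm"
  using assms unfolding AU_def by blast

lemma AU_E_ge:
  assumes "A \<in> AU"
  obtains m B where "n \<le> m" "A \<in> tri m" "B \<in> tri m" "A \<odot> B = Idm" "B \<odot> A = Idm"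
proof -
  obtain m B where "A \<in> tri m" "B \<in> tri m" "A \<odot> B = Idm" "B \<odot> A = Idm"
    using assms by (rule AU_E)
  then show thesis
    using that[of "max m n" B] tri_mono[of m "max m n"] by (meson max.cobounded1 max.cobounded2 subsetD)
qed

lemma col_finite_AU [simp]: "A \<in> AU \<Longrightarrow> col_finite A"
  unfolding AU_def using col_finite_tri by blast

lemma AU_mult:
  assumes "A \<in> AU" "B \<in> AU"
  shows "A \<odot> B \<in> AU"
proof -
  obtain n B' where B: "B \<in> tri n" "B' \<in> tri n" "B \<odot> B' = Idm" "B' \<odot> B = Idm"
    using assms(2) by (rule AU_E)
  obtain m A' where A: "n \<le> m" "A \<in> tri m" "A' \<in> tri m" "A \<odot> A' = Idm" "A' \<odot> A = Idm"
    using assms(1) by (rule AU_E_ge)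
  have B': "B \<in> tri m" "B' \<in> tri m"
    using tri_mono[OF A(1)] B by auto
  note [simp] = A(2,3)[THEN col_finite_tri] B'[THEN col_finite_tri]
  have "(A \<odot> B) \<odot> (B' \<odot> A') = A \<odot> (B \<odot> B') \<odot> A'" "(B' \<odot> A') \<odot> (A \<odot> B) = B' \<odot> (A' \<odot> A) \<odot> B"
    by (simp_all add: mm_assoc)
  then show ?thesis
    using A B B' by (intro AU_I[of _ m "B' \<odot> A'"] tri_mm) auto
qed

lemma group_G: "group (G :: ('i \<times> 'i \<Rightarrow> 'k::{field,finite}) monoid)"
proof (rule groupI)
  show "\<exists>B\<in>carrier G. B \<otimes>\<^bsub>G\<^esub> A = \<one>\<^bsub>G\<^esub>" if A: "A \<in> carrier G" for A :: "'i \<times> 'i \<Rightarrow> 'k"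
  proof -
    obtain m B where B: "A \<in> tri m" "B \<in> tri m" "A \<odot> B = Idm" "B \<odot> A = Idm"
      using A unfolding carrier_AU AU_def by blast
    then have "B \<in> AU"
      using AU_I by blast
    then show ?thesis
      using B by (intro bexI[of _ B]) (simp_all add: carrier_AU)
  qed
qed (use AU_mult AU_Idm in \<open>auto simp: carrier_AU mm_assoc\<close>)

lemma inv_AU:
  assumes "A \<in> AU"
  shows "inv\<^bsub>G\<^esub> A \<in> AU" "A \<odot> inv\<^bsub>G\<^esub> A = Idm" "inv\<^bsub>G\<^esub> A \<odot> A = Idm"
  using assms group.inv_closed[OF group_G] group.r_inv[OF group_G] group.l_inv[OF group_G]
  by (simp_all add: carrier_AU)

lemma inv_eqI:
  assumes "A \<in> AU" "B \<in> AU" "B \<odot> A = Idm"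
  shows "inv\<^bsub>G\<^esub> A = B"
  using assms group.inv_equality[OF group_G] by (metis carrier_AU mult_G one_G)

text \<open>The inverse is a priori only in some \<open>tri e\<close>; \<open>inverse_tri\<close>
  brings it back to the \<open>m\<close> of the matrix itself.\<close>

lemma inv_tri:
  assumes "A \<in> AU" "A \<in> tri m"
  shows "inv\<^bsub>G\<^esub> A \<in> tri m"
proof -
  obtain e where "inv\<^bsub>G\<^esub> A \<in> tri e"
    using inv_AU(1)[OF assms(1)] unfolding AU_def by blast
  then show ?thesis
    using inverse_tri assms inv_AU by metis
qed

lemma inv_mm [simp]: "A \<in> AU \<Longrightarrow> col_finite B \<Longrightarrow> inv\<^bsub>G\<^esub> A \<odot> (A \<odot> B) = B"
  using inv_AU by (metis Idm_mm col_finite_AU mm_assoc)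

lemma mm_inv [simp]: "A \<in> AU \<Longrightarrow> col_finite B \<Longrightarrow> A \<odot> (inv\<^bsub>G\<^esub> A \<odot> B) = B"
  using inv_AU by (metis Idm_mm col_finite_AU mm_assoc)

lemma col_finite_inv [simp]: "A \<in> AU \<Longrightarrow> col_finite (inv\<^bsub>G\<^esub> A)"
  by (simp add: inv_AU(1))

section \<open>Congruence subgroups\<close>

definition V :: "nat \<Rightarrow> ('i \<times> 'i \<Rightarrow> 'k::{field,finite}) set" where
  "V m = {A \<in> AU. A \<in> tri m \<and> A \<odot> proj m = proj m}"

lemma V_AU: "A \<in> V m \<Longrightarrow> A \<in> AU"
  by (simp add: V_def)

lemma col_finite_V [simp]: "A \<in> V m \<Longrightarrow> col_finite A"
  by (simp add: V_def)

lemma V_iff: "A \<in> V m \<longleftrightarrow> A \<in> AU \<and> A \<in> tri m \<and> (\<forall>i j. b j < m \<longrightarrow> A (i, j) = Idm (i, j))"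
proof -
  have "A \<odot> proj m = proj m \<longleftrightarrow> (\<forall>i j. b j < m \<longrightarrow> A (i, j) = Idm (i, j))"
    by (auto simp: fun_eq_iff mm_proj proj_apply)
  then show ?thesis
    unfolding V_def by blast
qed

text \<open>An entry below the diagonal in the first \<open>m\<close> blocks of rows also lies in
  the first \<open>m\<close> blocks of columns, where the matrix is the identity.\<close>

lemma V_tri0:
  assumes A: "A \<in> V m"
  shows "A \<in> tri 0"
  unfolding tri_def
proof clarify
  fix i j assume "b j < b i"
  then show "A (i, j) = 0"
    using A unfolding V_iff tri_def by (cases "m \<le> b i") (auto simp: not_le)
qed

lemma V_mono:
  assumes "m \<le> n"
  shows "V n \<subseteq> V m"
proof
  fix A assume A: "A \<in> V n"
  then have "A \<in> tri m"
    using V_tri0 tri_mono[of 0 m] by blast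
  then show "A \<in> V m"
    using A assms by (simp add: V_iff)
qed

lemma V_0: "V 0 = AU \<inter> tri 0"
  by (auto simp: V_iff)

lemma V_mult: "A \<in> V m \<Longrightarrow> B \<in> V m \<Longrightarrow> A \<odot> B \<in> V m"
  unfolding V_def using AU_mult tri_mm by (auto simp: mm_assoc)

lemma inv_proj:
  assumes "A \<in> AU" "A \<odot> proj m = C \<odot> proj m" "col_finite C"
  shows "inv\<^bsub>G\<^esub> A \<odot> C \<odot> proj m = proj m"
  using assms by (metis col_finite_proj inv_mm mm_assoc)

lemma V_inv:
  assumes "A \<in> V m"
  shows "inv\<^bsub>G\<^esub> A \<in> V m"
  using assms inv_AU(1) inv_tri inv_proj[of A m Idm] by (auto simp: V_def)

text \<open>The span of the first \<open>m\<close> blocks is invariant under \<open>x\<close> and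
  its inverse and is fixed pointwise by \<open>v\<close>, hence also by the conjugate.\<close>

lemma V_normal:
  assumes x: "x \<in> AU" "x \<in> tri m" and v: "v \<in> V m"
  shows "x \<odot> v \<odot> inv\<^bsub>G\<^esub> x \<in> V m"
proof -
  have v': "v \<in> AU" "v \<in> tri m" "v \<odot> proj m = proj m"
    using v by (auto simp: V_def)
  note [simp] = x(1) v'(1)
  have p: "inv\<^bsub>G\<^esub> x \<odot> proj m = proj m \<odot> (inv\<^bsub>G\<^esub> x \<odot> proj m)"
    using proj_mm_proj inv_tri x by (metis order_refl)
  have "x \<odot> v \<odot> inv\<^bsub>G\<^esub> x \<odot> proj m = x \<odot> (v \<odot> proj m \<odot> (inv\<^bsub>G\<^esub> x \<odot> proj m))"
    using p by (simp add: mm_assoc)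
  also have "\<dots> = proj m"
    using p v' by simp
  finally show ?thesis
    using x v' inv_AU(1)[OF x(1)] inv_tri[OF x] unfolding V_def mem_Collect_eq
    by (intro conjI AU_mult tri_mm)
qed

lemma filtered_group_G: "filtered_group (G :: ('i \<times> 'i \<Rightarrow> 'k::{field,finite}) monoid) V"
proof (intro filtered_group.intro filtered_group_axioms.intro group_G)
  show "subgroup (V n) (G :: ('i \<times> 'i \<Rightarrow> 'k) monoid)" for n
  proof (rule subgroup.intro)
    show "V n \<subseteq> carrier (G :: ('i \<times> 'i \<Rightarrow> 'k) monoid)"
      using V_AU by (auto simp: carrier_AU)
    show "\<one>\<^bsub>G\<^esub> \<in> (V n :: ('i \<times> 'i \<Rightarrow> 'k) set)"
      by (simp add: V_iff AU_Idm tri_Idm)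
  qed (simp_all add: V_mult V_inv)
  show "V n \<subseteq> (V m :: ('i \<times> 'i \<Rightarrow> 'k) set)" if "m \<le> n" for m n
    using V_mono that by blast
  fix x :: "'i \<times> 'i \<Rightarrow> 'k" and n
  assume "x \<in> carrier G"
  then have x: "x \<in> AU"
    by (simp add: carrier_AU)
  then obtain m where m: "n \<le> m" "x \<in> tri m"
    using AU_E_ge by metis
  then have "\<forall>v\<in>V m. x \<odot> v \<odot> inv\<^bsub>G\<^esub> x \<in> V n"
    using V_normal[OF x m(2)] V_mono[OF m(1)] by blast
  then show "\<exists>m. \<forall>v\<in>V m. x \<otimes>\<^bsub>G\<^esub> v \<otimes>\<^bsub>G\<^esub> inv\<^bsub>G\<^esub> x \<in> V n"
    by (intro exI[of _ m]) (simp only: mult_G)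
qed

subsection \<open>Identification of the topology\<close>

text \<open>Finitely many entries always lie in a square of initial segments, so agreement on such
  squares describes the basic neighbourhoods of the product topology.\<close>

definition agree :: "nat \<Rightarrow> ('i \<times> 'i \<Rightarrow> 'k) \<Rightarrow> ('i \<times> 'i \<Rightarrow> 'k) \<Rightarrow> bool" where
  "agree n A B \<longleftrightarrow> (\<forall>i j. b i < n \<and> b j < n \<longrightarrow> A (i, j) = B (i, j))"

lemma openin_matrix_topology:
  "openin (product_topology (\<lambda>_. discrete_topology UNIV) (UNIV \<times> UNIV)) W \<longleftrightarrow>
    (\<forall>A\<in>W. \<exists>n. \<forall>A'. agree n A' A \<longrightarrow> A' \<in> W)" (is "?L \<longleftrightarrow> ?R")
proof
  assume L: ?L
  show ?R
  proof
    fix A assume "A \<in> W"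
    then obtain U where U: "finite {p. U p \<noteq> UNIV}" "\<And>p. A p \<in> U p" "\<And>A'. (\<And>p. A' p \<in> U p) \<Longrightarrow> A' \<in> W"
      using L unfolding openin_product_topology_alt by (fastforce simp: Pi_iff)
    obtain n where n: "fst ` {p. U p \<noteq> UNIV} \<union> snd ` {p. U p \<noteq> UNIV} \<subseteq> {i. b i < n}"
      using finite_bound[of "fst ` {p. U p \<noteq> UNIV} \<union> snd ` {p. U p \<noteq> UNIV}"] U(1) by blast
    have "A' \<in> W" if "agree n A' A" for A'
    proof (rule U(3))
      fix p
      show "A' p \<in> U p"
      proof (cases "U p = UNIV")
        case False
        then have "b (fst p) < n \<and> b (snd p) < n"
          using n by blast
        then have "A' p = A p"
          using that unfolding agree_def by (metis prod.collapse)
        then show ?thesis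
          using U(2) by simp
      qed simp
    qed
    then show "\<exists>n. \<forall>A'. agree n A' A \<longrightarrow> A' \<in> W"
      by blast
  qed
next
  assume R: ?R
  show ?L
    unfolding openin_product_topology_alt
  proof
    fix A assume "A \<in> W"
    then obtain n where n: "\<And>A'. agree n A' A \<Longrightarrow> A' \<in> W"
      using R by blast
    define U where "U = (\<lambda>p. if b (fst p) < n \<and> b (snd p) < n then {A p} else UNIV)"
    have "{p. U p \<noteq> UNIV} \<subseteq> {i. b i < n} \<times> {i. b i < n}"
      by (auto simp: U_def)
    then have "finite {p. U p \<noteq> UNIV}"
      using finite_below finite_subset by blast
    moreover have "A' \<in> W" if "\<forall>p. A' p \<in> U p" for A'
    proof (rule n, unfold agree_def, clarify)
      fix i j assume "b i < n" "b j < n"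
      then show "A' (i, j) = A (i, j)"
        using that[rule_format, of "(i, j)"] by (simp add: U_def)
    qed
    moreover have "A p \<in> U p" for p
      by (simp add: U_def)
    ultimately show "\<exists>U. finite {i \<in> UNIV \<times> UNIV. U i \<noteq> topspace (discrete_topology UNIV)} \<and>
        (\<forall>i\<in>UNIV \<times> UNIV. openin (discrete_topology UNIV) (U i)) \<and>
        A \<in> Pi\<^sub>E (UNIV \<times> UNIV) U \<and> Pi\<^sub>E (UNIV \<times> UNIV) U \<subseteq> W"
      by (intro exI[of _ U]) (auto simp: PiE_iff)
  qed
qed

lemma openin_U_topology:
  "openin (U_topology UNIV R) W \<longleftrightarrow> W \<subseteq> carrier (U_group UNIV R) \<and>
    (\<forall>A\<in>W. \<exists>n. \<forall>A'\<in>carrier (U_group UNIV R). agree n A' A \<longrightarrow> A' \<in> W)" (is "?L \<longleftrightarrow> ?R")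
proof
  assume ?L
  then show ?R
    unfolding U_topology_def openin_subtopology openin_matrix_topology by blast
next
  assume R: ?R
  let ?W = "{A'. \<exists>A\<in>W. \<exists>n. agree n A' A \<and>
    (\<forall>A'\<in>carrier (U_group UNIV R). agree n A' A \<longrightarrow> A' \<in> W)}"
  have "\<forall>A\<in>?W. \<exists>n. \<forall>A'. agree n A' A \<longrightarrow> A' \<in> ?W"
  proof
    fix A assume "A \<in> ?W"
    then obtain B n where B: "B \<in> W" "agree n A B"
      "\<forall>A'\<in>carrier (U_group UNIV R). agree n A' B \<longrightarrow> A' \<in> W"
      by blast
    have "agree n A' B" if "agree n A' A" for A'
      using that B(2) by (simp add: agree_def)
    then show "\<exists>n. \<forall>A'. agree n A' A \<longrightarrow> A' \<in> ?W"
      using B by blast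
  qed
  moreover have "agree n A A" for n A
    by (simp add: agree_def)
  then have "W = ?W \<inter> carrier (U_group UNIV R)"
    using R by blast
  ultimately show ?L
    unfolding U_topology_def openin_subtopology openin_matrix_topology by blast
qed

lemma topspace_U_topology: "topspace (U_topology UNIV R) = carrier (U_group UNIV R)"
  by (auto simp: U_topology_def)

text \<open>Below the square the first \<open>n\<close> blocks of columns vanish for matrices in
  \<open>tri n\<close>, so agreement on the square is agreement on those whole columns.\<close>

lemma agree_imp_V:
  assumes A: "A \<in> AU" "A \<in> tri n" and A': "A' \<in> AU" "A' \<in> tri n" and "agree n A' A"
  shows "inv\<^bsub>G\<^esub> A \<odot> A' \<in> V n"
proof -
  have "A \<odot> proj n = A' \<odot> proj n"
  proof (rule ext, clarify)
    fix i j
    show "(A \<odot> proj n) (i, j) = (A' \<odot> proj n) (i, j)"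
      using assms triD[of A n j i] triD[of A' n j i] unfolding mm_proj agree_def
      by (cases "b i < n") auto
  qed
  then show ?thesis
    using assms inv_AU(1) inv_tri[OF A] inv_proj[of A n A'] by (auto simp: V_def intro: AU_mult tri_mm)
qed

lemma mm_V_column:
  assumes "v \<in> V n" "b j < n"
  shows "(A \<odot> v) (i, j) = A (i, j)"
proof -
  have "A \<odot> v \<odot> proj n = A \<odot> proj n"
    using assms by (simp add: mm_assoc) (simp add: V_def)
  then show ?thesis
    using assms(2) by (metis mm_proj)
qed

lemma carrier_U_tri:
  assumes "finite S" "S \<subseteq> {i. b i < m}" "A \<in> carrier (U_group UNIV (rel S))"
  shows "A \<in> AU" "A \<in> tri m"
  using assms unfolding carrier_U[OF assms(1)] tri_def by fastforce+

abbreviation inclusions_open :: "('i \<times> 'i \<Rightarrow> 'k::{field,finite}) topology \<Rightarrow> bool" where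
  "inclusions_open T \<equiv> topological_group G T \<and>
     (\<forall>S. finite S \<and> order_convex UNIV (rel {}) S \<longrightarrow>
        continuous_map (U_topology UNIV (merge_preorder UNIV (rel {}) S)) T (\<lambda>A. A) \<and>
        open_map (U_topology UNIV (merge_preorder UNIV (rel {}) S)) T (\<lambda>A. A))"

text \<open>Existence for the definite description in \<open>AU_topology\<close>. For group elements
  in \<open>tri n\<close>, agreement on the square of the first \<open>n\<close> blocks and equality
  modulo \<open>V n\<close> are the same, so the entrywise topology and the coset topology coincide
  there.\<close>

lemma inclusions_open_filtration:
  "inclusions_open (filtration_topology G V :: ('i \<times> 'i \<Rightarrow> 'k::{field,finite}) topology)"
proof (intro conjI allI impI)
  interpret F: filtered_group "G :: ('i \<times> 'i \<Rightarrow> 'k) monoid" V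
    by (rule filtered_group_G)
  show "topological_group G F.T"
    by (rule F.topological_group_T)
  fix S assume S: "finite S \<and> order_convex UNIV (rel {}) S"
  obtain m where m: "S \<subseteq> {i. b i < m}"
    using finite_bound S by metis
  have U: "merge_preorder UNIV (rel {}) S = rel S"
    using merge_rel S by blast
  let ?C = "carrier (U_group UNIV (rel S)) :: ('i \<times> 'i \<Rightarrow> 'k) set"
  note tri = carrier_U_tri[OF _ m]
  show "continuous_map (U_topology UNIV (merge_preorder UNIV (rel {}) S)) F.T (\<lambda>A. A)"
    unfolding U continuous_map_def topspace_U_topology F.topspace_T
  proof (intro conjI allI impI)
    show "(\<lambda>A. A) \<in> ?C \<rightarrow> carrier G"
      using tri(1) S by (auto simp: carrier_AU)
    fix W :: "('i \<times> 'i \<Rightarrow> 'k) set" assume W: "openin F.T W"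
    show "openin (U_topology UNIV (rel S)) {A \<in> ?C. A \<in> W}"
      unfolding openin_U_topology
    proof (intro conjI ballI)
      fix A assume A: "A \<in> {A \<in> ?C. A \<in> W}"
      then obtain n where n: "\<forall>v\<in>V n. A \<odot> v \<in> W"
        using W unfolding F.openin_T by auto
      have "A' \<in> W" if A': "A' \<in> ?C" "agree (max m n) A' A" for A'
      proof -
        have "A \<in> AU" "A \<in> tri (max m n)" "A' \<in> AU" "A' \<in> tri (max m n)"
          using tri A A' S tri_mono[of m "max m n"] by auto
        moreover from this have "inv\<^bsub>G\<^esub> A \<odot> A' \<in> V (max m n)"
          using agree_imp_V A' by blast
        ultimately show ?thesis
          using n V_mono[of n "max m n"] mm_inv[of A A'] by (metis col_finite_AU max.cobounded2 subsetD)
      qed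
      then show "\<exists>n. \<forall>A'\<in>?C. agree n A' A \<longrightarrow> A' \<in> {A \<in> ?C. A \<in> W}"
        by blast
    qed blast
  qed
  show "open_map (U_topology UNIV (merge_preorder UNIV (rel {}) S)) F.T (\<lambda>A. A)"
    unfolding U open_map_def
  proof (intro allI impI)
    fix W :: "('i \<times> 'i \<Rightarrow> 'k) set" assume W: "openin (U_topology UNIV (rel S)) W"
    have "openin F.T W"
      unfolding F.openin_T
    proof (intro conjI ballI)
      show "W \<subseteq> carrier G"
        using W tri(1) S unfolding openin_U_topology carrier_AU by blast
      fix A assume A: "A \<in> W"
      then obtain n where n: "A \<in> ?C" "\<forall>A'\<in>?C. agree n A' A \<longrightarrow> A' \<in> W"
        using W unfolding openin_U_topology by blast
      have "A \<odot> v \<in> W" if v: "v \<in> V (max m n)" for v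
      proof -
        have "A \<in> tri (max m n)"
          using tri(2)[OF _ n(1)] S tri_mono[of m "max m n"] by auto
        then have t: "A \<odot> v \<in> tri (max m n)"
          using v tri_mm by (auto simp: V_def)
        \<comment> \<open>Early columns are those of \<open>A\<close>; in later columns membership
          in \<open>tri (max m n)\<close> already forces the zero.\<close>
        have "(A \<odot> v) (i, j) = 0" if "b j < b i" "(i, j) \<notin> S \<times> S" for i j
        proof (cases "b j < max m n")
          case True
          then show ?thesis
            using mm_V_column[OF v] n(1) that S by (auto simp: carrier_U)
        next
          case False
          then show ?thesis
            using triD[OF t that(1)] that(1) by linarith
        qed
        moreover have "A \<odot> v \<in> AU"
          using AU_mult V_AU[OF v] tri(1)[OF _ n(1)] S by blast
        ultimately have "A \<odot> v \<in> ?C"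
          using S by (simp add: carrier_U)
        moreover have "agree n (A \<odot> v) A"
          unfolding agree_def
          by (intro allI impI, intro mm_V_column[OF v]) (simp add: less_max_iff_disj)
        ultimately show ?thesis
          using n(2) by blast
      qed
      then show "\<exists>n. \<forall>v\<in>V n. A \<otimes>\<^bsub>G\<^esub> v \<in> W"
        by (intro exI[of _ "max m n"]) simp
    qed
    then show "openin F.T ((\<lambda>A. A) ` W)"
      by simp
  qed
qed

text \<open>Applied in both directions, this gives uniqueness. Each \<open>A\<close> lies in the
  subgroup for the merged first \<open>m\<close> blocks; continuity of its inclusion for
  \<open>T1\<close> and openness for \<open>T2\<close> carry a neighbourhood of \<open>A\<close>
  from one topology to the other.\<close>

lemma inclusions_open_finer:
  fixes T1 T2 :: "('i \<times> 'i \<Rightarrow> 'k::{field,finite}) topology"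
  assumes T1: "inclusions_open T1" and T2: "inclusions_open T2" and W: "openin T1 W"
  shows "openin T2 W"
proof (subst openin_subopen, intro ballI)
  fix A assume A: "A \<in> W"
  have "topspace T1 = AU"
    using T1 by (simp add: topological_group_def carrier_AU)
  then have "A \<in> AU"
    using A W openin_subset by blast
  then obtain m where m: "A \<in> tri m"
    by (auto simp: AU_def)
  let ?S = "{i. b i < m}"
  have S: "finite ?S" "order_convex UNIV (rel {}) ?S"
    using finite_below convex_below[of "{}" m] by auto
  let ?U = "U_topology UNIV (merge_preorder UNIV (rel {}) ?S) :: ('i \<times> 'i \<Rightarrow> 'k) topology"
  have "openin ?U {A \<in> topspace ?U. A \<in> W}"
    using T1 S W unfolding continuous_map_def by blast
  then have "openin T2 ((\<lambda>A. A) ` {A \<in> topspace ?U. A \<in> W})"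
    using T2 S unfolding open_map_def by blast
  moreover have "A \<in> topspace ?U"
    using \<open>A \<in> AU\<close> m unfolding merge_rel[OF S(2)] topspace_U_topology carrier_U[OF S(1)]
    by (auto simp: tri_def)
  ultimately show "\<exists>T. openin T2 T \<and> A \<in> T \<and> T \<subseteq> W"
    using A by (intro exI[of _ "(\<lambda>A. A) ` {A \<in> topspace ?U. A \<in> W}"]) auto
qed

lemma AU_topology_eq:
  "AU_topology UNIV (rel {}) = (filtration_topology G V :: ('i \<times> 'i \<Rightarrow> 'k::{field,finite}) topology)"
  unfolding AU_topology_def
proof (rule the_equality)
  show "inclusions_open (filtration_topology G V :: ('i \<times> 'i \<Rightarrow> 'k) topology)"
    by (rule inclusions_open_filtration)
  show "T = filtration_topology G V" if "inclusions_open T" for T :: "('i \<times> 'i \<Rightarrow> 'k) topology"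
    unfolding topology_eq using inclusions_open_finer that inclusions_open_filtration by blast
qed

text \<open>The set is closed in a compact product of finite discrete spaces: a matrix outside it is
  recognised in a finite square, by a nonzero entry below the diagonal blocks or by a truncation
  that is not invertible.\<close>

lemma compactin_V_0:
  "compactin (filtration_topology G V :: ('i \<times> 'i \<Rightarrow> 'k::{field,finite}) topology) (V 0)"
proof -
  let ?P = "product_topology (\<lambda>_. discrete_topology UNIV) (UNIV \<times> UNIV) :: ('i \<times> 'i \<Rightarrow> 'k) topology"
  have carrier: "carrier (U_group UNIV (rel {}) :: ('i \<times> 'i \<Rightarrow> 'k) monoid) = V 0"
    unfolding V_0 carrier_U[OF finite.emptyI] by (auto simp: tri_def)
  have "openin ?P (UNIV - V 0)"
    unfolding openin_matrix_topology
  proof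
    fix A :: "'i \<times> 'i \<Rightarrow> 'k" assume A: "A \<in> UNIV - V 0"
    show "\<exists>n. \<forall>A'. agree n A' A \<longrightarrow> A' \<in> UNIV - V 0"
    proof (cases "A \<in> tri 0")
      case True
      then have "A \<notin> AU"
        using A V_0 by blast
      then obtain e where e: "\<not> inv_on {i. b i < e} A"
        using True unfolding AU_iff by blast
      have "A' \<notin> V 0" if A': "agree e A' A" for A'
      proof
        assume "A' \<in> V 0"
        then have "A' \<in> AU" "A' \<in> tri 0"
          by (auto simp: V_0)
        then have "inv_on {i. b i < e} A'"
          using inv_on_below[of A' 0 "inv\<^bsub>G\<^esub> A'" e] inv_tri inv_AU by blast
        then have "inv_on {i. b i < e} A"
          using A' unfolding inv_on_def agree_def by simp
        then show False
          using e by blast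
      qed
      then show ?thesis
        by blast
    next
      case False
      then obtain i j where ij: "b j < b i" "A (i, j) \<noteq> 0"
        by (auto simp: tri_def)
      then have "A' \<notin> V 0" if "agree (Suc (b i)) A' A" for A'
        using that triD[of A' 0 j i] unfolding agree_def V_0 by force
      then show ?thesis
        by blast
    qed
  qed
  then have "closedin ?P (V 0)"
    by (auto simp: closedin_def)
  moreover have "compact_space ?P"
    by (simp add: compact_space_product_topology compact_space_discrete_topology)
  ultimately have "compactin ?P (V 0)"
    using closedin_compact_space by blast
  then have "compactin (U_topology UNIV (rel {})) (V 0 :: ('i \<times> 'i \<Rightarrow> 'k) set)"
    unfolding U_topology_def compactin_subtopology using carrier by simp
  moreover have "continuous_map (U_topology UNIV (rel {})) (filtration_topology G V)
      (\<lambda>A :: 'i \<times> 'i \<Rightarrow> 'k. A)"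
    using inclusions_open_filtration merge_rel[OF order_convex_empty] order_convex_empty
    by (metis finite.emptyI)
  ultimately have "compactin (filtration_topology G V) ((\<lambda>A. A) ` (V 0 :: ('i \<times> 'i \<Rightarrow> 'k) set))"
    by (rule image_compactin)
  then show ?thesis
    by simp
qed

subsection \<open>Scalar matrices\<close>

abbreviation Z :: "('i \<times> 'i \<Rightarrow> 'k::{field,finite}) set" where
  "Z \<equiv> Z_subgroup UNIV (rel {})"

lemma Z_iff: "A \<in> Z \<longleftrightarrow> A \<in> AU \<and> scalar_matrix UNIV A"
proof -
  have "A \<in> tri 0" if "scalar_matrix UNIV A"
    unfolding tri_def
  proof clarify
    fix i j assume "b j < b i"
    then have "i \<noteq> j"
      by auto
    then show "A (i, j) = 0"
      using that by (simp add: scalar_matrix_def)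
  qed
  then show ?thesis
    unfolding Z_subgroup_def AU_iff by (auto simp: nonsingular_rel)
qed

lemma scalar_obtain:
  assumes "scalar_matrix UNIV A"
  obtains c where "\<And>i j. A (i, j) = (if i = j then c else 0)"
  using assms that[of "A (undefined, undefined)"] by (auto simp: scalar_matrix_def)

lemma scalar_mm:
  assumes "\<And>i j. A (i, j) = (if i = j then c else 0)"
  shows "(B \<odot> A) (i, j) = B (i, j) * c"
    and "col_finite B \<Longrightarrow> (A \<odot> B) (i, j) = c * B (i, j)"
proof -
  show "(B \<odot> A) (i, j) = B (i, j) * c"
    using assms by (subst mm_sum[of "{j}"]) auto
  assume "col_finite B"
  then have "(A \<odot> B) (i, j) = (\<Sum>k\<in>insert i {k. B (k, j) \<noteq> 0}. A (i, k) * B (k, j))"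
    by (intro mm_sum) (auto simp: col_finite_def)
  also have "\<dots> = (\<Sum>k\<in>insert i {k. B (k, j) \<noteq> 0}. if i = k then c * B (k, j) else 0)"
    using assms by (intro sum.cong) auto
  also have "\<dots> = c * B (i, j)"
    using \<open>col_finite B\<close> by (simp add: col_finite_def)
  finally show "(A \<odot> B) (i, j) = c * B (i, j)" .
qed

lemma Z_commute:
  assumes "A \<in> Z" "col_finite B"
  shows "A \<odot> B = B \<odot> A"
proof -
  obtain c where c: "\<And>i j. A (i, j) = (if i = j then c else 0)"
    using assms scalar_obtain unfolding Z_iff by metis
  show ?thesis
    by (rule ext, clarify) (simp only: scalar_mm[OF c] assms(2) mult.commute)
qed

lemma Z_normal: "Z \<lhd> (G :: ('i \<times> 'i \<Rightarrow> 'k::{field,finite}) monoid)"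
  unfolding group.normal_inv_iff[OF group_G]
proof
  show "subgroup Z (G :: ('i \<times> 'i \<Rightarrow> 'k) monoid)"
  proof (rule subgroup.intro)
    show "Z \<subseteq> carrier (G :: ('i \<times> 'i \<Rightarrow> 'k) monoid)"
      by (auto simp: Z_iff carrier_AU)
    show "\<one>\<^bsub>G\<^esub> \<in> (Z :: ('i \<times> 'i \<Rightarrow> 'k) set)"
      by (simp add: Z_iff AU_Idm scalar_matrix_def)
    show "A \<otimes>\<^bsub>G\<^esub> B \<in> Z" if A: "A \<in> Z" and B: "B \<in> Z" for A B :: "'i \<times> 'i \<Rightarrow> 'k"
    proof -
      obtain c where c: "\<And>i j. A (i, j) = (if i = j then c else 0)"
        using A scalar_obtain unfolding Z_iff by metis
      have "col_finite B"
        using B by (simp add: Z_iff)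
      then show ?thesis
        using A B AU_mult[of A B] unfolding Z_iff scalar_matrix_def by (simp add: scalar_mm(2)[OF c])
    qed
    show "inv\<^bsub>G\<^esub> A \<in> Z" if A: "A \<in> Z" for A :: "'i \<times> 'i \<Rightarrow> 'k"
    proof -
      obtain c where c: "\<And>i j. A (i, j) = (if i = j then c else 0)"
        using A scalar_obtain unfolding Z_iff by metis
      have B: "(inv\<^bsub>G\<^esub> A) (i, j) * c = Idm (i, j)" for i j
        using A inv_AU(3) scalar_mm(1)[OF c] unfolding Z_iff by metis
      then have "c \<noteq> 0"
        using B[of undefined undefined] by (metis Idm_apply mult_zero_right one_neq_zero)
      then have "(inv\<^bsub>G\<^esub> A) (i, j) = Idm (i, j) / c" for i j
        using B[of i j] by (simp add: field_simps)
      then show ?thesis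
        using A inv_AU(1) unfolding Z_iff scalar_matrix_def by auto
    qed
  qed
  show "\<forall>x\<in>carrier G. \<forall>h\<in>Z. x \<otimes>\<^bsub>G\<^esub> h \<otimes>\<^bsub>G\<^esub> inv\<^bsub>G\<^esub> x \<in> (Z :: ('i \<times> 'i \<Rightarrow> 'k) set)"
  proof (intro ballI)
    fix x h :: "'i \<times> 'i \<Rightarrow> 'k" assume x: "x \<in> carrier G" and h: "h \<in> Z"
    then have "x \<odot> h \<odot> inv\<^bsub>G\<^esub> x = h"
      using inv_AU(1)[of x] Z_commute[OF h, of "inv\<^bsub>G\<^esub> x"] by (auto simp: carrier_AU Z_iff mm_assoc)
    then show "x \<otimes>\<^bsub>G\<^esub> h \<otimes>\<^bsub>G\<^esub> inv\<^bsub>G\<^esub> x \<in> Z"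
      using h by simp
  qed
qed

lemma Z_coset_eq:
  fixes v w :: "'i \<times> 'i \<Rightarrow> 'k::{field,finite}"
  assumes "v \<in> AU" "Z #>\<^bsub>G\<^esub> v = Z #>\<^bsub>G\<^esub> w"
  obtains z where "z \<in> Z" "v = z \<odot> w"
proof -
  have "v \<in> Z #>\<^bsub>G\<^esub> v"
    using assms(1) Z_normal group_G by (intro group.rcos_self) (auto simp: carrier_AU normal_def)
  then show ?thesis
    using that assms(2) by (auto simp: r_coset_def)
qed

text \<open>Elements of \<open>V 1\<close> have diagonal entry \<open>1\<close> in block
  \<open>0\<close>, which determines the scalar factor. Near the identity the quotient therefore
  looks like \<open>AU\<close> itself, and local isomorphisms can be lifted.\<close>

lemma Z_coset_inj: "inj_on (\<lambda>v. Z #>\<^bsub>G\<^esub> v) (V 1 :: ('i \<times> 'i \<Rightarrow> 'k::{field,finite}) set)"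
proof (rule inj_onI)
  fix v w :: "'i \<times> 'i \<Rightarrow> 'k" assume v: "v \<in> V 1" and w: "w \<in> V 1" and eq: "Z #>\<^bsub>G\<^esub> v = Z #>\<^bsub>G\<^esub> w"
  obtain z where z: "z \<in> Z" "v = z \<odot> w"
    using Z_coset_eq eq v V_AU by metis
  obtain c where c: "\<And>i j. z (i, j) = (if i = j then c else 0)"
    using z scalar_obtain unfolding Z_iff by metis
  have vw: "v (i, j) = c * w (i, j)" for i j
    unfolding z(2) using w by (intro scalar_mm(2)[OF c]) simp
  obtain i where "b i = 0" by (rule fibre_obtain)
  then have "c = 1"
    using v w vw[of i i] by (simp add: V_iff)
  then show "v = w"
    using vw by auto
qed

abbreviation V_bar :: "nat \<Rightarrow> ('i \<times> 'i \<Rightarrow> 'k::{field,finite}) set set" where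
  "V_bar n \<equiv> (\<lambda>v. Z #>\<^bsub>G\<^esub> v) ` V n"

lemma filtered_group_PAU:
  "filtered_group (PAU_group UNIV (rel {}) :: ('i \<times> 'i \<Rightarrow> 'k::{field,finite}) set monoid) V_bar"
  unfolding PAU_group_def
  using filtered_group.quotient_filtered_group(1)[OF filtered_group_G Z_normal] .

lemma PAU_topology_eq:
  "PAU_topology UNIV (rel {}) = filtration_topology
     (PAU_group UNIV (rel {}) :: ('i \<times> 'i \<Rightarrow> 'k::{field,finite}) set monoid) V_bar"
  unfolding PAU_topology_def PAU_group_def AU_topology_eq
  using filtered_group.quotient_filtered_group(2)[OF filtered_group_G Z_normal] .

lemma tdlc_PAU:
  "tdlc_group (PAU_group UNIV (rel {}))
     (PAU_topology UNIV (rel {}) :: ('i \<times> 'i \<Rightarrow> 'k::{field,finite}) set topology)"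
proof -
  interpret F: filtered_group "G :: ('i \<times> 'i \<Rightarrow> 'k) monoid" V
    by (rule filtered_group_G)
  interpret Q: filtered_group "PAU_group UNIV (rel {}) :: ('i \<times> 'i \<Rightarrow> 'k) set monoid" V_bar
    by (rule filtered_group_PAU)
  have one: "\<one>\<^bsub>PAU_group UNIV (rel {})\<^esub> = (Z :: ('i \<times> 'i \<Rightarrow> 'k) set)"
    by (simp add: PAU_group_def FactGroup_def)
  have "X = Z" if X: "\<And>n. X \<in> V_bar n" for X :: "('i \<times> 'i \<Rightarrow> 'k) set"
  proof -
    obtain v where v: "v \<in> V 0" "X = Z #>\<^bsub>G\<^esub> v"
      using X[of 0] by blast
    then have vAU: "v \<in> AU"
      using V_AU by blast
    \<comment> \<open>Membership of the coset in \<open>V_bar n\<close> makes the first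
      \<open>n\<close> blocks of columns of \<open>v\<close> agree with a scalar matrix; as
      \<open>n\<close> varies, \<open>v\<close> itself is scalar.\<close>
    have ex: "\<exists>c. \<forall>i j. b j < n \<longrightarrow> v (i, j) = c * Idm (i, j)" for n
    proof -
      obtain w where w: "w \<in> V n" "X = Z #>\<^bsub>G\<^esub> w"
        using X[of n] by blast
      obtain z where z: "z \<in> Z" "v = z \<odot> w"
        using Z_coset_eq[OF vAU, of w] v w by metis
      obtain c where c: "\<And>i j. z (i, j) = (if i = j then c else 0)"
        using z scalar_obtain unfolding Z_iff by metis
      have "v (i, j) = c * w (i, j)" for i j
        unfolding z(2) using w by (intro scalar_mm(2)[OF c]) simp
      then show ?thesis
        using w unfolding V_iff by metis
    qed
    have "scalar_matrix UNIV v"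
      unfolding scalar_matrix_def
    proof (intro conjI ballI impI)
      show "v (i, j) = 0" if "i \<noteq> j" for i j
        using ex[of "Suc (b j)"] that by auto
      show "v (i, i) = v (j, j)" for i j
        using ex[of "Suc (max (b i) (b j))"] by (auto simp: less_Suc_eq_le)
    qed
    then have "v \<in> Z"
      using vAU by (simp add: Z_iff)
    then show ?thesis
      unfolding v(2) using subgroup.rcos_const[OF normal_imp_subgroup[OF Z_normal] group_G] by blast
  qed
  moreover have "(Z :: ('i \<times> 'i \<Rightarrow> 'k) set) \<in> V_bar n" for n
    using Q.V_one unfolding one by blast
  ultimately have "(\<Inter>n. V_bar n) = {\<one>\<^bsub>PAU_group UNIV (rel {})\<^esub> :: ('i \<times> 'i \<Rightarrow> 'k) set}"
    unfolding one
    by (intro equalityI subsetI) (simp_all only: INT_iff UNIV_I simp_thms singleton_iff ball_UNIV)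
  then have "totally_disconnected_space Q.T"
    by (rule Q.totally_disconnected_T)
  moreover have "compactin Q.T (V_bar 0)"
    using image_compactin[OF compactin_V_0 F.continuous_map_quotient[of Z]]
    unfolding PAU_topology_eq[symmetric] PAU_topology_def AU_topology_eq .
  then have "locally_compact_space Q.T"
    using Q.locally_compact_T by blast
  ultimately show ?thesis
    unfolding tdlc_group_def PAU_topology_eq using Q.topological_group_T by blast
qed

section \<open>Rank one perturbations of the identity\<close>

definition outer :: "('i \<Rightarrow> 'k) \<Rightarrow> ('i \<Rightarrow> 'k) \<Rightarrow> ('i \<times> 'i \<Rightarrow> 'k::{field,finite})" where
  "outer x v = (\<lambda>(i, j). x i * v j)"

definition Col :: "nat \<Rightarrow> ('i \<Rightarrow> 'k::{field,finite}) set" where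
  "Col n = {x. \<forall>i. n \<le> b i \<longrightarrow> x i = 0}"

definition Row :: "nat \<Rightarrow> ('i \<Rightarrow> 'k::{field,finite}) set" where
  "Row n = {v. \<forall>j. b j < n \<longrightarrow> v j = 0}"

definition unit :: "'i \<Rightarrow> 'i \<Rightarrow> 'k::{field,finite}" where
  "unit i = (\<lambda>k. if k = i then 1 else 0)"

text \<open>A transvection when \<open>v\<close> annihilates \<open>x\<close>. The lemmas below
  ensure this by disjoint supports, so the product of \<open>v\<close> and \<open>x\<close> never
  has to be summed.\<close>

definition R :: "('i \<Rightarrow> 'k) \<Rightarrow> ('i \<Rightarrow> 'k) \<Rightarrow> ('i \<times> 'i \<Rightarrow> 'k::{field,finite})" where
  "R x v = Idm + outer x v"

text \<open>Row vector times matrix. Summing over the support of a column keeps the sum finite for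
  column-finite matrices, even if \<open>v\<close> has infinite support.\<close>

definition vm :: "('i \<Rightarrow> 'k) \<Rightarrow> ('i \<times> 'i \<Rightarrow> 'k) \<Rightarrow> ('i \<Rightarrow> 'k::{field,finite})" where
  "vm v A = (\<lambda>j. \<Sum>k | A (k, j) \<noteq> 0. v k * A (k, j))"

lemma outer_apply [simp]: "outer x v (i, j) = x i * v j"
  by (simp add: outer_def)

lemma R_apply: "R x v (i, j) = Idm (i, j) + x i * v j"
  by (simp add: R_def)

lemma outer_tri: "x \<in> Col m \<Longrightarrow> outer x v \<in> tri m"
  by (auto simp: Col_def tri_def)

lemma col_finite_outer: "x \<in> Col m \<Longrightarrow> col_finite (outer x v)"
  using outer_tri col_finite_tri by blast

lemma col_finite_R: "x \<in> Col m \<Longrightarrow> col_finite (R x v)"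
  unfolding R_def by (simp add: col_finite_outer)

lemma unit_Col: "b i < m \<Longrightarrow> unit i \<in> Col m"
  by (auto simp: Col_def unit_def)

lemma unit_Row: "m \<le> b i \<Longrightarrow> unit i \<in> Row m"
  by (auto simp: Row_def unit_def)

lemma unit_neq_0: "unit i \<noteq> (\<lambda>_. 0 :: 'k::{field,finite})"
  by (metis one_neq_zero unit_def)

lemma Row_mono: "m \<le> n \<Longrightarrow> Row n \<subseteq> Row m"
  by (auto simp: Row_def)

lemma Col_mono: "m \<le> n \<Longrightarrow> Col m \<subseteq> Col n"
  by (auto simp: Col_def)

lemma Col_Row: "x \<in> Col m \<Longrightarrow> v \<in> Row m \<Longrightarrow> v k = 0 \<or> x k = 0"
  unfolding Col_def Row_def by (metis (mono_tags, lifting) mem_Collect_eq not_le)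

lemma outer_add: "outer x (v + w) = outer x v + outer x w" "outer x (v - w) = outer x v - outer x w"
  by (auto simp: fun_eq_iff algebra_simps)

lemma outer_mm: "col_finite A \<Longrightarrow> outer x v \<odot> A = outer x (vm v A)"
  by (rule ext) (auto simp: vm_def mm_sum[OF _ subset_refl] col_finite_def sum_distrib_left mult.assoc)

lemma outer_outer_eq_0: "(\<And>k. v k = 0 \<or> y k = 0) \<Longrightarrow> outer x v \<odot> outer y w = 0"
  by (rule ext, clarify, simp, rule mm_eq_0) (metis mult_zero_left mult_zero_right outer_apply)

lemma mm_outer_unit: "A \<odot> outer (unit r) w = outer (\<lambda>i. A (i, r)) w"
proof (rule ext, clarify)
  show "(A \<odot> outer (unit r) w) (i, j) = outer (\<lambda>i. A (i, r)) w (i, j)" for i j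
    by (subst mm_sum[of "{r}"]) (auto simp: unit_def)
qed

lemma outer_unit_mm: "col_finite A \<Longrightarrow> (outer x (unit s) \<odot> A) (i, j) = x i * A (s, j)"
  by (subst mm_sum[of "insert s {k. A (k, j) \<noteq> 0}"])
    (auto simp: col_finite_def unit_def if_distrib if_distribR cong: if_cong)

lemma mm_outer_proj:
  assumes "A \<odot> proj m = proj m" "x \<in> Col m"
  shows "A \<odot> outer x v = outer x v"
proof -
  have c: "col_finite (outer x v)"
    using assms(2) by (rule col_finite_outer)
  have "proj m \<odot> outer x v = outer x v"
    using assms(2) by (auto simp: fun_eq_iff proj_mm[OF c] Col_def not_less)
  then show ?thesis
    using assms(1) c by (metis col_finite_proj mm_assoc)
qed

text \<open>For fixed \<open>x\<close> the matrices \<open>R x v\<close> multiply as the rows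
  \<open>v\<close> add; this embeds additive groups of rows into \<open>AU\<close>.\<close>

lemma R_mult:
  assumes "x \<in> Col m" "\<And>k. v k = 0 \<or> x k = 0"
  shows "R x v \<odot> R x w = R x (v + w)"
proof -
  have [simp]: "col_finite (outer x v)" "col_finite (outer x w)"
    using assms(1) col_finite_outer by auto
  show ?thesis
    using outer_outer_eq_0[OF assms(2)]
    by (simp add: R_def mm_add_left mm_add_right outer_add add.assoc)
qed

lemma R_0: "R x 0 = Idm"
  by (auto simp: R_def fun_eq_iff)

lemma R_AU:
  assumes x: "x \<in> Col m" and xv: "\<And>k. v k = 0 \<or> x k = 0"
  shows "R x v \<in> AU" "inv\<^bsub>G\<^esub> (R x v) = R x (- v)"
proof -
  have t: "R x w \<in> tri m" for w
    using outer_tri[OF x, of w] tri_Idm[of m] by (auto simp: R_def tri_def)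
  have 1: "R x v \<odot> R x (- v) = Idm" "R x (- v) \<odot> R x v = Idm"
    using R_mult[OF x, of v "- v"] R_mult[OF x, of "- v" v] xv by (auto simp: R_0)
  show AU: "R x v \<in> AU"
    by (rule AU_I[OF t t 1])
  have "R x (- v) \<in> AU"
    by (rule AU_I[OF t t 1(2,1)])
  then show "inv\<^bsub>G\<^esub> (R x v) = R x (- v)"
    using inv_eqI AU 1 by blast
qed

lemma R_V:
  assumes x: "x \<in> Col m" and xv: "\<And>k. v k = 0 \<or> x k = 0" and v: "v \<in> Row n"
    and up: "\<And>i j. x i \<noteq> 0 \<Longrightarrow> v j \<noteq> 0 \<Longrightarrow> b i \<le> b j"
  shows "R x v \<in> V n"
  unfolding V_iff
proof (intro conjI allI impI)
  show "R x v \<in> AU"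
    using R_AU(1)[OF x xv] .
  show "R x v \<in> tri n"
    unfolding tri_def using up by (fastforce simp: R_apply)
  show "R x v (i, j) = Idm (i, j)" if "b j < n" for i j
    using v that by (simp add: R_apply Row_def)
qed

lemma R_V_block:
  assumes "x \<in> Col m" "v \<in> Row m"
  shows "R x v \<in> V m"
proof (rule R_V[OF assms(1) _ assms(2)])
  show "v k = 0 \<or> x k = 0" for k
    using Col_Row[OF assms] .
  show "b i \<le> b j" if "x i \<noteq> 0" "v j \<noteq> 0" for i j
    using assms that unfolding Col_def Row_def
      by (metis (mono_tags, lifting) le_trans mem_Collect_eq nat_le_linear not_le)
qed

text \<open>Here \<open>v\<close> may have entries in the block of \<open>i\<close> as well as in
  later ones. This gives the shears inside one block, which \<open>R_V_block\<close> does not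
  provide.\<close>

lemma R_unit_V:
  fixes v :: "'i \<Rightarrow> 'k::{field,finite}"
  assumes "v i = 0" "v \<in> Row (b i)"
  shows "R (unit i) v \<in> V (b i)"
proof (rule R_V[of _ "Suc (b i)"])
  show "unit i \<in> Col (Suc (b i))"
    by (rule unit_Col) simp
  show "v k = 0 \<or> unit i k = (0::'k)" for k
    using assms(1) by (cases "k = i") (simp_all add: unit_def)
  show "b k \<le> b j" if "unit i k \<noteq> (0::'k)" "v j \<noteq> 0" for k j
  proof -
    have "k = i"
      using that(1) by (metis unit_def)
    then show ?thesis
      using assms(2) that(2) unfolding Row_def by (metis (mono_tags, lifting) mem_Collect_eq not_le)
  qed
qed (rule assms(2))

lemma V_mm_outer: "A \<in> V m \<Longrightarrow> x \<in> Col m \<Longrightarrow> A \<odot> outer x v = outer x v"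
  by (intro mm_outer_proj) (auto simp: V_def)

text \<open>Elements of \<open>V m\<close> fix every column supported in the first \<open>m\<close>
  blocks, so conjugation leaves \<open>x\<close> alone and acts on the row by right
  multiplication.\<close>

lemma R_conj:
  assumes A: "A \<in> V m" and x: "x \<in> Col m"
  shows "inv\<^bsub>G\<^esub> A \<odot> R x v \<odot> A = R x (vm v A)"
proof -
  have [simp]: "col_finite (outer x v)" "col_finite A" "A \<in> AU"
    using col_finite_outer[OF x] A V_AU by auto
  have "inv\<^bsub>G\<^esub> A \<odot> R x v \<odot> A = Idm + outer x v \<odot> A"
    using V_mm_outer[OF V_inv[OF A] x] by (simp add: R_def mm_add_left mm_add_right inv_AU)
  then show ?thesis
    by (simp add: R_def outer_mm)
qed

lemma vm_Row:
  assumes "A \<in> tri 0" "v \<in> Row n"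
  shows "vm v A \<in> Row n"
  unfolding Row_def vm_def
proof (clarify, rule sum.neutral, clarify)
  fix j k assume j: "b j < n"
  show "v k * A (k, j) = 0"
    using assms j triD[OF assms(1), of j k] by (cases "b k < n") (auto simp: Row_def)
qed

lemma R_inj:
  assumes "x \<noteq> (\<lambda>_. 0)" "R x v = R x w"
  shows "v = w"
proof
  fix j
  obtain i where i: "x i \<noteq> 0"
    using assms(1) by blast
  have "x i * v j = x i * w j"
    using fun_cong[OF assms(2), of "(i, j)"] by (simp add: R_apply)
  then show "v j = w j"
    using i by simp
qed

lemma R_V_Row:
  assumes "x \<noteq> (\<lambda>_. 0)" "R x v \<in> V n"
  shows "v \<in> Row n"
proof -
  obtain i where i: "x i \<noteq> 0"
    using assms(1) by blast
  have "x i * v j = 0" if "b j < n" for j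
    using assms(2) that by (auto simp: V_iff R_apply)
  then show ?thesis
    using i by (auto simp: Row_def)
qed

section \<open>Rank one elements in subgroups normalised by a congruence subgroup\<close>

lemma subgroup_AU:
  assumes "subgroup N G" "A \<in> N"
  shows "A \<in> AU" "inv\<^bsub>G\<^esub> A \<in> N" "B \<in> N \<Longrightarrow> A \<odot> B \<in> N"
  using assms subgroup.mem_carrier subgroup.m_inv_closed subgroup.m_closed
  by (metis carrier_AU, metis, metis mult_G)

text \<open>The nonzero entries of \<open>M\<close> lie in early rows and late columns, so
  conjugation by \<open>V j\<close> acts on \<open>M\<close> by right multiplication only. Taking
  \<open>g = R (unit r0) w\<close> adds column \<open>r0\<close> of \<open>M\<close> times the
  arbitrary row \<open>w\<close>; dividing by \<open>Idm + M\<close> isolates this rank one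
  part.\<close>

lemma contains_rank_one_aux:
  assumes N: "subgroup N G"
    and conj: "\<And>g a. g \<in> V j \<Longrightarrow> a \<in> N \<Longrightarrow> inv\<^bsub>G\<^esub> g \<odot> a \<odot> g \<in> N"
    and M: "Idm + M \<in> N" "M \<noteq> 0" "\<And>i c. j \<le> b i \<or> b c < j \<Longrightarrow> M (i, c) = 0"
  shows "\<exists>x r. x \<in> Col j \<and> x \<noteq> (\<lambda>_. 0) \<and> j \<le> r \<and> (\<forall>v\<in>Row r. R x v \<in> N)"
proof -
  obtain i0 r0 where M0: "M (i0, r0) \<noteq> 0"
    using M(2) by (force simp: fun_eq_iff)
  then have r0: "j \<le> b r0"
    using M(3) by (meson not_less)
  define x where "x = (\<lambda>i. M (i, r0))"
  have x: "x \<in> Col j" "x \<noteq> (\<lambda>_. 0)"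
    using M(3) M0 by (auto simp: x_def Col_def fun_eq_iff)
  let ?a = "Idm + M"
  have a [simp]: "?a \<in> AU"
    using subgroup_AU(1)[OF N M(1)] .
  have [simp]: "col_finite M"
  proof -
    have "col_finite (?a - Idm)"
      using col_finite_add(2)[OF col_finite_AU[OF a] col_finite_Idm] .
    moreover have "?a - Idm = M"
      by simp
    ultimately show ?thesis
      by metis
  qed
  have pM: "proj j \<odot> M = M"
    using M(3) by (auto simp: fun_eq_iff proj_mm not_less)
  have ap: "?a \<odot> proj j = proj j"
    using M(3) by (auto simp: fun_eq_iff mm_proj proj_apply)
  have "R x w \<in> N" if w: "w \<in> Row (Suc (b r0))" for w
  proof -
    define g :: "'i \<times> 'i \<Rightarrow> 'a" where "g = R (unit r0) w"
    have u: "unit r0 \<in> (Col (Suc (b r0)) :: ('i \<Rightarrow> 'a) set)"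
      by (rule unit_Col) simp
    have "g \<in> V (Suc (b r0))"
      unfolding g_def using u w by (rule R_V_block)
    then have g: "g \<in> V j"
      using V_mono[of j "Suc (b r0)"] r0 by auto
    have [simp]: "g \<in> AU" "col_finite g" "col_finite (outer x w)" "col_finite (outer (unit r0) w)"
      using V_AU[OF g] col_finite_outer x(1) u by auto
    have "inv\<^bsub>G\<^esub> g \<odot> M = M"
    proof -
      have "inv\<^bsub>G\<^esub> g \<odot> proj j = proj j"
        using V_inv[OF g] by (simp add: V_def)
      then have "(inv\<^bsub>G\<^esub> g \<odot> proj j) \<odot> M = M"
        using pM by simp
      then show ?thesis
        using pM by (simp add: mm_assoc)
    qed
    then have 1: "inv\<^bsub>G\<^esub> g \<odot> ?a \<odot> g = Idm + M \<odot> g"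
      by (simp add: mm_add_left mm_add_right inv_AU)
    have 2: "M \<odot> g = M + outer x w"
      unfolding g_def R_def by (simp add: mm_add_right mm_outer_unit x_def)
    have "Idm + M + outer x w \<in> N"
      using conj[OF g M(1)] unfolding 1 2 add.assoc .
    moreover have "?a \<odot> R x w = ?a + outer x w"
      using mm_outer_proj[OF ap x(1), of w] by (simp add: R_def mm_add_right)
    ultimately have "?a \<odot> R x w \<in> N"
      by simp
    then have "inv\<^bsub>G\<^esub> ?a \<odot> (?a \<odot> R x w) \<in> N"
      using subgroup_AU[OF N] M(1) by blast
    then show ?thesis
      using col_finite_R[OF x(1), of w] by simp
  qed
  then show ?thesis
    using x r0 by (intro exI[of _ x] exI[of _ "Suc (b r0)"]) auto
qed

text \<open>If \<open>a\<close> differs from the identity only in early rows, the auxiliary lemma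
  applies to \<open>a\<close> itself. Otherwise \<open>a\<close> is replaced by its commutator with
  \<open>Idm + Y\<close>, where \<open>Y\<close> has its only nonzero entry at
  \<open>(p, i0)\<close> with \<open>p\<close> in block \<open>0\<close>.\<close>

lemma contains_rank_one:
  assumes N: "subgroup N G"
    and conj: "\<And>g a. g \<in> V j \<Longrightarrow> a \<in> N \<Longrightarrow> inv\<^bsub>G\<^esub> g \<odot> a \<odot> g \<in> N"
    and j: "0 < j" and a: "a \<in> N" "a \<in> V j" "a \<noteq> Idm"
  shows "\<exists>x r. x \<in> Col j \<and> x \<noteq> (\<lambda>_. 0) \<and> j \<le> r \<and> (\<forall>v\<in>Row r. R x v \<in> N)"
proof (cases "\<exists>i c. j \<le> b i \<and> a (i, c) \<noteq> Idm (i, c)")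
  case False
  define M where "M = a - Idm"
  have "Idm + M \<in> N"
    using a(1) by (simp add: M_def)
  moreover have "M \<noteq> 0"
    using a(3) by (simp add: M_def)
  moreover have "M (i, c) = 0" if "j \<le> b i \<or> b c < j" for i c
    using that False a(2) by (auto simp: M_def V_iff)
  ultimately show ?thesis
    using conj by (intro contains_rank_one_aux[OF N])
next
  case True
  then obtain i0 c0 where i0: "j \<le> b i0" "a (i0, c0) \<noteq> Idm (i0, c0)"
    by blast
  obtain p where p: "b p = 0"
    by (rule fibre_obtain)
  define Y :: "'i \<times> 'i \<Rightarrow> 'a" where "Y = outer (unit p) (unit i0)"
  have uC: "unit p \<in> (Col j :: ('i \<Rightarrow> 'a) set)" and uR: "unit i0 \<in> (Row j :: ('i \<Rightarrow> 'a) set)"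
    using p j i0 by (auto intro: unit_Col unit_Row)
  have disj: "unit i0 k = (0::'a) \<or> unit p k = (0::'a)" for k
    using Col_Row[OF uC uR] .
  let ?g = "R (unit p) (unit i0) :: 'i \<times> 'i \<Rightarrow> 'a"
  have g: "?g \<in> V j"
    using R_V_block[OF uC uR] .
  have aAU [simp]: "a \<in> AU"
    using a(2) V_AU by blast
  have [simp]: "col_finite Y"
    unfolding Y_def using col_finite_outer[OF uC] .
  have ginv: "inv\<^bsub>G\<^esub> ?g = Idm - Y"
    using R_AU(2)[OF uC disj] by (auto simp: R_def Y_def fun_eq_iff)
  have aY: "a \<odot> Y = Y"
    unfolding Y_def using V_mm_outer[OF a(2) uC] .
  have YY: "Y \<odot> Y = 0"
    unfolding Y_def using outer_outer_eq_0[OF disj] .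
  \<comment> \<open>Row \<open>p\<close> of \<open>M\<close> is row \<open>i0\<close> of the inverse
    of \<open>a\<close> minus the identity; all other rows vanish. It is nonzero because row
    \<open>i0\<close> of \<open>a\<close> differs from that of the identity.\<close>
  define M where "M = Y \<odot> inv\<^bsub>G\<^esub> a - Y"
  have g_eq: "?g = Idm + Y"
    by (simp add: R_def Y_def)
  have "inv\<^bsub>G\<^esub> ?g \<odot> a \<odot> ?g = a - Y \<odot> a + Y"
    unfolding ginv unfolding g_eq using aY YY by (simp add: mm_diff_left mm_add_right mm_assoc)
  then have "a - Y \<odot> a + Y \<in> N"
    using conj[OF g a(1)] by simp
  then have "(a - Y \<odot> a + Y) \<odot> inv\<^bsub>G\<^esub> a \<in> N"
    using subgroup_AU[OF N] a(1) by blast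
  moreover have "(a - Y \<odot> a + Y) \<odot> inv\<^bsub>G\<^esub> a = Idm + M"
    unfolding M_def by (simp add: mm_add_left mm_diff_left mm_assoc inv_AU)
  ultimately have "Idm + M \<in> N"
    by simp
  moreover have "M \<noteq> 0"
  proof
    assume "M = 0"
    then have "Y \<odot> inv\<^bsub>G\<^esub> a \<odot> a = Y \<odot> a"
      by (simp add: M_def)
    then have "Y = Y \<odot> a"
      by (simp add: mm_assoc inv_AU)
    then have "Y (p, c0) = (Y \<odot> a) (p, c0)"
      by simp
    then show False
      using i0(2) unfolding Y_def by (simp add: outer_unit_mm) (auto simp: unit_def split: if_splits)
  qed
  moreover have "M (i, c) = 0" if "j \<le> b i \<or> b c < j" for i c
  proof (cases "j \<le> b i")
    case True
    then have "i \<noteq> p"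
      using p j by auto
    then show ?thesis
      by (simp add: M_def Y_def outer_unit_mm) (simp add: unit_def)
  next
    case False
    then have "b c < j"
      using that by simp
    then have "(inv\<^bsub>G\<^esub> a) (i0, c) = Idm (i0, c)"
      using V_inv[OF a(2)] by (simp add: V_iff)
    then show ?thesis
      by (simp add: M_def Y_def outer_unit_mm) (auto simp: unit_def)
  qed
  ultimately show ?thesis
    using conj by (intro contains_rank_one_aux[OF N])
qed

section \<open>Topological simplicity\<close>

definition el :: "'i \<Rightarrow> 'i \<Rightarrow> 'k \<Rightarrow> ('i \<times> 'i \<Rightarrow> 'k::{field,finite})" where
  "el i j t = R (unit i) (\<lambda>c. t * unit j c)"

lemma el_apply: "el i j t (a, c) = Idm (a, c) + (if a = i \<and> c = j then t else 0)"
  by (simp add: el_def R_apply unit_def)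

lemma el_AU:
  fixes t :: "'k::{field,finite}"
  assumes "i \<noteq> j"
  shows "el i j t \<in> AU" "inv\<^bsub>G\<^esub> (el i j t) = el i j (- t)"
proof -
  have c: "unit i \<in> (Col (Suc (b i)) :: ('i \<Rightarrow> 'k) set)"
    by (rule unit_Col) simp
  have d: "t * unit j k = 0 \<or> unit i k = (0::'k)" for k
    using assms by (simp add: unit_def)
  have "- (\<lambda>c. t * unit j c) = (\<lambda>c. - t * unit j c)"
    by (simp add: fun_eq_iff)
  then show "el i j t \<in> AU" "inv\<^bsub>G\<^esub> (el i j t) = el i j (- t)"
    using R_AU[OF c d] by (simp_all add: el_def)
qed

lemma el_mm:
  assumes "col_finite A"
  shows "(el i j t \<odot> A) (a, c) = A (a, c) + (if a = i then t * A (j, c) else 0)"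
proof -
  have "(el i j t \<odot> A) (a, c) = (\<Sum>k\<in>insert a (insert j {k. A (k, c) \<noteq> 0}). el i j t (a, k) * A (k, c))"
    using assms by (intro mm_sum) (auto simp: col_finite_def)
  also have "\<dots> = (\<Sum>k\<in>insert a (insert j {k. A (k, c) \<noteq> 0}).
      (if k = a then A (k, c) else 0) + (if k = j then if a = i then t * A (k, c) else 0 else 0))"
    by (intro sum.cong) (auto simp: el_apply distrib_right)
  also have "\<dots> = A (a, c) + (if a = i then t * A (j, c) else 0)"
    using assms by (simp add: col_finite_def sum.distrib del: sum.insert_if)
  finally show ?thesis .
qed

lemma mm_el: "(A \<odot> el i j t) (a, c) = A (a, c) + (if c = j then A (a, i) * t else 0)"
proof -
  have "(A \<odot> el i j t) (a, c) = (\<Sum>k\<in>{c, i}. A (a, k) * el i j t (k, c))"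
    by (intro mm_sum) (auto simp: el_apply)
  also have "\<dots> = A (a, c) + (if c = j then A (a, i) * t else 0)"
    by (cases "i = c") (auto simp: el_apply algebra_simps)
  finally show ?thesis .
qed

text \<open>A commutator relation: conjugation moves the row index from \<open>i\<close> to
  \<open>k\<close>, up to the original factor. The next lemma moves the column index in the same
  way.\<close>

lemma el_conj_left:
  fixes t :: "'k::{field,finite}"
  assumes "i \<noteq> j" "k \<noteq> i" "k \<noteq> j"
  shows "el k i 1 \<odot> el i j t \<odot> el k i (- 1) = el i j t \<odot> el k j t"
proof -
  have [simp]: "col_finite (el i j t)"
    by (rule col_finite_AU[OF el_AU(1)[OF assms(1)]])
  show ?thesis
    using assms by (auto simp: fun_eq_iff mm_el el_mm el_apply)
qed

lemma el_conj_right: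
  fixes t :: "'k::{field,finite}"
  assumes "i \<noteq> j" "k \<noteq> i" "k \<noteq> j"
  shows "el j k (- 1) \<odot> el i j t \<odot> el j k 1 = el i j t \<odot> el i k t"
proof -
  have [simp]: "col_finite (el i j t)"
    by (rule col_finite_AU[OF el_AU(1)[OF assms(1)]])
  show ?thesis
    using assms by (auto simp: fun_eq_iff mm_el el_mm el_apply)
qed

text \<open>Gaussian elimination of the columns in the blocks below \<open>m\<close>. The extra row \<open>z\<close> in block \<open>m\<close>
  makes it possible to normalise every pivot to \<open>1\<close> with elementary operations only, so that
  determinants play no role.\<close>

definition reduced :: "nat \<Rightarrow> 'i \<Rightarrow> 'i set \<Rightarrow> ('i \<times> 'i \<Rightarrow> 'k::{field,finite}) \<Rightarrow> bool" where
  "reduced m z C A \<longleftrightarrow> (\<forall>c\<in>C. \<forall>i. A (i, c) = Idm (i, c)) \<and>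
     (\<forall>i j. b j < b i \<and> m \<le> b i \<and> A (i, j) \<noteq> 0 \<longrightarrow> i = z \<and> b j < m)"

text \<open>Row \<open>r\<close> has zeros in the finished columns because
  \<open>r \<notin> C\<close>, and the changed row \<open>i\<close> is in the first \<open>m\<close>
  blocks or is \<open>z\<close>, where the extra entries are allowed.\<close>

lemma reduced_el:
  assumes A: "reduced m z C A" "col_finite A" and z: "b z = m"
    and r: "b r < m \<or> r = z" "r \<notin> C" and i: "b i < m \<or> i = z"
  shows "reduced m z C (el i r t \<odot> A)"
  unfolding reduced_def
proof (intro conjI ballI allI impI)
  fix c i' assume c: "c \<in> C"
  then have "A (r, c) = 0"
    using A r by (auto simp: reduced_def)
  then show "(el i r t \<odot> A) (i', c) = Idm (i', c)"
    using A c by (simp add: el_mm reduced_def)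
next
  fix i' j assume h: "b j < b i' \<and> m \<le> b i' \<and> (el i r t \<odot> A) (i', j) \<noteq> 0"
  show "i' = z" "b j < m"
  proof -
    have "i' = z \<and> b j < m"
    proof (cases "i' = i")
      case True
      then show ?thesis
        using h i z by auto
    next
      case False
      then show ?thesis
        using h A by (auto simp: el_mm reduced_def)
    qed
    then show "i' = z" "b j < m"
      by auto
  qed
qed

lemma clear_column:
  assumes closed: "\<And>i j t A. i \<noteq> j \<Longrightarrow> A \<in> S \<Longrightarrow> el i j t \<odot> A \<in> S" and S: "S \<subseteq> AU"
    and z: "b z = m" and c: "b c < m" "c \<notin> C"
    and D: "finite D" "D \<subseteq> {i. b i < m} \<union> {z}" "c \<notin> D"
    and A: "A \<in> S" "reduced m z C A" "A (c, c) = 1"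
  shows "\<exists>A'\<in>S. reduced m z C A' \<and> A' (c, c) = 1 \<and> (\<forall>i\<in>D. A' (i, c) = 0)"
  using D
proof (induction D)
  case empty
  then show ?case
    using A by blast
next
  case (insert i D)
  then obtain A' where A': "A' \<in> S" "reduced m z C A'" "A' (c, c) = 1" "\<forall>i\<in>D. A' (i, c) = 0"
    by auto
  have cf: "col_finite A'"
    using A'(1) S by auto
  have ic: "i \<noteq> c"
    using insert by auto
  let ?A = "el i c (- A' (i, c)) \<odot> A'"
  have "?A \<in> S"
    by (rule closed[OF ic A'(1)])
  moreover have "reduced m z C ?A"
    using insert c by (intro reduced_el[OF A'(2) cf z]) auto
  ultimately show ?case
    using A' ic insert.hyps by (intro bexI[of _ ?A]) (auto simp: el_mm[OF cf])
qed

text \<open>To obtain the pivot \<open>1\<close> without rescaling, a row other than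
  \<open>c\<close> with a nonzero entry in column \<open>c\<close> is used; if there is none outside
  \<open>C\<close>, adding row \<open>c\<close> to row \<open>z\<close> creates one.\<close>

lemma gauss_step:
  fixes S :: "('i \<times> 'i \<Rightarrow> 'k::{field,finite}) set"
  assumes closed: "\<And>i j t A. i \<noteq> j \<Longrightarrow> A \<in> S \<Longrightarrow> el i j t \<odot> A \<in> S" and S: "S \<subseteq> AU"
    and z: "b z = m" and c: "b c < m" "c \<notin> C" and C: "finite C" "C \<subseteq> {i. b i < m}"
    and A: "A \<in> S" "reduced m z C A"
  shows "\<exists>A'\<in>S. reduced m z (insert c C) A'"
proof -
  have zc: "z \<noteq> c" "z \<notin> C"
    using z c C by auto
  have support: "b i < m \<or> i = z" if "A' (i, c) \<noteq> 0" "reduced m z C A'" for A' :: "'i \<times> 'i \<Rightarrow> 'k" and i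
    using that c z unfolding reduced_def by (meson less_le_trans not_less)
  have AU: "A \<in> AU" and cf: "col_finite A"
    using A S by auto
  \<comment> \<open>Otherwise column \<open>c\<close> would be a combination of the finished unit
    columns: row \<open>c\<close> of the inverse vanishes on \<open>C\<close>, so its product with
    column \<open>c\<close> would be \<open>0\<close> instead of \<open>1\<close>.\<close>
  have "\<exists>r. r \<notin> C \<and> A (r, c) \<noteq> 0"
  proof (rule ccontr)
    assume "\<not> ?thesis"
    then have sub: "{k. A (k, c) \<noteq> 0} \<subseteq> C"
      by blast
    let ?B = "inv\<^bsub>G\<^esub> A"
    have "?B (c, d) = 0" if d: "d \<in> C" for d
    proof -
      have "(?B \<odot> A) (c, d) = (\<Sum>k\<in>{d}. ?B (c, k) * A (k, d))"
        using A(2) d by (intro mm_sum) (auto simp: reduced_def)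
      also have "\<dots> = ?B (c, d)"
        using A(2) d by (simp add: reduced_def)
      finally show ?thesis
        using inv_AU(3)[OF AU] c(2) d by (metis Idm_apply)
    qed
    then have "(?B \<odot> A) (c, c) = 0"
      using mm_sum[OF C(1) sub, of ?B c] by simp
    then show False
      using inv_AU(3)[OF AU] by simp
  qed
  then obtain r where r: "r \<notin> C" "A (r, c) \<noteq> 0"
    by blast
  have "\<exists>A1\<in>S. reduced m z C A1 \<and> (\<exists>r. r \<notin> C \<and> r \<noteq> c \<and> A1 (r, c) \<noteq> 0)"
  proof (cases "\<exists>r. r \<notin> C \<and> r \<noteq> c \<and> A (r, c) \<noteq> 0")
    case True
    then show ?thesis
      using A by blast
  next
    case False
    then have "A (z, c) = 0" "A (c, c) \<noteq> 0"
      using r zc by auto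
    then have "(el z c 1 \<odot> A) (z, c) \<noteq> 0"
      using cf by (simp add: el_mm)
    moreover have "el z c 1 \<odot> A \<in> S"
      by (rule closed[OF zc(1) A(1)])
    moreover have "reduced m z C (el z c 1 \<odot> A)"
      using c by (intro reduced_el[OF A(2) cf z]) auto
    ultimately show ?thesis
      using zc by blast
  qed
  then obtain A1 r where A1: "A1 \<in> S" "reduced m z C A1" "r \<notin> C" "r \<noteq> c" "A1 (r, c) \<noteq> 0"
    by blast
  have cf1: "col_finite A1"
    using A1(1) S by auto
  \<comment> \<open>The factor is the solution \<open>t\<close> of
    \<open>A1 (c, c) + t * A1 (r, c) = 1\<close>.\<close>
  define A2 where "A2 = el c r ((1 - A1 (c, c)) / A1 (r, c)) \<odot> A1"
  have "A2 \<in> S"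
    unfolding A2_def by (rule closed[OF A1(4)[symmetric] A1(1)])
  moreover have "reduced m z C A2"
    unfolding A2_def using c A1(3) support[OF A1(5,2)] by (intro reduced_el[OF A1(2) cf1 z]) auto
  moreover have "A2 (c, c) = 1"
    unfolding A2_def using A1 by (simp add: el_mm[OF cf1])
  moreover have "finite ({i. b i < m} \<union> {z} - {c})"
    using finite_below by simp
  ultimately have "\<exists>A'\<in>S. reduced m z C A' \<and> A' (c, c) = 1 \<and>
      (\<forall>i\<in>{i. b i < m} \<union> {z} - {c}. A' (i, c) = 0)"
    by (intro clear_column[OF _ S z c, where A = A2]) (simp_all add: closed)
  then obtain A3 where A3: "A3 \<in> S" "reduced m z C A3" "A3 (c, c) = 1"
    "\<forall>i\<in>{i. b i < m} \<union> {z} - {c}. A3 (i, c) = 0"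
    by blast
  have "A3 (i, c) = Idm (i, c)" for i
    using A3 support[OF _ A3(2), of i] by (cases "i = c") auto
  then have "reduced m z (insert c C) A3"
    using A3(2) by (simp add: reduced_def)
  then show ?thesis
    using A3(1) by blast
qed

text \<open>\<open>S\<close> is kept abstract; it will be a coset of a normal subgroup. Once the
  columns of the first \<open>m\<close> blocks are unit columns, row \<open>z\<close> cannot hold an
  entry below the diagonal either.\<close>

lemma gauss:
  fixes S :: "('i \<times> 'i \<Rightarrow> 'k::{field,finite}) set"
  assumes closed: "\<And>i j t A. i \<noteq> j \<Longrightarrow> A \<in> S \<Longrightarrow> el i j t \<odot> A \<in> S" and S: "S \<subseteq> AU"
    and A: "A \<in> S" "A \<in> tri m"
  shows "\<exists>A'\<in>S. A' \<in> V m"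
proof -
  obtain z where z: "b z = m"
    by (rule fibre_obtain)
  have "\<exists>A'\<in>S. reduced m z C A'" if "finite C" "C \<subseteq> {i. b i < m}" for C
    using that
  proof (induction C)
    case empty
    have "reduced m z {} A"
      using A(2) by (auto simp: reduced_def tri_def)
    then show ?case
      using A(1) by blast
  next
    case (insert c C)
    then obtain A' where "A' \<in> S" "reduced m z C A'"
      by auto
    then show ?case
      using insert by (intro gauss_step[OF _ S z, of c C A']) (simp_all add: closed)
  qed
  then obtain A' where A': "A' \<in> S" "reduced m z {i. b i < m} A'"
    using finite_below by blast
  have "A' \<in> V m"
    unfolding V_iff
  proof (intro conjI allI impI)
    show "A' \<in> AU"
      using A'(1) S by blast
    show id: "A' (i, j) = Idm (i, j)" if "b j < m" for i j
      using A'(2) that by (simp add: reduced_def)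
    show "A' \<in> tri m"
      unfolding tri_def
    proof clarify
      fix i j assume h: "b j < b i" "m \<le> b i"
      show "A' (i, j) = 0"
      proof (rule ccontr)
        assume n: "A' (i, j) \<noteq> 0"
        then have "b j < m"
          using A'(2) h by (auto simp: reduced_def)
        then show False
          using id[of j i] n h by (auto split: if_splits)
      qed
    qed
  qed
  then show ?thesis
    using A'(1) by blast
qed

text \<open>Commuting with the matrix unit at \<open>(r, s)\<close> forces column \<open>r\<close>
  of \<open>a\<close> to be a multiple of \<open>unit r\<close> and identifies the diagonal entries
  at \<open>r\<close> and \<open>s\<close>. For each \<open>r\<close>, adding the identity puts
  these matrix units into \<open>V m\<close> for all \<open>s\<close> in late blocks.\<close>

lemma commuting_scalar:
  fixes a :: "'i \<times> 'i \<Rightarrow> 'k::{field,finite}"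
  assumes a: "a \<in> AU" and comm: "\<And>v. v \<in> V m \<Longrightarrow> a \<odot> v = v \<odot> a"
  shows "scalar_matrix UNIV a"
proof -
  have [simp]: "col_finite a"
    using a by simp
  have eq: "a (i, r) * unit s c = unit r i * a (s, c)" if s: "b r < b s" "m \<le> b s" for i r s c
  proof -
    have u: "unit r \<in> (Col (b s) :: ('i \<Rightarrow> 'k) set)" "unit s \<in> (Row (b s) :: ('i \<Rightarrow> 'k) set)"
      using s by (auto intro: unit_Col unit_Row)
    have [simp]: "col_finite (outer (unit r) (unit s) :: 'i \<times> 'i \<Rightarrow> 'k)"
      using col_finite_outer[OF u(1)] .
    have "R (unit r) (unit s) \<in> (V m :: ('i \<times> 'i \<Rightarrow> 'k) set)"
      using R_V_block[OF u] V_mono[OF s(2)] by blast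
    then have "a \<odot> outer (unit r) (unit s) = outer (unit r) (unit s) \<odot> a"
      using comm[of "R (unit r) (unit s)"] by (simp add: R_def mm_add_left mm_add_right)
    then have "(a \<odot> outer (unit r) (unit s)) (i, c) = (outer (unit r) (unit s) \<odot> a) (i, c)"
      by simp
    then show ?thesis
      by (simp add: mm_outer_unit outer_unit_mm)
  qed
  have ex: "\<exists>s. b r < b s \<and> b r' < b s \<and> m \<le> b s" for r r'
  proof -
    obtain s where "b s = Suc (max (max (b r) (b r')) m)"
      by (rule fibre_obtain)
    then show ?thesis
      by (intro exI[of _ s]) auto
  qed
  show ?thesis
    unfolding scalar_matrix_def
  proof (intro conjI ballI impI)
    fix i r
    obtain s where s: "b i < b s" "b r < b s" "m \<le> b s"
      using ex by blast
    show "a (i, r) = 0" if "i \<noteq> r"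
      using eq[OF s(2,3), of i s] that by (simp add: unit_def)
    show "a (i, i) = a (r, r)"
      using eq[OF s(1,3), of i s] eq[OF s(2,3), of r s] by (simp add: unit_def)
  qed
qed

text \<open>An element \<open>v\<close> of \<open>V m\<close> that does not commute with
  \<open>a\<close> yields a nontrivial commutator in \<open>N \<inter> V m\<close>, hence a family
  of transvections with an unknown column \<open>x\<close>. Conjugation by \<open>el k l 1\<close>,
  at a row \<open>l\<close> with \<open>x l \<noteq> 0\<close>, splits off a single elementary
  matrix.\<close>

lemma normal_contains_elementary:
  fixes N :: "('i \<times> 'i \<Rightarrow> 'k::{field,finite}) set"
  assumes N: "N \<lhd> G" and a: "a \<in> N" "\<not> scalar_matrix UNIV a" and ij: "i \<noteq> j"
  shows "el i j t \<in> N"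
proof -
  have sub: "subgroup N G"
    using N by (rule normal_imp_subgroup)
  note N_AU = subgroup_AU[OF sub]
  have conj: "x \<odot> h \<odot> inv\<^bsub>G\<^esub> x \<in> N" if "x \<in> AU" "h \<in> N" for x h
    using N that unfolding group.normal_inv_iff[OF group_G] by (simp add: carrier_AU)
  have conj': "inv\<^bsub>G\<^esub> x \<odot> h \<odot> x \<in> N" if "x \<in> AU" "h \<in> N" for x h
    using conj[OF inv_AU(1)[OF that(1)] that(2)] group.inv_inv[OF group_G, of x] that(1)
    by (simp add: carrier_AU)
  have aAU [simp]: "a \<in> AU"
    using N_AU(1) a(1) .
  obtain m where m: "1 \<le> m" "a \<in> tri m"
    using AU_E_ge[OF aAU] by metis
  obtain v where v: "v \<in> V m" "a \<odot> v \<noteq> v \<odot> a"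
    using commuting_scalar[OF aAU] a(2) by blast
  have [simp]: "v \<in> AU"
    using v V_AU by blast
  let ?c = "inv\<^bsub>G\<^esub> a \<odot> inv\<^bsub>G\<^esub> v \<odot> a \<odot> v"
  have "inv\<^bsub>G\<^esub> a \<odot> (inv\<^bsub>G\<^esub> v \<odot> a \<odot> v) \<in> N"
    using N_AU a(1) conj' by simp
  then have cN: "?c \<in> N"
    by (simp add: mm_assoc)
  have "inv\<^bsub>G\<^esub> a \<odot> inv\<^bsub>G\<^esub> v \<odot> inv\<^bsub>G\<^esub> (inv\<^bsub>G\<^esub> a) \<in> V m"
    using V_normal[OF inv_AU(1)[OF aAU] inv_tri[OF aAU m(2)] V_inv[OF v(1)]] .
  then have "inv\<^bsub>G\<^esub> a \<odot> inv\<^bsub>G\<^esub> v \<odot> a \<in> V m"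
    using group.inv_inv[OF group_G] aAU by (metis carrier_AU)
  then have cV: "?c \<in> V m"
    using v(1) V_mult by blast
  have "?c \<noteq> Idm"
  proof
    assume c: "?c = Idm"
    have "a \<odot> v = v \<odot> (a \<odot> ?c)"
      by (simp add: mm_assoc)
    then show False
      using c v(2) by simp
  qed
  then obtain x r where x: "x \<in> Col m" "x \<noteq> (\<lambda>_. 0)" "m \<le> r" "\<And>v. v \<in> Row r \<Longrightarrow> R x v \<in> N"
    using contains_rank_one[OF sub _ _ cN cV] conj' V_AU m(1) by (metis less_eq_Suc_le One_nat_def)
  obtain l where l: "x l \<noteq> 0"
    using x(2) by blast
  then have bl: "b l < m"
    using x(1) by (auto simp: Col_def not_le)
  obtain k where k: "k \<noteq> l" "b k = b l"
    using two_in_fibre[of "b l"] by metis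
  have far: "el k s t \<in> N" if s: "r \<le> b s" for s t
  proof -
    have ks: "k \<noteq> s" "l \<noteq> s"
      using s k bl x(3) by auto
    \<comment> \<open>Conjugation by \<open>el k l 1\<close> adds \<open>x l\<close> to entry
      \<open>k\<close> of the column and leaves the row alone because \<open>v k = 0\<close>;
      dividing by \<open>x l\<close> makes the split-off entry exactly \<open>t\<close>.\<close>
    define v where "v = (\<lambda>c. t / x l * unit s c)"
    have "v \<in> Row r"
      using s by (auto simp: v_def Row_def unit_def)
    then have RN: "R x v \<in> N"
      using x(4) by blast
    have [simp]: "R x v \<in> AU" "col_finite (R x v)"
      using N_AU(1)[OF RN] by auto
    have kl: "el k l 1 \<in> (AU :: ('i \<times> 'i \<Rightarrow> 'k) set)" "inv\<^bsub>G\<^esub> (el k l (1::'k)) = el k l (- 1)"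
      using el_AU k by auto
    have vk: "v k = 0"
      using ks by (simp add: v_def unit_def)
    have xs: "x s = 0"
      using x(1,3) s by (simp add: Col_def)
    have "el k l 1 \<odot> R x v \<odot> inv\<^bsub>G\<^esub> (el k l 1) = R x v \<odot> el k s t"
    proof (rule ext, clarify)
      show "(el k l 1 \<odot> R x v \<odot> inv\<^bsub>G\<^esub> (el k l 1)) (a, c) = (R x v \<odot> el k s t) (a, c)" for a c
        unfolding kl(2) mm_el el_mm[OF \<open>col_finite (R x v)\<close>] R_apply
        using k l vk xs ks by (auto simp: v_def unit_def)
    qed
    then have "R x v \<odot> el k s t \<in> N"
      using conj[OF kl(1) RN] by simp
    then have "inv\<^bsub>G\<^esub> (R x v) \<odot> (R x v \<odot> el k s t) \<in> N"
      using N_AU RN by blast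
    then show ?thesis
      using col_finite_AU[OF el_AU(1)[OF ks(1), of t]] by simp
  qed
  \<comment> \<open>An index so late that \<open>el k s t\<close> is available and \<open>s\<close>
    differs from \<open>i\<close>, \<open>j\<close> and \<open>k\<close>. Conjugation moves the row
    index from \<open>k\<close> to \<open>i\<close> and then the column index from \<open>s\<close>
    to \<open>j\<close>.\<close>
  obtain s where s: "b s = Suc (r + b i + b j)"
    by (rule fibre_obtain)
  have sne: "s \<noteq> i" "s \<noteq> j" "s \<noteq> k"
    using s k(2) bl x(3) by auto
  have "el i s t \<in> N"
  proof (cases "i = k")
    case True
    then show ?thesis
      using far s by simp
  next
    case False
    have kN: "el k s t \<in> N"
      using far s by simp
    have "el k s t \<odot> el i s t \<in> N"
      using conj[OF el_AU(1)[OF False, of 1] kN] el_AU(2)[OF False, of "1::'k"]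
        el_conj_left[of k s i t] sne False
      by simp
    then have "inv\<^bsub>G\<^esub> (el k s t) \<odot> (el k s t \<odot> el i s t) \<in> N"
      using N_AU kN by blast
    then show ?thesis
      using N_AU(1)[OF kN] col_finite_AU[OF el_AU(1)[OF sne(1)[symmetric], of t]] by simp
  qed
  note iN = this
  have "el i s t \<odot> el i j t \<in> N"
    using conj'[OF el_AU(1)[OF sne(2), of 1] iN] el_AU(2)[OF sne(2), of "1::'k"]
      el_conj_right[of i s j t] sne ij
    by simp
  then have "inv\<^bsub>G\<^esub> (el i s t) \<odot> (el i s t \<odot> el i j t) \<in> N"
    using N_AU iN by blast
  then show ?thesis
    using N_AU(1)[OF iN] col_finite_AU[OF el_AU(1)[OF ij, of t]] by simp
qed

text \<open>Row reduction inside the coset \<open>N A\<close> reaches an element of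
  \<open>V m\<close>, so every neighbourhood of \<open>A\<close> meets \<open>N\<close>; closedness
  then puts \<open>A\<close> into \<open>N\<close>.\<close>

lemma closed_normal_full:
  fixes N :: "('i \<times> 'i \<Rightarrow> 'k::{field,finite}) set"
  assumes N: "N \<lhd> G" and closed: "closedin (filtration_topology G V) N"
    and a: "a \<in> N" "\<not> scalar_matrix UNIV a"
  shows "N = AU"
proof
  have sub: "subgroup N G"
    using N by (rule normal_imp_subgroup)
  note N_AU = subgroup_AU[OF sub]
  show "N \<subseteq> AU"
    using N_AU(1) by blast
  show "AU \<subseteq> N"
  proof
    fix A :: "'i \<times> 'i \<Rightarrow> 'k" assume A: "A \<in> AU"
    show "A \<in> N"
    proof (rule filtered_group.closedin_mem[OF filtered_group_G closed])
      show "A \<in> carrier G"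
        using A by (simp add: carrier_AU)
      fix n
      obtain m where m: "n \<le> m" "A \<in> tri m"
        using AU_E_ge[OF A] by metis
      define S where "S = {g \<odot> A | g. g \<in> N}"
      have "S \<subseteq> AU"
        using AU_mult A N_AU(1) by (auto simp: S_def)
      moreover have "el i j t \<odot> B \<in> S" if ij: "i \<noteq> j" and B: "B \<in> S" for i j t B
      proof -
        obtain g where g: "g \<in> N" "B = g \<odot> A"
          using B by (auto simp: S_def)
        have "el i j t \<odot> B = (el i j t \<odot> g) \<odot> A"
          using g N_AU(1)[OF g(1)] A by (simp add: mm_assoc)
        moreover have "el i j t \<odot> g \<in> N"
          using normal_contains_elementary[OF N a ij] g(1) N_AU(3) by blast
        ultimately show ?thesis
          by (auto simp: S_def)
      qed
      moreover have "Idm \<in> N"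
        using subgroup.one_closed[OF sub] by simp
      then have "A \<in> S"
        using A unfolding S_def by (force intro: exI[of _ Idm])
      ultimately obtain B where B: "B \<in> S" "B \<in> V m"
        using gauss[OF _ _ _ m(2), of S] by metis
      then obtain g where g: "g \<in> N" "B = g \<odot> A"
        by (auto simp: S_def)
      have [simp]: "g \<in> AU" "A \<in> AU" "B \<in> AU"
        using N_AU(1)[OF g(1)] A V_AU[OF B(2)] by auto
      have "inv\<^bsub>G\<^esub> B = inv\<^bsub>G\<^esub> A \<odot> inv\<^bsub>G\<^esub> g"
        unfolding g(2) using group.inv_mult_group[OF group_G, of g A] by (simp add: carrier_AU)
      then have "A \<odot> inv\<^bsub>G\<^esub> B = inv\<^bsub>G\<^esub> g"
        by simp
      then have "A \<odot> inv\<^bsub>G\<^esub> B \<in> N"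
        using N_AU(2) g(1) by simp
      then show "\<exists>v\<in>V n. A \<otimes>\<^bsub>G\<^esub> v \<in> N"
        using V_inv[OF B(2)] V_mono[OF m(1)] by (intro bexI[of _ "inv\<^bsub>G\<^esub> B"]) auto
    qed
  qed
qed

lemma topologically_simple_PAU:
  "topologically_simple (PAU_group UNIV (rel {}))
     (PAU_topology UNIV (rel {}) :: ('i \<times> 'i \<Rightarrow> 'k::{field,finite}) set topology)"
  unfolding PAU_topology_def PAU_group_def AU_topology_eq
proof (rule filtered_group.topologically_simple_quotient[OF filtered_group_G Z_normal])
  obtain i j :: 'i where ij: "i \<noteq> j"
    using two_in_fibre[of 0] by blast
  have "el i j 1 (i, j) \<noteq> (0 :: 'k)"
    using ij by (simp add: el_apply)
  then have "\<not> scalar_matrix UNIV (el i j (1::'k))"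
    using ij by (auto simp: scalar_matrix_def)
  then have "el i j 1 \<notin> (Z :: ('i \<times> 'i \<Rightarrow> 'k) set)"
    by (simp add: Z_iff)
  then show "Z \<noteq> carrier (G :: ('i \<times> 'i \<Rightarrow> 'k) monoid)"
    using el_AU(1)[OF ij] unfolding carrier_AU by blast
  fix M :: "('i \<times> 'i \<Rightarrow> 'k) set"
  assume M: "M \<lhd> G" "closedin (filtration_topology G V) M" "Z \<subseteq> M" "M \<noteq> Z"
  then obtain a where a: "a \<in> M" "a \<notin> Z"
    by blast
  then have "a \<in> AU"
    using subgroup_AU(1)[OF normal_imp_subgroup[OF M(1)]] by blast
  then have "\<not> scalar_matrix UNIV a"
    using a(2) by (simp add: Z_iff)
  then show "M = carrier G"
    unfolding carrier_AU using closed_normal_full[OF M(1,2) a(1)] by blast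
qed

section \<open>Local isomorphisms\<close>

lemma vm_R_unit: "vm w (R (unit j) u) = w + (\<lambda>c. w j * u c)"
proof
  fix c
  have "vm w (R (unit j) u) c = (\<Sum>k\<in>{c, j}. w k * R (unit j) u (k, c))"
    unfolding vm_def by (intro sum.mono_neutral_left) (auto simp: R_apply unit_def split: if_splits)
  also have "\<dots> = (w + (\<lambda>c. w j * u c)) c"
    by (cases "j = c") (auto simp: R_apply unit_def algebra_simps)
  finally show "vm w (R (unit j) u) c = (w + (\<lambda>c. w j * u c)) c" .
qed

text \<open>If \<open>w\<close> is nonzero at \<open>j\<close> in the lowest occurring block, shears
  with pivot \<open>j\<close> change \<open>w\<close> by an arbitrary row that starts in that block
  and vanishes at \<open>j\<close>. In particular \<open>unit j'\<close> is reached for a second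
  index \<open>j'\<close> of the block, and shears with pivot \<open>j'\<close> supply the entry at
  \<open>j\<close>.\<close>

lemma invariant_rows:
  fixes W :: "('i \<Rightarrow> 'k::{field,finite}) set"
  assumes W: "W \<subseteq> Row k"
    and diff: "\<And>v w. v \<in> W \<Longrightarrow> w \<in> W \<Longrightarrow> v - w \<in> W"
    and inv: "\<And>v A. v \<in> W \<Longrightarrow> A \<in> V k \<Longrightarrow> vm v A \<in> W"
    and nontriv: "\<exists>v\<in>W. v \<noteq> 0"
  obtains t where "k \<le> t" "W = Row t"
proof -
  have add: "v + w \<in> W" if "v \<in> W" "w \<in> W" for v w
  proof -
    have "v - ((v - v) - w) \<in> W"
      using diff that by blast
    then show ?thesis
      by simp
  qed
  define P where "P = (\<lambda>n. \<exists>w\<in>W. \<exists>j. b j = n \<and> w j \<noteq> 0)"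
  define t where "t = (LEAST n. P n)"
  have "\<exists>n. P n"
    using nontriv by (fastforce simp: P_def fun_eq_iff)
  then have "P t"
    unfolding t_def by (rule LeastI_ex)
  then obtain w j where w: "w \<in> W" "b j = t" "w j \<noteq> 0"
    by (auto simp: P_def)
  have kt: "k \<le> t"
    using w W by (force simp: Row_def)
  have sub: "W \<subseteq> Row t"
  proof
    fix v assume v: "v \<in> W"
    have "v j = 0" if "b j < t" for j
      using not_less_Least[of "b j" P] that v unfolding t_def[symmetric] by (auto simp: P_def)
    then show "v \<in> Row t"
      by (simp add: Row_def)
  qed
  have row: "u \<in> W" if w: "w \<in> W" "b j = t" "w j \<noteq> 0" and u: "u \<in> Row t" "u j = 0" for w j u
  proof -
    define u' where "u' = (\<lambda>c. u c / w j)"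
    have "u' \<in> Row t" "u' j = 0"
      using u by (auto simp: u'_def Row_def)
    then have "R (unit j) u' \<in> V t"
      using R_unit_V[of u' j] w(2) by simp
    then have "vm w (R (unit j) u') - w \<in> W"
      using inv diff w(1) V_mono[OF kt] by blast
    moreover have "vm w (R (unit j) u') - w = u"
      using w(3) by (auto simp: vm_R_unit u'_def fun_eq_iff)
    ultimately show ?thesis
      by simp
  qed
  have "Row t \<subseteq> W"
  proof
    fix u :: "'i \<Rightarrow> 'k" assume u: "u \<in> Row t"
    obtain j' where j': "j' \<noteq> j" "b j' = t"
      using two_in_fibre by metis
    have "unit j' \<in> W"
      using row[OF w, of "unit j'"] j' unit_Row[of t j'] by (simp add: unit_def)
    moreover have "unit j' j' \<noteq> (0::'k)"
      by (simp add: unit_def)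
    moreover have "(\<lambda>c. u j * unit j c) \<in> Row t"
      using w(2) by (auto simp: Row_def unit_def)
    ultimately have 1: "(\<lambda>c. u j * unit j c) \<in> W"
      using row[of "unit j'" j' "\<lambda>c. u j * unit j c"] j' by (simp add: unit_def)
    have "u - (\<lambda>c. u j * unit j c) \<in> W"
      using u w(2) by (intro row[OF w]) (auto simp: Row_def unit_def)
    then have "u - (\<lambda>c. u j * unit j c) + (\<lambda>c. u j * unit j c) \<in> W"
      using 1 add by blast
    then show "u \<in> W"
      by simp
  qed
  then show ?thesis
    using that[OF kt] sub by blast
qed

lemma Row_subset_iff: "Row s \<subseteq> (Row t :: ('i \<Rightarrow> 'k::{field,finite}) set) \<longleftrightarrow> t \<le> s"
proof
  assume sub: "Row s \<subseteq> (Row t :: ('i \<Rightarrow> 'k) set)"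
  obtain j where j: "b j = s"
    by (rule fibre_obtain)
  then have "unit j \<in> (Row t :: ('i \<Rightarrow> 'k) set)"
    using sub unit_Row[of s j] by auto
  then have "b j < t \<longrightarrow> unit j j = (0 :: 'k)"
    unfolding Row_def by blast
  then show "t \<le> s"
    using j by (auto simp: unit_def)
qed (rule Row_mono)

lemma Row_diff: "v \<in> Row t \<Longrightarrow> w \<in> Row t \<Longrightarrow> v - w \<in> Row t"
  and Row_add: "v \<in> Row t \<Longrightarrow> w \<in> Row t \<Longrightarrow> v + w \<in> Row t"
  and Row_minus: "v \<in> Row t \<Longrightarrow> - v \<in> Row t"
  and Row_0: "0 \<in> Row t"
  by (simp_all add: Row_def)

lemma Z_coset_mult:
  assumes "v \<in> AU" "w \<in> AU"
  shows "(Z #>\<^bsub>G\<^esub> v) \<otimes>\<^bsub>PAU_group UNIV (rel {})\<^esub> (Z #>\<^bsub>G\<^esub> w) = Z #>\<^bsub>G\<^esub> (v \<odot> w)"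
  using normal.rcos_sum[OF Z_normal, of v w] assms
  by (simp add: PAU_group_def FactGroup_def carrier_AU)

end

section \<open>Comparison of two block orders\<close>

locale block_order_pair = B: block_order b + C: block_order c
  for b :: "'i \<Rightarrow> nat" and c :: "'j \<Rightarrow> nat"
begin

text \<open>\<open>Row t\<close> modulo \<open>Row (Suc t)\<close> is the space of functions on
  block \<open>t\<close>. By \<open>diff\<close>, distinct classes have images in distinct classes,
  and comparing powers of the field size gives the claim.\<close>

lemma card_fibre_le:
  fixes f :: "('j \<Rightarrow> 'k::{field,finite}) \<Rightarrow> ('i \<Rightarrow> 'k)"
  assumes f: "f \<in> C.Row t \<rightarrow> B.Row s"
    and diff: "\<And>v w. v \<in> C.Row t \<Longrightarrow> w \<in> C.Row t \<Longrightarrow> f v - f w \<in> B.Row (Suc s) \<Longrightarrow> v - w \<in> C.Row (Suc t)"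
  shows "card {y. c y = t} \<le> card {x. b x = s}"
proof -
  let ?P = "{y. c y = t} \<rightarrow>\<^sub>E (UNIV :: 'k set)" and ?Q = "{x. b x = s} \<rightarrow>\<^sub>E (UNIV :: 'k set)"
  define e :: "('j \<Rightarrow> 'k) \<Rightarrow> ('j \<Rightarrow> 'k)" where "e = (\<lambda>u y. if c y = t then u y else 0)"
  have e: "e u \<in> C.Row t" for u
    by (auto simp: e_def C.Row_def)
  have "inj_on (\<lambda>u. restrict (f (e u)) {x. b x = s}) ?P"
  proof (rule inj_onI)
    fix u u' assume u: "u \<in> ?P" "u' \<in> ?P"
      and eq: "restrict (f (e u)) {x. b x = s} = restrict (f (e u')) {x. b x = s}"
    have "f (e u) \<in> B.Row s" "f (e u') \<in> B.Row s"
      using f e by auto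
    moreover have "f (e u) x = f (e u') x" if "b x = s" for x
      using fun_cong[OF eq, of x] that by simp
    ultimately have "f (e u) - f (e u') \<in> B.Row (Suc s)"
      by (auto simp: B.Row_def less_Suc_eq)
    then have "e u - e u' \<in> C.Row (Suc t)"
      by (rule diff[OF e e])
    then have "u y = u' y" if "c y = t" for y
      using that by (auto simp: C.Row_def e_def)
    then show "u = u'"
      using u by (intro PiE_ext[of _ "{y. c y = t}" "\<lambda>_. UNIV"]) auto
  qed
  moreover have "(\<lambda>u. restrict (f (e u)) {x. b x = s}) ` ?P \<subseteq> ?Q"
    by (intro image_subsetI) (simp add: restrict_PiE_iff)
  moreover have "finite ?Q"
    using B.finite_fibre by (intro finite_PiE) auto
  ultimately have "card ?P \<le> card ?Q"
    by (rule card_inj_on_le)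
  then have "CARD('k) ^ card {y. c y = t} \<le> CARD('k) ^ card {x. b x = s}"
    using B.finite_fibre C.finite_fibre by (simp add: card_PiE)
  moreover have "1 < CARD('k)"
    using card_mono[of "UNIV :: 'k set" "{0, 1}"] by simp
  ultimately show ?thesis
    by simp
qed

text \<open>By \<open>act\<close> the image of each \<open>Row t\<close> is an invariant group of
  rows, say \<open>Row (\<sigma> t)\<close>; by \<open>act'\<close> the same holds for preimages, so
  \<sigma> is strictly increasing without gaps. The partners \<open>g\<close> and \<open>h\<close>
  are taken in \<open>V 0\<close> because upper triangular matrices preserve every
  \<open>Row t\<close>.\<close>

lemma rows_isomorphism:
  fixes F :: "('j \<Rightarrow> 'k::{field,finite}) \<Rightarrow> ('i \<Rightarrow> 'k)"
  assumes F: "F \<in> C.Row r \<rightarrow> B.Row n" and inj: "inj_on F (C.Row r)"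
    and diff: "\<And>v w. v \<in> C.Row r \<Longrightarrow> w \<in> C.Row r \<Longrightarrow> F (v - w) = F v - F w"
    and act: "\<And>h. h \<in> B.V n \<Longrightarrow> \<exists>g\<in>C.V 0. \<forall>w\<in>C.Row r. F (C.vm w g) = B.vm (F w) h"
    and act': "\<And>g. g \<in> C.V r \<Longrightarrow> \<exists>h\<in>B.V 0. \<forall>w\<in>C.Row r. F (C.vm w g) = B.vm (F w) h"
  shows "\<exists>s t. \<forall>i. card {x. b x = s + i} = card {y. c y = t + i}"
proof -
  have F0: "F 0 = 0"
    using diff[of 0 0] C.Row_0[of r] by simp
  have Fne: "F v \<noteq> 0" if "v \<in> C.Row r" "v \<noteq> 0" for v
    using inj that F0 C.Row_0[of r] by (metis inj_onD)
  have unit_ne: "C.unit y \<noteq> (0 :: 'j \<Rightarrow> 'k)" "B.unit x \<noteq> (0 :: 'i \<Rightarrow> 'k)" for x y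
    using C.unit_neq_0[of y] B.unit_neq_0[of x] by (auto simp: fun_eq_iff)
  have "\<exists>s. F ` C.Row t = B.Row s" if t: "r \<le> t" for t
  proof -
    have rt: "C.Row t \<subseteq> (C.Row r :: ('j \<Rightarrow> 'k) set)"
      using C.Row_mono[OF t] .
    show ?thesis
    proof (rule B.invariant_rows[of "F ` C.Row t" n])
      show "F ` C.Row t \<subseteq> B.Row n"
        using F rt by auto
      show "v - w \<in> F ` C.Row t" if vw: "v \<in> F ` C.Row t" "w \<in> F ` C.Row t" for v w
      proof -
        obtain v' w' where "v' \<in> C.Row t" "w' \<in> C.Row t" "v = F v'" "w = F w'"
          using vw by blast
        then show ?thesis
          using diff[of v' w'] rt C.Row_diff[of v' t w'] by (metis image_eqI subsetD)
      qed
      show "B.vm v h \<in> F ` C.Row t" if v: "v \<in> F ` C.Row t" and h: "h \<in> B.V n" for v h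
      proof -
        obtain w where w: "w \<in> C.Row t" "v = F w"
          using v by blast
        obtain g where g: "g \<in> C.V 0" "\<forall>w\<in>C.Row r. F (C.vm w g) = B.vm (F w) h"
          using act[OF h] by blast
        have "C.vm w g \<in> C.Row t"
          using C.vm_Row[OF C.V_tri0[OF g(1)] w(1)] .
        then show ?thesis
          using g(2) w rt by (metis image_eqI subsetD)
      qed
      obtain y where "c y = t"
        by (rule C.fibre_obtain)
      then have "C.unit y \<in> (C.Row t :: ('j \<Rightarrow> 'k) set)"
        by (intro C.unit_Row) simp
      then show "\<exists>v\<in>F ` C.Row t. v \<noteq> 0"
        using Fne unit_ne(1) rt by blast
    qed blast
  qed
  then obtain \<sigma> where \<sigma>: "\<And>t. r \<le> t \<Longrightarrow> F ` C.Row t = B.Row (\<sigma> t)"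
    by metis
  have mono: "\<sigma> t < \<sigma> t'" if t: "r \<le> t" "t < t'" for t t'
  proof -
    have "C.Row t' \<subseteq> (C.Row t :: ('j \<Rightarrow> 'k) set)" "\<not> C.Row t \<subseteq> (C.Row t' :: ('j \<Rightarrow> 'k) set)"
      using t by (auto simp: C.Row_subset_iff)
    moreover have "C.Row t \<subseteq> (C.Row r :: ('j \<Rightarrow> 'k) set)" "C.Row t' \<subseteq> (C.Row r :: ('j \<Rightarrow> 'k) set)"
      using t by (auto simp: C.Row_subset_iff)
    ultimately have "\<not> F ` C.Row t \<subseteq> F ` C.Row t'"
      using inj_on_image_subset_iff[OF inj] by blast
    then show ?thesis
      using \<sigma>[of t] \<sigma>[of t'] t B.Row_subset_iff[where 'k = 'k] by (metis less_imp_le not_le order_trans)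
  qed
  have onto: "\<exists>t\<ge>r. \<sigma> t = s" if s: "\<sigma> r \<le> s" for s
  proof -
    let ?W = "{w \<in> C.Row r. F w \<in> B.Row s}"
    have sub: "B.Row s \<subseteq> F ` C.Row r"
      using \<sigma>[of r] B.Row_mono[OF s] by simp
    obtain t where t: "r \<le> t" "?W = C.Row t"
    proof (rule C.invariant_rows[of ?W r])
      show "v - w \<in> ?W" if "v \<in> ?W" "w \<in> ?W" for v w
        using that diff C.Row_diff B.Row_diff by auto
      show "C.vm v g \<in> ?W" if v: "v \<in> ?W" and g: "g \<in> C.V r" for v g
      proof -
        obtain h where h: "h \<in> B.V 0" "\<forall>w\<in>C.Row r. F (C.vm w g) = B.vm (F w) h"
          using act'[OF g] by blast
        then show ?thesis
          using v C.vm_Row[OF C.V_tri0[OF g], of v r] B.vm_Row[OF B.V_tri0[OF h(1)], of "F v" s] by simp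
      qed
      obtain x where "b x = s"
        by (rule B.fibre_obtain)
      then have "B.unit x \<in> (B.Row s :: ('i \<Rightarrow> 'k) set)"
        by (intro B.unit_Row) simp
      then obtain w where w: "w \<in> C.Row r" "F w = B.unit x" "F w \<in> B.Row s"
        using sub by (metis imageE subsetD)
      then have "w \<noteq> 0"
        using F0 unit_ne(2)[of x] by auto
      then show "\<exists>v\<in>?W. v \<noteq> 0"
        using w by blast
    qed auto
    have "F ` ?W = B.Row s"
      using sub by auto
    then have "B.Row (\<sigma> t) = (B.Row s :: ('i \<Rightarrow> 'k) set)"
      using t \<sigma> by simp
    then have "\<sigma> t = s"
      using B.Row_subset_iff[where 'k = 'k] by (metis order_antisym order_refl)
    then show ?thesis
      using t(1) by blast
  qed
  \<comment> \<open>The value \<open>Suc (\<sigma> t)\<close> is attained at some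
    \<open>t' > t\<close>, and monotonicity bounds \<open>\<sigma> (Suc t)\<close> by it.\<close>
  have Suc: "\<sigma> (Suc t) = Suc (\<sigma> t)" if t: "r \<le> t" for t
  proof (rule antisym)
    show "Suc (\<sigma> t) \<le> \<sigma> (Suc t)"
      using mono[of t "Suc t"] t by simp
    have "\<sigma> r \<le> \<sigma> t"
      using mono[of r t] t by (cases "r = t") auto
    then obtain t' where t': "r \<le> t'" "\<sigma> t' = Suc (\<sigma> t)"
      using onto[of "Suc (\<sigma> t)"] by auto
    then have "t < t'"
      using mono[of t' t] by (cases t t' rule: linorder_cases) auto
    then show "\<sigma> (Suc t) \<le> Suc (\<sigma> t)"
      using mono[of "Suc t" t'] t t'(2) by (cases "Suc t = t'") auto
  qed
  have "card {y. c y = t} = card {x. b x = \<sigma> t}" if t: "r \<le> t" for t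
  proof (rule antisym)
    have rt: "C.Row t \<subseteq> (C.Row r :: ('j \<Rightarrow> 'k) set)" "C.Row (Suc t) \<subseteq> (C.Row r :: ('j \<Rightarrow> 'k) set)"
      using t by (auto simp: C.Row_subset_iff)
    have img: "F ` C.Row t = B.Row (\<sigma> t)" "F ` C.Row (Suc t) = B.Row (Suc (\<sigma> t))"
      using \<sigma>[of t] \<sigma>[of "Suc t"] Suc t by simp_all
    have lift: "w \<in> C.Row (Suc t)" if w: "w \<in> C.Row r" "F w \<in> B.Row (Suc (\<sigma> t))" for w
      using w(2) inj_on_image_mem_iff[OF inj w(1) rt(2)] unfolding img(2) by blast
    show "card {y. c y = t} \<le> card {x. b x = \<sigma> t}"
    proof (rule card_fibre_le[of F])
      show "F \<in> C.Row t \<rightarrow> B.Row (\<sigma> t)"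
        using img by blast
      show "v - w \<in> C.Row (Suc t)"
        if vw: "v \<in> C.Row t" "w \<in> C.Row t" and F: "F v - F w \<in> B.Row (Suc (\<sigma> t))" for v w
      proof -
        have "v \<in> C.Row r" "w \<in> C.Row r"
          using vw rt by auto
        then show ?thesis
          using F diff C.Row_diff by (intro lift) auto
      qed
    qed
    \<comment> \<open>The reverse inequality is the same count for the inverse of \<open>F\<close>,
      with the two orders exchanged.\<close>
    interpret swap: block_order_pair c b ..
    let ?G = "inv_into (C.Row t) F"
    have G: "?G v \<in> C.Row t" "F (?G v) = v" if "v \<in> B.Row (\<sigma> t)" for v
      using that img(1) inv_into_into[of v F "C.Row t"] f_inv_into_f[of v F "C.Row t"] by auto
    show "card {x. b x = \<sigma> t} \<le> card {y. c y = t}"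
    proof (rule swap.card_fibre_le[of ?G])
      show "?G \<in> B.Row (\<sigma> t) \<rightarrow> C.Row t"
        using G by blast
      show "v - w \<in> B.Row (Suc (\<sigma> t))"
        if "v \<in> B.Row (\<sigma> t)" "w \<in> B.Row (\<sigma> t)" "?G v - ?G w \<in> C.Row (Suc t)" for v w
      proof -
        have "F (?G v - ?G w) = v - w"
          using G that rt diff[of "?G v" "?G w"] by auto
        then show ?thesis
          using that(3) img(2) by (metis image_eqI)
      qed
    qed
  qed
  moreover have "\<sigma> (r + i) = \<sigma> r + i" for i
    by (induction i) (simp_all add: Suc)
  ultimately have "card {x. b x = \<sigma> r + i} = card {y. c y = r + i}" for i
    by (metis le_add1)
  then show ?thesis
    by blast
qed

text \<open>The image \<open>N\<close> of a group of transvections is a subgroup normalised by some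
  \<open>C.V j\<close>, so it contains a family \<open>R x' w\<close> on the other side. Matching
  the two kinds of transvections gives the row map \<open>F\<close>, which intertwines the action of
  \<open>h\<close> with that of \<open>\<psi> h\<close>.\<close>

lemma tails_agree:
  fixes \<psi> :: "('i \<times> 'i \<Rightarrow> 'k::{field,finite}) \<Rightarrow> ('j \<times> 'j \<Rightarrow> 'k)"
  assumes k: "1 \<le> k" and inj: "inj_on \<psi> (B.V k)" and range: "\<And>v. v \<in> B.V k \<Longrightarrow> \<psi> v \<in> C.AU"
    and mult: "\<And>v w. v \<in> B.V k \<Longrightarrow> w \<in> B.V k \<Longrightarrow> \<psi> (v \<odot> w) = \<psi> v \<odot> \<psi> w"
    and opn: "\<And>n. k \<le> n \<Longrightarrow> \<exists>j. C.V j \<subseteq> \<psi> ` B.V n"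
    and cont: "\<And>j. \<exists>n\<ge>k. \<psi> ` B.V n \<subseteq> C.V j"
  shows "\<exists>s t. \<forall>i. card {x. b x = s + i} = card {y. c y = t + i}"
proof -
  have Idm: "Idm \<in> B.V k"
    by (simp add: B.V_iff B.AU_Idm B.tri_Idm)
  have one: "\<psi> Idm = Idm"
  proof -
    have "\<psi> Idm \<odot> \<psi> Idm = \<psi> Idm"
      using mult[OF Idm Idm] by simp
    then show ?thesis
      using range[OF Idm] by (metis C.inv_AU(3) C.inv_mm C.col_finite_AU)
  qed
  have inv: "\<psi> (inv\<^bsub>B.G\<^esub> v) = inv\<^bsub>C.G\<^esub> (\<psi> v)" if v: "v \<in> B.V k" for v
  proof (rule C.inv_eqI[symmetric])
    show "\<psi> v \<in> C.AU" "\<psi> (inv\<^bsub>B.G\<^esub> v) \<in> C.AU"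
      using range v B.V_inv by auto
    show "\<psi> (inv\<^bsub>B.G\<^esub> v) \<odot> \<psi> v = Idm"
      using mult[OF B.V_inv[OF v] v] B.inv_AU(3)[OF B.V_AU[OF v]] one by simp
  qed
  \<comment> \<open>Since \<open>k \<ge> 1\<close>, a unit column in block \<open>0\<close> lies in
    \<open>Col n\<close> for every \<open>n \<ge> k\<close>, so one \<open>x\<close> serves at all
    levels.\<close>
  obtain p where p: "b p = 0"
    by (rule B.fibre_obtain)
  define x :: "'i \<Rightarrow> 'k" where "x = B.unit p"
  have x: "x \<in> B.Col k" "x \<noteq> (\<lambda>_. 0)"
    using p k B.unit_Col[of p k] B.unit_neq_0[of p] by (auto simp: x_def)
  have xCol: "x \<in> B.Col n" if "k \<le> n" for n
    using x(1) B.Col_mono[OF that] by blast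
  have RV: "B.R x v \<in> B.V k" if "v \<in> B.Row k" for v
    using B.R_V_block[OF x(1) that] .
  have Rmult: "B.R x v \<odot> B.R x w = B.R x (v + w)" if "v \<in> B.Row k" for v w
    using B.R_mult[OF x(1) B.Col_Row[OF x(1) that]] .
  have Rinj: "v = w" if "v \<in> B.Row k" "w \<in> B.Row k" "\<psi> (B.R x v) = \<psi> (B.R x w)" for v w
    using that inj RV B.R_inj[OF x(2)] by (metis inj_onD)
  define N where "N = (\<lambda>v. \<psi> (B.R x v)) ` B.Row k"
  have N: "subgroup N C.G"
  proof (rule subgroup.intro)
    show "N \<subseteq> carrier C.G"
      using range RV by (auto simp: N_def C.carrier_AU)
    show "\<one>\<^bsub>C.G\<^esub> \<in> N"
      using one B.Row_0[of k] B.R_0[of x] unfolding N_def by (metis C.one_G image_eqI)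
    show "u \<otimes>\<^bsub>C.G\<^esub> u' \<in> N" if u: "u \<in> N" "u' \<in> N" for u u'
    proof -
      obtain v w where "v \<in> B.Row k" "w \<in> B.Row k" "u = \<psi> (B.R x v)" "u' = \<psi> (B.R x w)"
        using u by (auto simp: N_def)
      then have "u \<otimes>\<^bsub>C.G\<^esub> u' = \<psi> (B.R x (v + w))" "v + w \<in> B.Row k"
        using mult[OF RV RV, of v w] Rmult[of v w] B.Row_add[of v k w] by auto
      then show ?thesis
        by (auto simp: N_def)
    qed
    show "inv\<^bsub>C.G\<^esub> u \<in> N" if u: "u \<in> N" for u
    proof -
      obtain v where v: "v \<in> B.Row k" "u = \<psi> (B.R x v)"
        using u by (auto simp: N_def)
      have "inv\<^bsub>B.G\<^esub> (B.R x v) = B.R x (- v)"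
        using B.R_AU(2)[OF x(1) B.Col_Row[OF x(1) v(1)]] .
      then have "inv\<^bsub>C.G\<^esub> u = \<psi> (B.R x (- v))"
        using inv[OF RV[OF v(1)]] v(2) by simp
      then show ?thesis
        using B.Row_minus[OF v(1)] by (auto simp: N_def)
    qed
  qed
  have conj: "inv\<^bsub>C.G\<^esub> (\<psi> h) \<odot> \<psi> (B.R x v) \<odot> \<psi> h = \<psi> (B.R x (B.vm v h))"
    if "h \<in> B.V k" "v \<in> B.Row k" for h v
    using B.R_conj[OF that(1) x(1), of v] that RV B.V_inv B.V_mult mult inv by metis
  obtain j0 where "C.V j0 \<subseteq> \<psi> ` B.V k"
    using opn by blast
  then obtain j where j: "0 < j" "C.V j \<subseteq> \<psi> ` B.V k"
    using C.V_mono[of j0 "Suc j0"] by (metis le_SucI le_refl subset_trans zero_less_Suc)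
  have vm_k: "B.vm v h \<in> B.Row n" if "h \<in> B.V m" "v \<in> B.Row n" for v n m and h :: "'i \<times> 'i \<Rightarrow> 'k"
    using B.vm_Row[OF B.V_tri0[OF that(1)] that(2)] .
  have Nconj: "inv\<^bsub>C.G\<^esub> g \<odot> a \<odot> g \<in> N" if g: "g \<in> C.V j" and a: "a \<in> N" for g a
  proof -
    obtain h v where "h \<in> B.V k" "g = \<psi> h" "v \<in> B.Row k" "a = \<psi> (B.R x v)"
      using g a j(2) by (auto simp: N_def)
    then show ?thesis
      using conj[of h v] vm_k[of h k v k] by (auto simp: N_def)
  qed
  \<comment> \<open>A row starting in block \<open>n\<close> puts the transvection into
    \<open>B.V n\<close>, so its image \<open>a\<close> lies in \<open>C.V j\<close> as
    \<open>contains_rank_one\<close> requires.\<close>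
  obtain n where n: "k \<le> n" "\<psi> ` B.V n \<subseteq> C.V j"
    using cont by blast
  obtain q where q: "b q = n"
    by (rule B.fibre_obtain)
  have uq: "B.unit q \<in> (B.Row n :: ('i \<Rightarrow> 'k) set)" "B.unit q \<in> (B.Row k :: ('i \<Rightarrow> 'k) set)"
    using q n(1) by (auto intro: B.unit_Row)
  define a where "a = \<psi> (B.R x (B.unit q))"
  have "a \<in> N"
    using uq by (auto simp: a_def N_def)
  moreover have "a \<in> C.V j"
    using B.R_V_block[OF xCol[OF n(1)] uq(1)] n(2) by (auto simp: a_def)
  moreover have "a \<noteq> Idm"
  proof
    assume "a = Idm"
    then have "\<psi> (B.R x (B.unit q)) = \<psi> (B.R x 0)"
      using one by (simp add: a_def B.R_0)
    then have "B.unit q = (0 :: 'i \<Rightarrow> 'k)"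
      using Rinj uq(2) B.Row_0 by blast
    then show False
      using B.unit_neq_0[of q] by (auto simp: fun_eq_iff)
  qed
  ultimately obtain x' r0 where x': "x' \<in> C.Col j" "x' \<noteq> (\<lambda>_. 0)" "j \<le> r0" "\<forall>w\<in>C.Row r0. C.R x' w \<in> N"
    using C.contains_rank_one[OF N Nconj j(1)] by blast
  obtain j1 where j1: "C.V j1 \<subseteq> \<psi> ` B.V n"
    using opn n(1) by blast
  \<comment> \<open>\<open>r0\<close> keeps the matrices \<open>R x' w\<close> inside
    \<open>N\<close>; \<open>j1\<close> makes \<open>C.V r\<close> part of the image of
    \<open>B.V n\<close>, which forces the corresponding rows into \<open>Row n\<close>.\<close>
  define r where "r = max r0 j1"
  have r: "r0 \<le> r" "j1 \<le> r" "j \<le> r"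
    using x'(3) by (auto simp: r_def)
  have x'r: "x' \<in> C.Col r"
    using x'(1) C.Col_mono[OF r(3)] by blast
  have YV: "C.R x' w \<in> C.V r" if "w \<in> C.Row r" for w
    using C.R_V_block[OF x'r that] .
  have Vr: "C.V r \<subseteq> \<psi> ` B.V n"
    using j1 C.V_mono[OF r(2)] by blast
  have ex: "\<exists>v\<in>B.Row n. \<psi> (B.R x v) = C.R x' w" if w: "w \<in> C.Row r" for w
  proof -
    obtain h where h: "h \<in> B.V n" "C.R x' w = \<psi> h"
      using YV[OF w] Vr by blast
    obtain v where v: "v \<in> B.Row k" "C.R x' w = \<psi> (B.R x v)"
      using x'(4) w C.Row_mono[OF r(1)] by (auto simp: N_def)
    \<comment> \<open>Two preimages of the same matrix, one known to be in \<open>B.V n\<close> and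
      one known to be a transvection; injectivity on \<open>B.V k\<close> identifies them.\<close>
    have "h = B.R x v"
      using inj h v RV B.V_mono[OF n(1)] by (metis inj_onD subsetD)
    then have "v \<in> B.Row n"
      using h(1) B.R_V_Row[OF x(2)] by blast
    then show ?thesis
      using v(2) by auto
  qed
  then obtain F where F: "\<And>w. w \<in> C.Row r \<Longrightarrow> F w \<in> B.Row n" "\<And>w. w \<in> C.Row r \<Longrightarrow> \<psi> (B.R x (F w)) = C.R x' w"
    by metis
  have nk: "v \<in> B.Row k" if "v \<in> B.Row n" for v :: "'i \<Rightarrow> 'k"
    using that B.Row_mono[OF n(1)] by blast
  \<comment> \<open>Conjugating \<open>R x' w\<close> by \<open>\<psi> h\<close> and
    \<open>R x (F w)\<close> by \<open>h\<close> changes only the rows, and \<psi> carries one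
    computation to the other.\<close>
  have equivariant: "F (C.vm w (\<psi> h)) = B.vm (F w) h"
    if h: "h \<in> B.V k" and \<psi>h: "\<psi> h \<in> C.V j" and w: "w \<in> C.Row r" for h w
  proof (rule Rinj)
    have w': "C.vm w (\<psi> h) \<in> C.Row r"
      using C.vm_Row[OF C.V_tri0[OF \<psi>h] w] .
    show "F (C.vm w (\<psi> h)) \<in> B.Row k" "B.vm (F w) h \<in> B.Row k"
      using F(1)[OF w'] F(1)[OF w] nk vm_k[OF h] by blast+
    have "\<psi> (B.R x (F (C.vm w (\<psi> h)))) = C.R x' (C.vm w (\<psi> h))"
      using F(2)[OF w'] .
    also have "\<dots> = inv\<^bsub>C.G\<^esub> (\<psi> h) \<odot> C.R x' w \<odot> \<psi> h"
      using C.R_conj[OF \<psi>h x'(1)] by simp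
    also have "\<dots> = \<psi> (B.R x (B.vm (F w) h))"
      using conj[OF h nk[OF F(1)[OF w]]] F(2)[OF w] by simp
    finally show "\<psi> (B.R x (F (C.vm w (\<psi> h)))) = \<psi> (B.R x (B.vm (F w) h))" .
  qed
  have add: "F (v + w) = F v + F w" if vw: "v \<in> C.Row r" "w \<in> C.Row r" for v w
  proof (rule Rinj)
    have s: "v + w \<in> C.Row r"
      using C.Row_add[OF vw] .
    show "F (v + w) \<in> B.Row k" "F v + F w \<in> B.Row k"
      using F(1)[OF s] F(1)[OF vw(1)] F(1)[OF vw(2)] nk B.Row_add by blast+
    have "\<psi> (B.R x (F v + F w)) = \<psi> (B.R x (F v)) \<odot> \<psi> (B.R x (F w))"
      using Rmult[OF nk[OF F(1)[OF vw(1)]], of "F w"]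
        mult[OF RV[OF nk[OF F(1)[OF vw(1)]]] RV[OF nk[OF F(1)[OF vw(2)]]]]
      by simp
    also have "\<dots> = C.R x' v \<odot> C.R x' w"
      using F(2) vw by simp
    also have "\<dots> = C.R x' (v + w)"
      using C.R_mult[OF x'r C.Col_Row[OF x'r vw(1)]] .
    finally show "\<psi> (B.R x (F (v + w))) = \<psi> (B.R x (F v + F w))"
      using F(2)[OF s] by simp
  qed
  show ?thesis
  proof (rule rows_isomorphism[of F r n])
    show "F \<in> C.Row r \<rightarrow> B.Row n"
      using F(1) by blast
    show "inj_on F (C.Row r)"
      using F(2) C.R_inj[OF x'(2)] by (metis inj_onI)
    show "F (v - w) = F v - F w" if "v \<in> C.Row r" "w \<in> C.Row r" for v w
      using add[of "v - w" w] C.Row_diff[of v r w] that by simp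
    show "\<exists>g\<in>C.V 0. \<forall>w\<in>C.Row r. F (C.vm w g) = B.vm (F w) h" if h: "h \<in> B.V n" for h
    proof -
      have "\<psi> h \<in> C.V j" "h \<in> B.V k"
        using h n B.V_mono[OF n(1)] by auto
      moreover from this have "\<psi> h \<in> C.V 0"
        using C.V_mono[of 0 j] by auto
      ultimately show ?thesis
        using equivariant by blast
    qed
    show "\<exists>h\<in>B.V 0. \<forall>w\<in>C.Row r. F (C.vm w g) = B.vm (F w) h" if g: "g \<in> C.V r" for g
    proof -
      obtain h where h: "h \<in> B.V n" "g = \<psi> h"
        using Vr g by blast
      have "h \<in> B.V k" "h \<in> B.V 0" "\<psi> h \<in> C.V j"
        using h g B.V_mono[OF n(1)] B.V_mono[of 0 n] C.V_mono[OF r(3)] by auto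
      then show ?thesis
        using equivariant h(2) by blast
    qed
  qed
qed

text \<open>The projection to the quotient is injective on \<open>V 1\<close> on both sides, so
  \<phi> lifts to a map \<psi> between congruence subgroups of the groups before the
  quotient.\<close>

lemma locally_isomorphic_tails:
  assumes iso: "locally_isomorphic
      (PAU_group UNIV (B.rel {}),
       PAU_topology UNIV (B.rel {}) :: ('i \<times> 'i \<Rightarrow> 'k::{field,finite}) set topology)
      (PAU_group UNIV (C.rel {}), PAU_topology UNIV (C.rel {}) :: ('j \<times> 'j \<Rightarrow> 'k) set topology)"
  shows "\<exists>s t. \<forall>i. card {x. b x = s + i} = card {y. c y = t + i}"
proof -
  let ?PB = "PAU_group UNIV (B.rel {}) :: ('i \<times> 'i \<Rightarrow> 'k) set monoid"
  let ?PC = "PAU_group UNIV (C.rel {}) :: ('j \<times> 'j \<Rightarrow> 'k) set monoid"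
  let ?\<pi>B = "\<lambda>v :: 'i \<times> 'i \<Rightarrow> 'k. B.Z #>\<^bsub>B.G\<^esub> v"
  let ?\<pi>C = "\<lambda>v :: 'j \<times> 'j \<Rightarrow> 'k. C.Z #>\<^bsub>C.G\<^esub> v"
  obtain U \<phi> where "local_isomorphism ?PB (filtration_topology ?PB B.V_bar)
      ?PC (filtration_topology ?PC C.V_bar) U \<phi>"
    using iso unfolding locally_isomorphic_def B.PAU_topology_eq C.PAU_topology_eq by auto
  then obtain k0 where \<phi>: "inj_on \<phi> (B.V_bar k0)"
    "\<And>x y. \<lbrakk>x \<in> B.V_bar k0; y \<in> B.V_bar k0\<rbrakk> \<Longrightarrow> \<phi> (x \<otimes>\<^bsub>?PB\<^esub> y) = \<phi> x \<otimes>\<^bsub>?PC\<^esub> \<phi> y"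
    "\<And>n. n \<ge> k0 \<Longrightarrow> \<exists>j. C.V_bar j \<subseteq> \<phi> ` B.V_bar n"
    "\<And>j. \<exists>n\<ge>k0. \<phi> ` B.V_bar n \<subseteq> C.V_bar j"
    by (rule filtered_local_isomorphism[OF B.filtered_group_PAU C.filtered_group_PAU]) blast
  obtain k1 where k1: "k0 \<le> k1" "\<phi> ` B.V_bar k1 \<subseteq> C.V_bar 1"
    using \<phi>(4) by blast
  \<comment> \<open>\<open>k \<ge> k1\<close> keeps the images in \<open>V_bar 1\<close>, where
    lifts into \<open>V 1\<close> exist, and \<open>k \<ge> 1\<close> makes the projection injective
    on \<open>B.V k\<close>.\<close>
  define k where "k = Suc k1"
  have k: "k0 \<le> k" "k1 \<le> k" "1 \<le> k"
    using k1(1) by (auto simp: k_def)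
  have Vk: "B.V k \<subseteq> (B.V k0 :: ('i \<times> 'i \<Rightarrow> 'k) set)" "B.V k \<subseteq> (B.V k1 :: ('i \<times> 'i \<Rightarrow> 'k) set)"
    "B.V k \<subseteq> (B.V 1 :: ('i \<times> 'i \<Rightarrow> 'k) set)"
    using B.V_mono k by auto
  define \<psi> where "\<psi> = (\<lambda>v. inv_into (C.V 1) ?\<pi>C (\<phi> (?\<pi>B v)))"
  have \<psi>: "\<psi> v \<in> C.V 1" "?\<pi>C (\<psi> v) = \<phi> (?\<pi>B v)" if v: "v \<in> B.V k" for v
  proof -
    have "\<phi> (?\<pi>B v) \<in> ?\<pi>C ` C.V 1"
      using v Vk(2) k1(2) by blast
    then show "\<psi> v \<in> C.V 1" "?\<pi>C (\<psi> v) = \<phi> (?\<pi>B v)"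
      unfolding \<psi>_def by (rule inv_into_into, rule f_inv_into_f)
  qed
  have \<psi>_eq: "\<psi> v = w" if "v \<in> B.V k" "w \<in> C.V 1" "?\<pi>C w = \<phi> (?\<pi>B v)" for v w
    using \<psi>[OF that(1)] that C.Z_coset_inj by (metis inj_onD)
  show ?thesis
  proof (rule tails_agree[of k \<psi>])
    show "inj_on \<psi> (B.V k)"
    proof (rule inj_onI)
      fix v w assume vw: "v \<in> B.V k" "w \<in> B.V k" "\<psi> v = \<psi> w"
      then have "\<phi> (?\<pi>B v) = \<phi> (?\<pi>B w)"
        using \<psi>(2) by metis
      then have "?\<pi>B v = ?\<pi>B w"
        using \<phi>(1) vw(1,2) Vk(1) by (meson imageI inj_onD subsetD)
      then show "v = w"
        using vw(1,2) Vk(3) B.Z_coset_inj by (meson inj_onD subsetD)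
    qed
    show "\<psi> v \<in> C.AU" if "v \<in> B.V k" for v
      using \<psi>(1)[OF that] C.V_AU by blast
    show "\<psi> (v \<odot> w) = \<psi> v \<odot> \<psi> w" if vw: "v \<in> B.V k" "w \<in> B.V k" for v w
    proof (rule \<psi>_eq)
      show "v \<odot> w \<in> B.V k"
        using B.V_mult vw .
      show "\<psi> v \<odot> \<psi> w \<in> C.V 1"
        using C.V_mult \<psi>(1) vw by blast
      have "?\<pi>C (\<psi> v \<odot> \<psi> w) = \<phi> (?\<pi>B v) \<otimes>\<^bsub>?PC\<^esub> \<phi> (?\<pi>B w)"
        using C.Z_coset_mult[OF C.V_AU[OF \<psi>(1)[OF vw(1)]] C.V_AU[OF \<psi>(1)[OF vw(2)]]] \<psi>(2) vw by simp
      also have "\<dots> = \<phi> (?\<pi>B v \<otimes>\<^bsub>?PB\<^esub> ?\<pi>B w)"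
        using vw Vk(1) by (intro \<phi>(2)[symmetric]) auto
      also have "\<dots> = \<phi> (?\<pi>B (v \<odot> w))"
        using B.Z_coset_mult[OF B.V_AU[OF vw(1)] B.V_AU[OF vw(2)]] by simp
      finally show "?\<pi>C (\<psi> v \<odot> \<psi> w) = \<phi> (?\<pi>B (v \<odot> w))" .
    qed
    show "\<exists>j. C.V j \<subseteq> \<psi> ` B.V n" if n: "k \<le> n" for n
    proof -
      obtain j where j: "C.V_bar j \<subseteq> \<phi> ` B.V_bar n"
        using \<phi>(3) k(1) n by (meson le_trans)
      have "w \<in> \<psi> ` B.V n" if w: "w \<in> C.V (max j 1)" for w
      proof -
        have w': "w \<in> C.V j" "w \<in> C.V 1"
          using w C.V_mono[of j "max j 1"] C.V_mono[of 1 "max j 1"] by auto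
        then obtain v where v: "v \<in> B.V n" "?\<pi>C w = \<phi> (?\<pi>B v)"
          using j by blast
        then have "\<psi> v = w"
          using w'(2) B.V_mono[OF n] by (intro \<psi>_eq) auto
        then show ?thesis
          using v(1) by blast
      qed
      then show ?thesis
        by blast
    qed
    show "\<exists>n\<ge>k. \<psi> ` B.V n \<subseteq> C.V j" for j
    proof -
      obtain n0 where n0: "\<phi> ` B.V_bar n0 \<subseteq> C.V_bar (max j 1)"
        using \<phi>(4) by blast
      have "\<psi> v \<in> C.V j" if v: "v \<in> B.V (max n0 k)" for v
      proof -
        have v': "v \<in> B.V n0" "v \<in> B.V k"
          using v B.V_mono[of n0 "max n0 k"] B.V_mono[of k "max n0 k"] by auto
        then obtain w where w: "w \<in> C.V (max j 1)" "?\<pi>C w = \<phi> (?\<pi>B v)"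
          using n0 by blast
        have "\<psi> v = w"
          using w C.V_mono[of 1 "max j 1"] v'(2) by (intro \<psi>_eq) auto
        then show ?thesis
          using w(1) C.V_mono[of j "max j 1"] by auto
      qed
      then show ?thesis
        by (intro exI[of _ "max n0 k"]) auto
    qed
  qed (rule k(3))
qed

end

text \<open>Puts each group into its own class, so that equality of two classes yields a local
  isomorphism between the groups.\<close>

lemma locally_isomorphic_refl:
  assumes "topological_group G T"
  shows "locally_isomorphic (G, T) (G, T)"
proof -
  interpret group G
    using assms by (simp add: topological_group_def)
  have T: "topspace T = carrier G"
    using assms by (simp add: topological_group_def)
  have "local_isomorphism G T G T (topspace T) id"
    using openin_topspace[of T] unfolding T
    by (simp add: local_isomorphism_def embedding_map_def open_map_id
        subtopology_topspace[of T, unfolded T] T)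
  then show ?thesis
    unfolding locally_isomorphic_def by auto
qed

section \<open>Uncountably many block size sequences\<close>

text \<open>The two residues \<open>0\<close> and \<open>1\<close> modulo 3 provide the basic
  elements of each block; the numbers of residue \<open>2\<close> are spent one by one on the blocks
  numbered by \<open>A\<close>. For infinite \<open>A\<close> this uses up all naturals, so
  \<Lambda> can be \<open>UNIV\<close>.\<close>

definition blocks :: "nat set \<Rightarrow> nat \<Rightarrow> nat" where
  "blocks A i = (if i mod 3 = 2 then enumerate A (i div 3) else i div 3)"

lemma blocks_values:
  "blocks A (3 * n) = n" "blocks A (3 * n + 1) = n" "blocks A (3 * n + 2) = enumerate A n"
proof -
  have "(3 * n) mod 3 \<noteq> 2" "(3 * n) div 3 = n" "(3 * n + 1) mod 3 \<noteq> 2" "(3 * n + 1) div 3 = n"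
    "(3 * n + 2) mod 3 = 2" "(3 * n + 2) div 3 = n"
    by presburger+
  then show "blocks A (3 * n) = n" "blocks A (3 * n + 1) = n" "blocks A (3 * n + 2) = enumerate A n"
    unfolding blocks_def by presburger+
qed

lemma blocks_fibre:
  "{i. blocks A i = n} = {3 * n, 3 * n + 1} \<union> (\<lambda>k. 3 * k + 2) ` {k. enumerate A k = n}"
proof (intro equalityI subsetI)
  fix i assume i: "i \<in> {i. blocks A i = n}"
  have "i = 3 * (i div 3) \<or> i = 3 * (i div 3) + 1 \<or> i = 3 * (i div 3) + 2"
    by presburger
  then obtain k where "i = 3 * k \<or> i = 3 * k + 1 \<or> i = 3 * k + 2"
    by blast
  then show "i \<in> {3 * n, 3 * n + 1} \<union> (\<lambda>k. 3 * k + 2) ` {k. enumerate A k = n}"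
    using i blocks_values[of A k] by auto
next
  fix i assume "i \<in> {3 * n, 3 * n + 1} \<union> (\<lambda>k. 3 * k + 2) ` {k. enumerate A k = n}"
  then show "i \<in> {i. blocks A i = n}"
    using blocks_values[of A] by blast
qed

lemma enumerate_fibre:
  assumes "infinite (A :: nat set)"
  shows "finite {k. enumerate A k = n}" "card {k. enumerate A k = n} = of_bool (n \<in> A)"
proof -
  have inj: "k = l" if "enumerate A k = enumerate A l" for k l
    using that assms enumerate_mono[of k l A] enumerate_mono[of l k A]
    by (cases k l rule: linorder_cases) auto
  have "{k. enumerate A k = n} = {} \<and> n \<notin> A \<or> (\<exists>k. {k. enumerate A k = n} = {k}) \<and> n \<in> A"
  proof (cases "n \<in> A")
    case True
    then obtain k where "enumerate A k = n"
      using enumerate_Ex assms by blast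
    then show ?thesis
      using True inj by blast
  next
    case False
    then show ?thesis
      using enumerate_in_set[OF assms] by blast
  qed
  then show "finite {k. enumerate A k = n}" "card {k. enumerate A k = n} = of_bool (n \<in> A)"
    by auto
qed

lemma card_blocks_fibre:
  assumes "infinite A"
  shows "card {i. blocks A i = n} = 2 + of_bool (n \<in> A)"
proof -
  have "card {i. blocks A i = n} =
      card {3 * n, 3 * n + 1} + card ((\<lambda>k. 3 * k + 2) ` {k. enumerate A k = n})"
    unfolding blocks_fibre
  proof (rule card_Un_disjoint)
    have "3 * n \<noteq> 3 * k + 2" "3 * n + 1 \<noteq> 3 * k + 2" for k
      by presburger+
    then show "{3 * n, 3 * n + 1} \<inter> (\<lambda>k. 3 * k + 2) ` {k. enumerate A k = n} = {}"
      by blast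
  qed (use enumerate_fibre(1)[OF assms] in simp_all)
  then show ?thesis
    using enumerate_fibre(2)[OF assms] by (simp add: card_image inj_on_def)
qed

lemma block_order_blocks:
  assumes "infinite A"
  shows "block_order (blocks A)"
proof
  show "finite {i. blocks A i = n}" for n
    unfolding blocks_fibre using enumerate_fibre(1)[OF assms] by simp
  show "\<exists>i j. i \<noteq> j \<and> blocks A i = n \<and> blocks A j = n" for n
  proof (intro exI conjI)
    show "3 * n \<noteq> 3 * n + 1"
      by simp
  qed (rule blocks_values)+
qed

text \<open>Equality of tails up to translation.\<close>

definition shift_related :: "nat set \<Rightarrow> nat set set" where
  "shift_related A = {B. \<exists>s t. \<forall>i. s + i \<in> A \<longleftrightarrow> t + i \<in> B}"

text \<open>\<open>B\<close> is recovered from \<open>A\<close>, the two offsets \<open>s\<close>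
  and \<open>t\<close>, and the finite set of its elements below \<open>t\<close>.\<close>

lemma countable_shift_related: "countable (shift_related A)"
proof -
  let ?f = "\<lambda>(s, t, F). F \<union> (\<lambda>a. a - s + t) ` (A \<inter> {s..})"
  have "B \<in> ?f ` (UNIV \<times> UNIV \<times> Collect finite)" if B: "B \<in> shift_related A" for B
  proof -
    obtain s t where st: "\<And>i. s + i \<in> A \<longleftrightarrow> t + i \<in> B"
      using B by (auto simp: shift_related_def)
    have "B = ?f (s, t, B \<inter> {..<t})"
    proof (intro equalityI subsetI)
      fix x assume x: "x \<in> B"
      show "x \<in> ?f (s, t, B \<inter> {..<t})"
      proof (cases "x < t")
        case False
        then have "s + (x - t) \<in> A"
          using st[of "x - t"] x by simp
        then show ?thesis
          using False by (auto intro!: image_eqI[of _ _ "s + (x - t)"])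
      qed (use x in auto)
    next
      fix x assume "x \<in> ?f (s, t, B \<inter> {..<t})"
      then consider "x \<in> B" | a where "x = a - s + t" "a \<in> A" "s \<le> a"
        by auto
      then show "x \<in> B"
      proof cases
        case (2 a)
        then show ?thesis
          using st[of "a - s"] by (simp add: add.commute)
      qed
    qed
    moreover have "(s, t, B \<inter> {..<t}) \<in> UNIV \<times> UNIV \<times> Collect finite"
      by simp
    ultimately show ?thesis
      by (rule image_eqI)
  qed
  then have "shift_related A \<subseteq> ?f ` (UNIV \<times> UNIV \<times> Collect finite)"
    by blast
  moreover have "countable (?f ` (UNIV \<times> UNIV \<times> Collect finite))"
    by (intro countable_image countable_SIGMA countable_Collect_finite) auto
  ultimately show ?thesis
    by (rule countable_subset)
qed

text \<open>Cantor's theorem, since only countably many sets of naturals are finite.\<close>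

lemma uncountable_infinite_subsets: "uncountable {A :: nat set. infinite A}"
proof
  assume "countable {A :: nat set. infinite A}"
  then have "countable (Collect finite \<union> {A :: nat set. infinite A})"
    using countable_Collect_finite by blast
  moreover have "Collect finite \<union> {A :: nat set. infinite A} = UNIV"
    by auto
  ultimately have "countable (UNIV :: nat set set)"
    by simp
  then have "range (from_nat_into (UNIV :: nat set set)) = UNIV"
    by (intro range_from_nat_into) simp_all
  then show False
    using Cantors_theorem[of "UNIV :: nat set"] by auto
qed

theorem corollary6p2:
  fixes q :: nat
  assumes "primepow q"
    and "CARD('k::{field,finite}) = q"
  shows "uncountable (local_isomorphism_classes
    {(PAU_group L r, PAU_topology L r :: (nat \<times> nat \<Rightarrow> 'k) set topology) | L r.
       Z_like L r \<and>
       topologically_simple (PAU_group L r :: (nat \<times> nat \<Rightarrow> 'k) set monoid) (PAU_topology L r) \<and>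
       tdlc_group (PAU_group L r :: (nat \<times> nat \<Rightarrow> 'k) set monoid) (PAU_topology L r)})"
    (is "uncountable (local_isomorphism_classes ?\<G>)")
proof
  assume count: "countable (local_isomorphism_classes ?\<G>)"
  let ?r = "\<lambda>A. block_order.rel (blocks A) {}"
  define X :: "nat set \<Rightarrow> (nat \<times> nat \<Rightarrow> 'k) set monoid \<times> (nat \<times> nat \<Rightarrow> 'k) set topology" where
    "X = (\<lambda>A. (PAU_group UNIV (?r A), PAU_topology UNIV (?r A)))"
  define iso_rel where "iso_rel = {(Y, Y'). Y \<in> ?\<G> \<and> Y' \<in> ?\<G> \<and> locally_isomorphic Y Y'}"
  let ?I = "{A :: nat set. infinite A}"
  have X: "X A \<in> ?\<G>" if "infinite A" for A
  proof -
    interpret block_order "blocks A"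
      using block_order_blocks[OF that] .
    show ?thesis
      unfolding X_def using Z_like_rel topologically_simple_PAU tdlc_PAU by blast
  qed
  have refl: "(X A, X A) \<in> iso_rel" if A: "infinite A" for A
  proof -
    interpret block_order "blocks A"
      using block_order_blocks[OF A] .
    have "locally_isomorphic (X A) (X A)"
      unfolding X_def by (intro locally_isomorphic_refl) (metis tdlc_PAU tdlc_group_def)
    then show ?thesis
      unfolding iso_rel_def by (intro CollectI case_prodI conjI X A)
  qed
  have tails: "B \<in> shift_related A" if A: "infinite A" and B: "infinite B" and iso: "(X A, X B) \<in> iso_rel"
    for A B
  proof -
    interpret A: block_order "blocks A"
      using block_order_blocks[OF A] .
    interpret B: block_order "blocks B"
      using block_order_blocks[OF B] .
    interpret block_order_pair "blocks A" "blocks B" ..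
    have "locally_isomorphic (X A) (X B)"
      using iso by (simp add: iso_rel_def)
    then obtain s t where "\<forall>i. card {x. blocks A x = s + i} = card {y. blocks B y = t + i}"
      unfolding X_def using locally_isomorphic_tails by blast
    \<comment> \<open>Block sizes are \<open>2\<close> or \<open>3\<close> according to membership,
      so equal sizes mean equal membership.\<close>
    then have "\<forall>i. s + i \<in> A \<longleftrightarrow> t + i \<in> B"
      by (simp add: card_blocks_fibre A B of_bool_eq_iff)
    then show ?thesis
      by (auto simp: shift_related_def)
  qed
  have "countable ((\<lambda>A. iso_rel `` {X A}) ` ?I)"
  proof (rule countable_subset[OF _ count])
    show "(\<lambda>A. iso_rel `` {X A}) ` ?I \<subseteq> local_isomorphism_classes ?\<G>"
      unfolding local_isomorphism_classes_def iso_rel_def using X by (intro image_subsetI quotientI) simp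
  qed
  \<comment> \<open>The class of \<open>X B\<close> contains \<open>X B\<close> by
    \<open>refl\<close>; if it equals the class of \<open>X A\<close>, then \<open>X A\<close> and
    \<open>X B\<close> are related and \<open>tails\<close> applies.\<close>
  moreover have "countable {B \<in> ?I. iso_rel `` {X B} = iso_rel `` {X A}}" if "A \<in> ?I" for A
  proof (rule countable_subset[OF _ countable_shift_related])
    show "{B \<in> ?I. iso_rel `` {X B} = iso_rel `` {X A}} \<subseteq> shift_related A"
      using that refl tails by blast
  qed
  \<comment> \<open>The infinite sets are sorted by the class of the group they define: countably
    many classes, each with a countable fibre.\<close>
  ultimately have "countable (\<Union>Y\<in>(\<lambda>A. iso_rel `` {X A}) ` ?I. {B \<in> ?I. iso_rel `` {X B} = Y})"
    by (intro countable_UN) auto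
  moreover have "(\<Union>Y\<in>(\<lambda>A. iso_rel `` {X A}) ` ?I. {B \<in> ?I. iso_rel `` {X B} = Y}) = ?I"
    by blast
  ultimately show False
    using uncountable_infinite_subsets by simp
qed

end
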